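(* Let $G=([T],\mathrm{Op},\mathrm{Inv})$ be a computable Baire presentation of a t.d.l.c. group, and let $N$ be a closed normal subgroup of $G$ such that $\mathrm{Tree}(N)=\{\sigma\in T:[\sigma]_T\cap N\neq\emptyset\}$ is a computable subtree of $T$. Then $G/N$ is computably t.d.l.c.
   Context: Trees: a tree is a nonempty prefix-closed subset of $\mathbb N^*$; $[T]$ its set of infinite paths with Baire-space topology; $[\sigma]_T=\{f\in[T]:\sigma\prec f\}$. A computable leafless tree $T$ is computably locally compact (c.l.c.) if $[T]$ is locally compact, $\{\sigma\in T:[\sigma]_T\text{ compact}\}$ is decidable, and there is a computable $H$ with $\rho(i)\le H(\sigma,i)$ for $i<|\rho|$ whenever $[\sigma]_T$ compact and $\rho\in T$ extends $\sigma$. $\Psi:[T]\to[S]$ is computable if there is a partial computable monotone $P$ from a subset of $T$ to $S$ with $\Psi(f)=\bigcup_n\{P(f\upharpoonright n):f\upharpoonright n\in\mathrm{dom}P\}$; binary functions analogously on pairs of equal-length strings. A computable Baire presentation is a topological group $([T],\mathrm{Op},\mathrm{Inv})$ with $T$ c.l.c. and $\mathrm{Op},\mathrm{Inv}$ computable. A t.d.l.c. group $H$ is computably t.d.l.c. if its meet groupoid $\mathcal W(H)$ has a Haar computable copy (equivalently, $H$ is isomorphic to a computable Baire presentation); here $\mathcal W(H)$ consists of the compact open cosets of $H$ and $\emptyset$ with inverse, intersection and partial product $A\cdot B=AB$ (defined iff for some compact open subgroup $V$, $A$ is a left and $B$ a right coset of $V$), and a copy is Haar computable if its domain is a computable subset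 of $\mathbb N$, the operations (and definedness of the product) are computable, and $(U,V)\mapsto|U:U\cap V|$ on subgroups is computable. *)

theory Defs
  imports
    "HOL-Analysis.Analysis"
    "HOL-Algebra.Left_Coset"
    "HOL-Library.Nat_Bijection"
    "HOL-Library.Sublist"
begin

section \<open>Computability\<close>

text \<open>
  Kleene's general recursive functions. A term denotes a partial function on argument
  lists, where \<^const>\<open>None\<close> means divergence; its restriction to lists of length \<open>k\<close> is
  a \<open>k\<close>-ary partial recursive function, and every such function arises in this way.
\<close>

datatype recf =
    Zero
  | Succ
  | Proj nat
  | Comp recf "recf list"
  | PrimRec recf recf
  | Minim recf

fun recf_eval :: "recf \<Rightarrow> nat list \<Rightarrow> nat option" where
  "recf_eval Zero xs = Some 0"
| "recf_eval Succ xs = (case xs of [] \<Rightarrow> None | x # _ \<Rightarrow> Some (Suc x))"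
| "recf_eval (Proj i) xs = (if i < length xs then Some (xs ! i) else None)"
| "recf_eval (Comp f gs) xs =
     (let ys = map (\<lambda>g. recf_eval g xs) gs
      in if None \<in> set ys then None else recf_eval f (map the ys))"
| "recf_eval (PrimRec f g) xs =
     (case xs of
        [] \<Rightarrow> None
      | n # ys \<Rightarrow>
          rec_nat (recf_eval f ys)
            (\<lambda>m r. case r of None \<Rightarrow> None | Some v \<Rightarrow> recf_eval g (m # v # ys)) n)"
| "recf_eval (Minim f) xs =
     (if \<exists>n. recf_eval f (n # xs) = Some 0 \<and> (\<forall>m<n. recf_eval f (m # xs) \<noteq> None)
      then Some (LEAST n. recf_eval f (n # xs) = Some 0)
      else None)"

definition computable_set :: "nat set \<Rightarrow> bool" where
  "computable_set A \<longleftrightarrow> (\<exists>e. \<forall>n. recf_eval e [n] = Some (of_bool (n \<in> A)))"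

text \<open>Strings over the natural numbers are coded by the bijection \<^const>\<open>list_encode\<close>.\<close>

definition computable_string_set :: "nat list set \<Rightarrow> bool" where
  "computable_string_set A \<longleftrightarrow> computable_set (list_encode ` A)"

definition computable_string_bound :: "(nat list \<Rightarrow> nat \<Rightarrow> nat) \<Rightarrow> bool" where
  "computable_string_bound H \<longleftrightarrow>
     (\<exists>e. \<forall>\<sigma> i. recf_eval e [list_encode \<sigma>, i] = Some (H \<sigma> i))"

definition partial_computable_string1 :: "(nat list \<Rightarrow> nat list option) \<Rightarrow> bool" where
  "partial_computable_string1 P \<longleftrightarrow>
     (\<exists>e. \<forall>\<sigma>. recf_eval e [list_encode \<sigma>] = map_option list_encode (P \<sigma>))"

definition partial_computable_string2 :: "(nat list \<Rightarrow> nat list \<Rightarrow> nat list option) \<Rightarrow> bool" where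
  "partial_computable_string2 P \<longleftrightarrow>
     (\<exists>e. \<forall>\<sigma> \<tau>. recf_eval e [list_encode \<sigma>, list_encode \<tau>] = map_option list_encode (P \<sigma> \<tau>))"

section \<open>Trees and computable functions between their path spaces\<close>

definition tree :: "nat list set \<Rightarrow> bool" where
  "tree T \<longleftrightarrow> T \<noteq> {} \<and> (\<forall>\<sigma> \<tau>. \<tau> \<in> T \<longrightarrow> prefix \<sigma> \<tau> \<longrightarrow> \<sigma> \<in> T)"

definition leafless :: "nat list set \<Rightarrow> bool" where
  "leafless T \<longleftrightarrow> (\<forall>\<sigma>\<in>T. \<exists>n. \<sigma> @ [n] \<in> T)"

definition computable_tree :: "nat list set \<Rightarrow> bool" where
  "computable_tree T \<longleftrightarrow> tree T \<and> computable_string_set T"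

definition init :: "(nat \<Rightarrow> nat) \<Rightarrow> nat \<Rightarrow> nat list" where
  "init f n = map f [0..<n]"

definition paths :: "nat list set \<Rightarrow> (nat \<Rightarrow> nat) set" where
  "paths T = {f. \<forall>n. init f n \<in> T}"

definition cone :: "nat list set \<Rightarrow> nat list \<Rightarrow> (nat \<Rightarrow> nat) set" where
  "cone T \<sigma> = {f \<in> paths T. init f (length \<sigma>) = \<sigma>}"

text \<open>
  The library topology on \<^typ>\<open>nat \<Rightarrow> nat\<close> is the product of discrete topologies, so this is
  the subspace topology inherited from Baire space.
\<close>

definition path_space :: "nat list set \<Rightarrow> (nat \<Rightarrow> nat) topology" where
  "path_space T = top_of_set (paths T)"

definition comp_locally_compact :: "nat list set \<Rightarrow> bool" where
  "comp_locally_compact T \<longleftrightarrow>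
     computable_tree T \<and> leafless T \<and>
     locally_compact_space (path_space T) \<and>
     computable_string_set {\<sigma> \<in> T. compactin (path_space T) (cone T \<sigma>)} \<and>
     (\<exists>H. computable_string_bound H \<and>
        (\<forall>\<sigma>\<in>T. compactin (path_space T) (cone T \<sigma>) \<longrightarrow>
           (\<forall>\<rho>\<in>T. prefix \<sigma> \<rho> \<longrightarrow> (\<forall>i<length \<rho>. \<rho> ! i \<le> H \<sigma> i))))"

text \<open>
  A string is identified with its graph, a finite partial function, in order to express
  that a path is the union of a family of strings.
\<close>

definition string_graph :: "nat list \<Rightarrow> (nat \<times> nat) set" where
  "string_graph \<sigma> = {(i, \<sigma> ! i) | i. i < length \<sigma>}"

definition path_graph :: "(nat \<Rightarrow> nat) \<Rightarrow> (nat \<times> nat) set" where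
  "path_graph f = {(i, f i) | i. True}"

definition computable_path_fun ::
  "nat list set \<Rightarrow> nat list set \<Rightarrow> ((nat \<Rightarrow> nat) \<Rightarrow> (nat \<Rightarrow> nat)) \<Rightarrow> bool" where
  "computable_path_fun T S \<Psi> \<longleftrightarrow>
     \<Psi> ` paths T \<subseteq> paths S \<and>
     (\<exists>P. partial_computable_string1 P \<and>
        (\<forall>\<sigma> \<rho>. P \<sigma> = Some \<rho> \<longrightarrow> \<sigma> \<in> T \<and> \<rho> \<in> S) \<and>
        (\<forall>\<sigma> \<sigma>' \<rho> \<rho>'. P \<sigma> = Some \<rho> \<longrightarrow> P \<sigma>' = Some \<rho>' \<longrightarrow>
           prefix \<sigma> \<sigma>' \<longrightarrow> prefix \<rho> \<rho>') \<and>
        (\<forall>f\<in>paths T.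
           path_graph (\<Psi> f) = (\<Union>{string_graph \<rho> | \<rho> n. P (init f n) = Some \<rho>})))"

definition computable_path_fun2 ::
  "nat list set \<Rightarrow> nat list set \<Rightarrow> ((nat \<Rightarrow> nat) \<Rightarrow> (nat \<Rightarrow> nat) \<Rightarrow> (nat \<Rightarrow> nat)) \<Rightarrow> bool" where
  "computable_path_fun2 T S \<Psi> \<longleftrightarrow>
     (\<forall>f\<in>paths T. \<forall>g\<in>paths T. \<Psi> f g \<in> paths S) \<and>
     (\<exists>P. partial_computable_string2 P \<and>
        (\<forall>\<sigma> \<tau> \<rho>. P \<sigma> \<tau> = Some \<rho> \<longrightarrow>
           \<sigma> \<in> T \<and> \<tau> \<in> T \<and> length \<sigma> = length \<tau> \<and> \<rho> \<in> S) \<and>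
        (\<forall>\<sigma> \<tau> \<sigma>' \<tau>' \<rho> \<rho>'. P \<sigma> \<tau> = Some \<rho> \<longrightarrow> P \<sigma>' \<tau>' = Some \<rho>' \<longrightarrow>
           prefix \<sigma> \<sigma>' \<longrightarrow> prefix \<tau> \<tau>' \<longrightarrow> prefix \<rho> \<rho>') \<and>
        (\<forall>f\<in>paths T. \<forall>g\<in>paths T.
           path_graph (\<Psi> f g) =
             (\<Union>{string_graph \<rho> | \<rho> n. P (init f n) (init g n) = Some \<rho>})))"

definition subtree_of :: "nat list set \<Rightarrow> (nat \<Rightarrow> nat) set \<Rightarrow> nat list set" where
  "subtree_of T N = {\<sigma> \<in> T. cone T \<sigma> \<inter> N \<noteq> {}}"

section \<open>Topological groups\<close>

definition topological_group :: "('a, 'm) monoid_scheme \<Rightarrow> 'a topology \<Rightarrow> bool" where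
  "topological_group G X \<longleftrightarrow>
     group G \<and> topspace X = carrier G \<and>
     continuous_map (prod_topology X X) X (\<lambda>(x, y). x \<otimes>\<^bsub>G\<^esub> y) \<and>
     continuous_map X X (\<lambda>x. inv\<^bsub>G\<^esub> x)"

definition totally_disconnected_space :: "'a topology \<Rightarrow> bool" where
  "totally_disconnected_space X \<longleftrightarrow> (\<forall>S. connectedin X S \<longrightarrow> (\<exists>a. S \<subseteq> {a}))"

definition tdlc_group :: "('a, 'm) monoid_scheme \<Rightarrow> 'a topology \<Rightarrow> bool" where
  "tdlc_group G X \<longleftrightarrow>
     topological_group G X \<and> Hausdorff_space X \<and>
     totally_disconnected_space X \<and> locally_compact_space X"

text \<open>
  The operations \<open>Op\<close> and \<open>Inv\<close> of a Baire presentation are the multiplication and the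
  inversion of the group structure \<open>G\<close> on \<open>[T]\<close>.
\<close>

definition computable_Baire_presentation ::
  "nat list set \<Rightarrow> ((nat \<Rightarrow> nat), 'm) monoid_scheme \<Rightarrow> bool" where
  "computable_Baire_presentation T G \<longleftrightarrow>
     comp_locally_compact T \<and>
     carrier G = paths T \<and> topological_group G (path_space T) \<and>
     computable_path_fun2 T T (mult G) \<and> computable_path_fun T T (m_inv G)"

definition quotient_topology :: "'a topology \<Rightarrow> ('a \<Rightarrow> 'b) \<Rightarrow> 'b topology" where
  "quotient_topology X f =
     topology (\<lambda>U. U \<subseteq> f ` topspace X \<and> openin X {x \<in> topspace X. f x \<in> U})"

lemma openin_quotient_topology:
  "openin (quotient_topology X f) U \<longleftrightarrow>
     U \<subseteq> f ` topspace X \<and> openin X {x \<in> topspace X. f x \<in> U}"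
proof -
  let ?L = "\<lambda>U. U \<subseteq> f ` topspace X \<and> openin X {x \<in> topspace X. f x \<in> U}"
  have "istopology ?L"
    unfolding istopology_def
  proof (intro conjI allI impI)
    fix S S' assume S: "?L S" and S': "?L S'"
    show "S \<inter> S' \<subseteq> f ` topspace X"
      using S by blast
    have eq: "{x \<in> topspace X. f x \<in> S \<inter> S'} =
        {x \<in> topspace X. f x \<in> S} \<inter> {x \<in> topspace X. f x \<in> S'}" by blast
    show "openin X {x \<in> topspace X. f x \<in> S \<inter> S'}"
      unfolding eq using S S' by (intro openin_Int) simp_all
  next
    fix \<K> assume K: "\<forall>K\<in>\<K>. ?L K"
    show "\<Union>\<K> \<subseteq> f ` topspace X"
      using K by (intro Union_least) simp
    have eq: "{x \<in> topspace X. f x \<in> \<Union>\<K>} = \<Union>((\<lambda>K. {x \<in> topspace X. f x \<in> K}) ` \<K>)"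
      by blast
    show "openin X {x \<in> topspace X. f x \<in> \<Union>\<K>}"
      unfolding eq
    proof (rule openin_Union)
      fix S assume "S \<in> (\<lambda>K. {x \<in> topspace X. f x \<in> K}) ` \<K>"
      then obtain K where "K \<in> \<K>" "S = {x \<in> topspace X. f x \<in> K}" by (rule imageE)
      then show "openin X S" using K by simp
    qed
  qed
  then show ?thesis
    unfolding quotient_topology_def by (simp add: topology_inverse')
qed

lemma quotient_map_quotient_topology:
  "quotient_map X (quotient_topology X f) f"
proof -
  have "topspace (quotient_topology X f) \<subseteq> f ` topspace X"
    by (meson openin_quotient_topology openin_topspace)
  moreover have "f ` topspace X \<subseteq> topspace (quotient_topology X f)"
  proof (rule openin_subset)
    have "{x \<in> topspace X. f x \<in> f ` topspace X} = topspace X" by blast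
    then show "openin (quotient_topology X f) (f ` topspace X)"
      by (simp only: openin_quotient_topology openin_topspace subset_refl simp_thms)
  qed
  ultimately have eq: "topspace (quotient_topology X f) = f ` topspace X" by (rule equalityI)
  show ?thesis
    unfolding quotient_map_def eq by (simp add: openin_quotient_topology)
qed

definition quotient_group_topology ::
  "('a, 'm) monoid_scheme \<Rightarrow> 'a topology \<Rightarrow> 'a set \<Rightarrow> 'a set topology" where
  "quotient_group_topology G X N = quotient_topology X (\<lambda>x. N #>\<^bsub>G\<^esub> x)"

section \<open>Meet groupoids\<close>

record 'a meet_groupoid =
  mg_carrier :: "'a set"
  mg_inv :: "'a \<Rightarrow> 'a"
  mg_meet :: "'a \<Rightarrow> 'a \<Rightarrow> 'a"
  mg_prod :: "'a \<Rightarrow> 'a \<Rightarrow> 'a option"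

definition mg_closed :: "'a meet_groupoid \<Rightarrow> bool" where
  "mg_closed W \<longleftrightarrow>
     (\<forall>a\<in>mg_carrier W. mg_inv W a \<in> mg_carrier W) \<and>
     (\<forall>a\<in>mg_carrier W. \<forall>b\<in>mg_carrier W. mg_meet W a b \<in> mg_carrier W) \<and>
     (\<forall>a\<in>mg_carrier W. \<forall>b\<in>mg_carrier W. \<forall>c. mg_prod W a b = Some c \<longrightarrow> c \<in> mg_carrier W)"

definition mg_iso :: "('a \<Rightarrow> 'b) \<Rightarrow> 'a meet_groupoid \<Rightarrow> 'b meet_groupoid \<Rightarrow> bool" where
  "mg_iso h V W \<longleftrightarrow>
     bij_betw h (mg_carrier V) (mg_carrier W) \<and>
     (\<forall>a\<in>mg_carrier V. h (mg_inv V a) = mg_inv W (h a)) \<and>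
     (\<forall>a\<in>mg_carrier V. \<forall>b\<in>mg_carrier V. h (mg_meet V a b) = mg_meet W (h a) (h b)) \<and>
     (\<forall>a\<in>mg_carrier V. \<forall>b\<in>mg_carrier V. map_option h (mg_prod V a b) = mg_prod W (h a) (h b))"

definition compact_open_subgroups :: "('a, 'm) monoid_scheme \<Rightarrow> 'a topology \<Rightarrow> 'a set set" where
  "compact_open_subgroups G X = {U. subgroup U G \<and> compactin X U \<and> openin X U}"

text \<open>
  Cosets are nonempty, so a product with the empty set as a factor is always undefined here.
\<close>

definition meet_groupoid_of :: "('a, 'm) monoid_scheme \<Rightarrow> 'a topology \<Rightarrow> 'a set meet_groupoid" where
  "meet_groupoid_of G X =
     \<lparr> mg_carrier =
         insert {} (\<Union>V\<in>compact_open_subgroups G X. (lcosets\<^bsub>G\<^esub> V) \<union> (rcosets\<^bsub>G\<^esub> V)),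
       mg_inv = (\<lambda>A. set_inv\<^bsub>G\<^esub> A),
       mg_meet = (\<lambda>A B. A \<inter> B),
       mg_prod = (\<lambda>A B.
         if \<exists>V\<in>compact_open_subgroups G X. A \<in> lcosets\<^bsub>G\<^esub> V \<and> B \<in> rcosets\<^bsub>G\<^esub> V
         then Some (A <#>\<^bsub>G\<^esub> B) else None) \<rparr>"

definition subgroup_index :: "('a, 'm) monoid_scheme \<Rightarrow> 'a set \<Rightarrow> 'a set \<Rightarrow> nat" where
  "subgroup_index G U V = card (lcosets\<^bsub>G\<lparr>carrier := U\<rparr>\<^esub> V)"

text \<open>
  The programs below are unconstrained off the carrier, off the domain of the product and off
  the codes of subgroups. These domains are all decidable in a copy (a code \<open>u\<close> stands for a
  subgroup iff \<open>u \<cdot> u\<close> is defined and equal to \<open>u\<close>), so this loses no generality. Off the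
  carrier, the functions in \<open>W\<close> are irrelevant.
\<close>

definition Haar_computable_copy ::
  "nat meet_groupoid \<Rightarrow> ('a, 'm) monoid_scheme \<Rightarrow> 'a topology \<Rightarrow> bool" where
  "Haar_computable_copy W G X \<longleftrightarrow>
     mg_closed W \<and>
     computable_set (mg_carrier W) \<and>
     (\<exists>e. \<forall>a\<in>mg_carrier W. recf_eval e [a] = Some (mg_inv W a)) \<and>
     (\<exists>e. \<forall>a\<in>mg_carrier W. \<forall>b\<in>mg_carrier W. recf_eval e [a, b] = Some (mg_meet W a b)) \<and>
     (\<exists>e. \<forall>a\<in>mg_carrier W. \<forall>b\<in>mg_carrier W.
        recf_eval e [a, b] = Some (of_bool (mg_prod W a b \<noteq> None))) \<and>
     (\<exists>e. \<forall>a\<in>mg_carrier W. \<forall>b\<in>mg_carrier W. \<forall>c.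
        mg_prod W a b = Some c \<longrightarrow> recf_eval e [a, b] = Some c) \<and>
     (\<exists>h. mg_iso h W (meet_groupoid_of G X) \<and>
        (\<exists>e. \<forall>u\<in>mg_carrier W. \<forall>v\<in>mg_carrier W. subgroup (h u) G \<longrightarrow> subgroup (h v) G \<longrightarrow>
           recf_eval e [u, v] = Some (subgroup_index G (h u) (h u \<inter> h v))))"

definition computably_tdlc :: "('a, 'm) monoid_scheme \<Rightarrow> 'a topology \<Rightarrow> bool" where
  "computably_tdlc G X \<longleftrightarrow> tdlc_group G X \<and> (\<exists>W. Haar_computable_copy W G X)"

end

theory Submission
  imports Defs
begin

text \<open>\<open>N\<close> need not be compact, so whether a path lies in a coset cannot be
  settled by a finite search through \<open>N\<close>. It can only be confirmed, by a string of the
  tree of \<open>N\<close>; the confirmation is sound because every such string is extended by an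
  actual element of \<open>N\<close>. Strings outside that tree confirm that two cosets differ.
  Decidability of the tree serves both purposes. Compactness enters through cones of
  \<open>G\<close>, whose branching is bounded by \<open>H\<close>. Points of the quotient are
  accessible only through neighbourhoods, so the failure of a closure condition has to be witnessed
  by coded sets around the offending points, whereas exact equalities of sets are replaced by
  inclusions arranged to bound a set from both sides. No program for an operation of the groupoid is
  written down: each one is an unbounded search through a semidecidable relation whose value is
  unique on the domain in question. Least codes are taken because a copy must be in bijection with
  the groupoid; they can be recognized because equality of coded sets is decidable.\<close>

text \<open>
  For strings \<open>\<sigma>\<close> with compact cone, the images of the cones \<open>[\<sigma>]\<close> form a base of compact open
  sets of \<open>G/N\<close>, so every compact open set is coded by a finite list of strings. Continuity of the
  group operations and closedness of \<open>N\<close> are witnessed by finite strings, and compactness reduces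
  conditions on all paths of a cone to finitely many such witnesses; hence inclusion, disjointness,
  products and inverses of coded sets are semidecidable. For example \<open>fN\<close> lies in the image of
  \<open>[\<rho>]\<close> iff some \<open>\<nu>\<close> in the tree of \<open>N\<close> makes the program for the product output an extension of
  \<open>\<rho>\<close> on a prefix of \<open>f\<close> and \<open>\<nu>\<close>, and \<open>fN \<noteq> gN\<close> iff \<open>f\<inverse>g\<close> has a prefix outside that tree.
  Differences of coded sets are coded as well, so inclusion is decidable. A set \<open>A\<close> is empty or a
  coset iff \<open>AA\<inverse>A \<subseteq> A\<close>, which is decidable too, and the least codes of the compact open cosets form
  the required copy of the meet groupoid: its operations and the index have semidecidable graphs.
\<close>

section \<open>Computable functions, decidable and semidecidable predicates\<close>

text \<open>Codes are bijections with the natural numbers, so every number decodes and an unbounded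
  search over numbers is a search over the type.\<close>

class code =
  fixes enc :: "'a \<Rightarrow> nat"
  assumes bij_enc: "bij enc"

lemma enc_eq_iff [simp]: "enc x = enc y \<longleftrightarrow> x = y"
  using bij_enc by (metis bij_pointE)

definition dec :: "nat \<Rightarrow> 'a::code" where
  "dec = inv_into UNIV enc"

lemma dec_enc [simp]: "dec (enc x) = x"
  by (simp add: dec_def bij_is_inj bij_enc)

lemma enc_dec [simp]: "enc (dec n :: 'a::code) = n"
  by (simp add: dec_def bij_is_surj bij_enc surj_f_inv_f)

instantiation nat :: code
begin
definition enc_nat :: "nat \<Rightarrow> nat" where "enc_nat n = n"
instance by standard (simp add: enc_nat_def [abs_def] bij_def)
end

instantiation prod :: (code, code) code
begin
definition enc_prod :: "'a \<times> 'b \<Rightarrow> nat" where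
  "enc_prod p = prod_encode (map_prod enc enc p)"
instance
proof
  have "enc = prod_encode \<circ> (map_prod enc enc :: 'a \<times> 'b \<Rightarrow> _)"
    by (auto simp: enc_prod_def fun_eq_iff)
  moreover have "bij (map_prod enc enc :: 'a \<times> 'b \<Rightarrow> _)"
    unfolding bij_def by (simp add: prod.inj_map bij_is_inj bij_enc map_prod_surj bij_is_surj)
  ultimately show "bij (enc :: 'a \<times> 'b \<Rightarrow> nat)"
    by (metis bij_comp bij_prod_encode)
qed
end

instantiation list :: (code) code
begin
definition enc_list :: "'a list \<Rightarrow> nat" where
  "enc_list xs = list_encode (map enc xs)"
instance
proof
  have "enc = list_encode \<circ> (map enc :: 'a list \<Rightarrow> _)"
    by (auto simp: enc_list_def fun_eq_iff)
  moreover have "bij (map enc :: 'a list \<Rightarrow> _)"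
    unfolding bij_def by (metis bij_enc bij_is_inj bij_is_surj inj_mapI lists_UNIV lists_image surjI surj_f_inv_f map_map list.map_id0 id_apply surj_iff list.map_comp)
  ultimately show "bij (enc :: 'a list \<Rightarrow> nat)"
    by (metis bij_comp bij_list_encode)
qed
end

lemma enc_nat [simp]: "enc (n::nat) = n"
  by (simp add: enc_nat_def)

lemma enc_Pair [simp]: "enc (x, y) = prod_encode (enc x, enc y)"
  by (simp add: enc_prod_def)

text \<open>Identifies the generic coding of strings with the coding used in the notions of
  computability for trees and path functions.\<close>

lemma enc_string: "enc (\<sigma> :: nat list) = list_encode \<sigma>"
  by (simp add: enc_list_def enc_nat_def [abs_def])

lemma enc_Cons [simp]: "enc (x # xs) = Suc (prod_encode (enc x, enc xs))"
  by (simp add: enc_list_def)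

lemma enc_Nil [simp]: "enc [] = 0"
  by (simp add: enc_list_def)

subsection \<open>Basic programs\<close>

declare recf_eval.simps [simp del]

lemma eval_basic [simp]:
  "recf_eval Zero xs = Some 0"
  "recf_eval Succ (x # xs) = Some (Suc x)"
  "i < length xs \<Longrightarrow> recf_eval (Proj i) xs = Some (xs ! i)"
  by (simp_all add: recf_eval.simps)

lemma eval_Comp1 [simp]:
  "recf_eval g xs = Some y \<Longrightarrow> recf_eval (Comp f [g]) xs = recf_eval f [y]"
  by (simp add: recf_eval.simps)

lemma eval_Comp2 [simp]:
  "recf_eval g xs = Some y \<Longrightarrow> recf_eval h xs = Some z \<Longrightarrow>
    recf_eval (Comp f [g, h]) xs = recf_eval f [y, z]"
  by (simp add: recf_eval.simps)

lemma eval_PrimRec: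
  assumes "recf_eval f ys = Some a" and "\<And>m v. recf_eval g (m # v # ys) = Some (b m v)"
  shows "recf_eval (PrimRec f g) (n # ys) = Some (rec_nat a b n)"
  by (induction n) (simp_all add: recf_eval.simps assms)

lemma eval_Minim:
  assumes "\<And>n. recf_eval f (n # xs) = Some (a n)" and "\<exists>n. a n = 0"
  shows "recf_eval (Minim f) xs = Some (LEAST n. a n = 0)"
  using assms by (simp add: recf_eval.simps)

definition "r_add = PrimRec (Proj 0) (Comp Succ [Proj 1])"
definition "r_pred = PrimRec Zero (Proj 0)"
definition "r_sub = PrimRec (Proj 0) (Comp r_pred [Proj 1])"
definition "r_triangle = PrimRec Zero (Comp r_add [Comp Succ [Proj 0], Proj 1])"
definition "r_pair = Comp r_add [Comp r_triangle [r_add], Proj 0]"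
definition "r_diag = Minim (Comp r_sub [Comp r_triangle [Comp Succ [Proj 0]], Comp Succ [Proj 1]])"
text \<open>As \<open>prod_encode (a, b)\<close> equals \<open>triangle (a + b) + a\<close>, the
  diagonal found by \<open>r_diag\<close> determines both components by subtraction. The number to
  be subtracted is the first argument of \<open>r_sub\<close>, because primitive recursion runs over
  the first argument.\<close>

definition "r_fst = Comp r_sub [Comp r_triangle [r_diag], Proj 0]"
definition "r_snd = Comp r_sub [r_fst, r_diag]"

lemma eval_add [simp]: "recf_eval r_add [m, n] = Some (m + n)"
proof -
  have "rec_nat n (\<lambda>_. Suc) m = m + n" by (induction m) auto
  then show ?thesis unfolding r_add_def by (subst eval_PrimRec [where b = "\<lambda>_. Suc"]) auto
qed

lemma eval_pred [simp]: "recf_eval r_pred [n] = Some (n - 1)"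
proof -
  have "rec_nat 0 (\<lambda>m _. m) n = n - 1" by (cases n) auto
  then show ?thesis unfolding r_pred_def by (subst eval_PrimRec [where b = "\<lambda>m _. m"]) auto
qed

lemma eval_sub [simp]: "recf_eval r_sub [n, m] = Some (m - n)"
proof -
  have "rec_nat m (\<lambda>_ v. v - 1) n = m - n" by (induction n) auto
  then show ?thesis unfolding r_sub_def by (subst eval_PrimRec [where b = "\<lambda>_ v. v - 1"]) auto
qed

lemma eval_triangle [simp]: "recf_eval r_triangle [n] = Some (triangle n)"
proof -
  have "rec_nat 0 (\<lambda>m v. Suc (m + v)) n = triangle n" by (induction n) auto
  then show ?thesis unfolding r_triangle_def by (subst eval_PrimRec [where b = "\<lambda>m v. Suc (m + v)"]) auto
qed

lemma eval_pair [simp]: "recf_eval r_pair [m, n] = Some (prod_encode (m, n))"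
  by (simp add: r_pair_def prod_encode_def)

lemma triangle_mono: "m \<le> n \<Longrightarrow> triangle m \<le> triangle n"
  by (induction n rule: nat_induct_at_least) (auto intro: lift_Suc_mono_le [of triangle])

text \<open>The diagonal \<open>a + b\<close> of \<open>prod_encode (a, b)\<close> is the least \<open>s\<close> with
  \<open>prod_encode (a, b) < triangle (s + 1)\<close>.\<close>

lemma eval_diag [simp]: "recf_eval r_diag [prod_encode (a, b)] = Some (a + b)"
proof -
  let ?n = "prod_encode (a, b)"
  have "(LEAST s. Suc ?n - triangle (Suc s) = 0) = a + b"
  proof (rule Least_equality)
    show "Suc ?n - triangle (Suc (a + b)) = 0" by (simp add: prod_encode_def)
  next
    fix s assume s: "Suc ?n - triangle (Suc s) = 0"
    show "a + b \<le> s"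
    proof (rule ccontr)
      assume "\<not> a + b \<le> s"
      then have "triangle (Suc s) \<le> triangle (a + b)" by (intro triangle_mono) simp
      with s show False by (simp add: prod_encode_def)
    qed
  qed
  moreover have "\<exists>s. Suc ?n - triangle (Suc s) = 0"
    by (rule exI [of _ "a + b"]) (simp add: prod_encode_def)
  ultimately show ?thesis
    unfolding r_diag_def
    by (subst eval_Minim [where a = "\<lambda>s. Suc ?n - triangle (Suc s)"]) simp_all
qed

lemma eval_fst [simp]: "recf_eval r_fst [prod_encode (a, b)] = Some a"
  by (simp add: r_fst_def) (simp add: prod_encode_def)

lemma eval_snd [simp]: "recf_eval r_snd [prod_encode (a, b)] = Some b"
  by (simp add: r_snd_def)

subsection \<open>Computable functions\<close>

text \<open>Programs take a single code; several arguments are paired, so that composition and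
  pairing account for all arities.\<close>

definition computable :: "('a::code \<Rightarrow> 'b::code) \<Rightarrow> bool" where
  "computable f \<longleftrightarrow> (\<exists>e. \<forall>x. recf_eval e [enc x] = Some (enc (f x)))"

lemma computableI: "(\<And>x. recf_eval e [enc x] = Some (enc (f x))) \<Longrightarrow> computable f"
  unfolding computable_def by blast

lemma computableE:
  assumes "computable f"
  obtains e where "\<And>x. recf_eval e [enc x] = Some (enc (f x))"
  using assms unfolding computable_def by blast

named_theorems computable_intros

lemma computable_comp:
  assumes "computable f" "computable g"
  shows "computable (\<lambda>x. f (g x))"
proof -
  obtain e where "\<And>x. recf_eval e [enc x] = Some (enc (f x))" using assms(1) by (rule computableE) blast
  moreover obtain e' where "\<And>x. recf_eval e' [enc x] = Some (enc (g x))"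
    using assms(2) by (rule computableE) blast
  ultimately show ?thesis by (intro computableI [of "Comp e [e']"]) simp
qed

lemma computable_id [computable_intros]: "computable (\<lambda>x. x)"
  by (rule computableI [of "Proj 0"]) simp

lemma computable_const [computable_intros]: "computable (\<lambda>x. c)"
proof -
  have "\<exists>e. \<forall>xs. recf_eval e xs = Some n" for n
  proof (induction n)
    case 0
    then show ?case by (intro exI [of _ Zero]) simp
  next
    case (Suc n)
    then obtain e where "\<forall>xs. recf_eval e xs = Some n" by blast
    then show ?case by (intro exI [of _ "Comp Succ [e]"]) simp
  qed
  then show ?thesis unfolding computable_def by metis
qed

lemma computable_enc [computable_intros]: "computable g \<Longrightarrow> computable (\<lambda>x. enc (g x))"
  unfolding computable_def by simp

lemma computable_dec [computable_intros]: "computable g \<Longrightarrow> computable (\<lambda>x. dec (g x))"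
  unfolding computable_def by simp

lemma computable_binary:
  assumes e: "\<And>a b. recf_eval e [enc a, enc b] = Some (enc (f a b))"
    and "computable g" "computable h"
  shows "computable (\<lambda>x. f (g x) (h x))"
proof -
  obtain e1 where "\<And>x. recf_eval e1 [enc x] = Some (enc (g x))" using assms(2) by (rule computableE) blast
  moreover obtain e2 where "\<And>x. recf_eval e2 [enc x] = Some (enc (h x))"
    using assms(3) by (rule computableE) blast
  ultimately show ?thesis by (intro computableI [of "Comp e [e1, e2]"]) (simp add: e)
qed

lemma computable_Pair [computable_intros]:
  "computable g \<Longrightarrow> computable h \<Longrightarrow> computable (\<lambda>x. (g x, h x))"
  by (rule computable_binary [of r_pair Pair]) simp_all

lemma computable_fst [computable_intros]: "computable g \<Longrightarrow> computable (\<lambda>x. fst (g x))"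
  by (rule computable_comp [of fst]) (auto intro: computableI [of r_fst] simp: enc_prod_def map_prod_def)

lemma computable_snd [computable_intros]: "computable g \<Longrightarrow> computable (\<lambda>x. snd (g x))"
  by (rule computable_comp [of snd]) (auto intro: computableI [of r_snd] simp: enc_prod_def map_prod_def)

lemma computable_comp2:
  "computable (\<lambda>p. f (fst p) (snd p)) \<Longrightarrow> computable g \<Longrightarrow> computable h \<Longrightarrow>
    computable (\<lambda>x. f (g x) (h x))"
  using computable_comp [of "\<lambda>p. f (fst p) (snd p)" "\<lambda>x. (g x, h x)"]
  by (simp add: computable_Pair)

lemma computable_Suc [computable_intros]: "computable g \<Longrightarrow> computable (\<lambda>x. Suc (g x))"
  by (rule computable_comp [of Suc]) (auto intro: computableI [of Succ])

lemma computable_add [computable_intros]: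
  fixes g h :: "'a::code \<Rightarrow> nat"
  shows "computable g \<Longrightarrow> computable h \<Longrightarrow> computable (\<lambda>x. g x + h x)"
  by (rule computable_binary [of r_add]) simp_all

lemma computable_diff [computable_intros]:
  fixes g h :: "'a::code \<Rightarrow> nat"
  assumes "computable g" "computable h"
  shows "computable (\<lambda>x. g x - h x)"
  by (rule computable_binary [of r_sub "\<lambda>a b. b - a", OF _ assms(2,1)]) simp

lemma computable_rec_nat:
  assumes g: "computable g" and h: "computable (\<lambda>p. h (fst p) (fst (snd p)) (snd (snd p)))"
    and n: "computable n"
  shows "computable (\<lambda>x. rec_nat (g x) (h x) (n x))"
proof -
  obtain eg where eg: "\<And>x. recf_eval eg [enc x] = Some (enc (g x))" using g by (rule computableE) blast
  obtain eh where eh: "\<And>x. recf_eval eh [enc x] = Some (enc (h (fst x) (fst (snd x)) (snd (snd x))))"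
    using h by (rule computableE) blast
  \<comment> \<open>\<open>PrimRec\<close> passes the counter, the previous value and the parameter
    in this order; \<open>k\<close> regroups them into the triple that \<open>h\<close>
    expects.\<close>
  define k where "k = Comp eh [Comp r_pair [Proj 2, Comp r_pair [Proj 0, Proj 1]]]"
  have k: "recf_eval k [m, v, enc x] = Some (enc (h x m (dec v)))" for m v x
    using eh [of "(x, m, dec v)"] by (simp add: k_def)
  have rec: "rec_nat (enc a) (\<lambda>m v. enc (b m (dec v))) j = enc (rec_nat a b j)"
    for a :: 'b and b j by (induction j) simp_all
  have "recf_eval (PrimRec eg k) [enc m, enc x] = Some (enc (rec_nat (g x) (h x) m))" for m x
    using eval_PrimRec [of eg "[enc x]" _ k, OF eg k] by (simp add: rec)
  then show ?thesis
    using computable_binary [of "PrimRec eg k" "\<lambda>m x. rec_nat (g x) (h x) m", OF _ n computable_id]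
    by simp
qed

lemma computable_Least_zero:
  fixes f :: "'a::code \<Rightarrow> nat \<Rightarrow> nat"
  assumes "computable (\<lambda>p. f (fst p) (snd p))" and ex: "\<And>x. \<exists>n. f x n = 0"
  shows "computable (\<lambda>x. LEAST n. f x n = 0)"
proof -
  obtain e where e: "\<And>p. recf_eval e [enc p] = Some (enc (f (fst p) (snd p)))"
    using assms(1) by (rule computableE) blast
  have e': "recf_eval (Comp e [Comp r_pair [Proj 1, Proj 0]]) [n, enc x] = Some (f x n)" for n x
    using e [of "(x, n)"] by simp
  show ?thesis
  proof (rule computableI)
    show "recf_eval (Minim (Comp e [Comp r_pair [Proj 1, Proj 0]])) [enc x] = Some (enc (LEAST n. f x n = 0))" for x
      using ex by (subst eval_Minim [OF e']) simp_all
  qed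
qed

subsection \<open>Decidable predicates\<close>

definition decidable :: "('a::code \<Rightarrow> bool) \<Rightarrow> bool" where
  "decidable P \<longleftrightarrow> computable (\<lambda>x. of_bool (P x) :: nat)"

lemma decidable_comp:
  "decidable P \<Longrightarrow> computable g \<Longrightarrow> decidable (\<lambda>x. P (g x))"
  unfolding decidable_def by (rule computable_comp)

lemma decidable_comp2:
  "decidable (\<lambda>p. R (fst p) (snd p)) \<Longrightarrow> computable g \<Longrightarrow> computable h \<Longrightarrow>
    decidable (\<lambda>x. R (g x) (h x))"
  unfolding decidable_def by (rule computable_comp2)

lemma decidable_eq_0 [computable_intros]:
  "computable g \<Longrightarrow> decidable (\<lambda>x. g x = (0::nat))"
proof -
  assume "computable g"
  then have "computable (\<lambda>x. 1 - g x)" by (intro computable_intros)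
  moreover have "1 - g x = of_bool (g x = 0)" for x by auto
  ultimately show ?thesis unfolding decidable_def by simp
qed

lemma decidable_not [computable_intros]: "decidable P \<Longrightarrow> decidable (\<lambda>x. \<not> P x)"
proof -
  assume "decidable P"
  then have "decidable (\<lambda>x. of_bool (P x) = (0::nat))"
    unfolding decidable_def [of P] by (rule decidable_eq_0)
  then show ?thesis by simp
qed

lemma decidable_conj [computable_intros]:
  assumes "decidable P" "decidable Q" shows "decidable (\<lambda>x. P x \<and> Q x)"
proof -
  have "decidable (\<lambda>x. of_bool (\<not> P x) + of_bool (\<not> Q x) = (0::nat))"
    using assms [THEN decidable_not]
    unfolding decidable_def [of "\<lambda>x. \<not> _ x"] by (intro computable_intros)
  then show ?thesis by simp
qed

lemma decidable_disj [computable_intros]: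
  assumes "decidable P" "decidable Q" shows "decidable (\<lambda>x. P x \<or> Q x)"
proof -
  have "decidable (\<lambda>x. \<not> (\<not> P x \<and> \<not> Q x))"
    using assms by (intro computable_intros)
  then show ?thesis by simp
qed

lemma decidable_imp [computable_intros]:
  assumes "decidable P" "decidable Q" shows "decidable (\<lambda>x. P x \<longrightarrow> Q x)"
proof -
  have "decidable (\<lambda>x. \<not> P x \<or> Q x)"
    using assms by (intro computable_intros)
  then show ?thesis by (simp only: imp_conv_disj)
qed

lemma decidable_le [computable_intros]:
  assumes "computable g" "computable h" shows "decidable (\<lambda>x. g x \<le> (h x::nat))"
proof -
  have "decidable (\<lambda>x. g x - h x = 0)"
    using assms by (intro computable_intros)
  then show ?thesis by simp
qed

lemma decidable_less [computable_intros]: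
  assumes "computable g" "computable h" shows "decidable (\<lambda>x. g x < (h x::nat))"
proof -
  have "decidable (\<lambda>x. Suc (g x) \<le> h x)"
    using assms by (intro computable_intros)
  then show ?thesis by (simp add: Suc_le_eq)
qed

lemma decidable_eq [computable_intros]:
  assumes "computable g" "computable h" shows "decidable (\<lambda>x. g x = h x)"
proof -
  have "decidable (\<lambda>x. enc (g x) \<le> enc (h x) \<and> enc (h x) \<le> enc (g x))"
    using assms by (intro computable_intros)
  moreover have "enc (g x) \<le> enc (h x) \<and> enc (h x) \<le> enc (g x) \<longleftrightarrow> g x = h x" for x
    by (metis antisym enc_eq_iff order_refl)
  ultimately show ?thesis by simp
qed

lemma computable_Least:
  assumes "decidable (\<lambda>p. P (fst p) (snd p))" and "\<And>x. \<exists>n. P x n"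
  shows "computable (\<lambda>x. LEAST n. P x (n::nat))"
proof -
  have "computable (\<lambda>x. LEAST n. of_bool (\<not> P x n) = (0::nat))"
    using assms(2) decidable_not [OF assms(1)] unfolding decidable_def
    by (intro computable_Least_zero) simp_all
  then show ?thesis by simp
qed

text \<open>The search for a counterexample always stops, at the bound at the latest, and the
  quantified statement holds iff the search reaches the bound.\<close>

lemma decidable_all_less [computable_intros]:
  assumes "decidable (\<lambda>p. P (fst p) (snd p))" and "computable b"
  shows "decidable (\<lambda>x. \<forall>i<b x. P x (i::nat))"
proof -
  have ex: "\<exists>i. b x \<le> i \<or> \<not> P x i" for x by blast
  have b: "computable (\<lambda>p. b (fst p))" using assms(2) by (rule computable_comp) (intro computable_intros)
  have "decidable (\<lambda>x. b x \<le> (LEAST i. b x \<le> i \<or> \<not> P x i))"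
    using assms b by (intro computable_intros computable_Least ex)
  moreover have "b x \<le> (LEAST i. b x \<le> i \<or> \<not> P x i) \<longleftrightarrow> (\<forall>i<b x. P x i)" for x
    using LeastI_ex [OF ex [of x]] not_less_Least [of _ "\<lambda>i. b x \<le> i \<or> \<not> P x i"]
    by (metis linorder_not_less order_trans)
  ultimately show ?thesis by simp
qed

lemma decidable_ex_less [computable_intros]:
  assumes "decidable (\<lambda>p. P (fst p) (snd p))" and "computable b"
  shows "decidable (\<lambda>x. \<exists>i<b x. P x (i::nat))"
proof -
  have "decidable (\<lambda>x. \<not> (\<forall>i<b x. \<not> P x i))"
    using assms by (intro computable_intros)
  then show ?thesis by simp
qed

subsection \<open>Semidecidable predicates\<close>

text \<open>Semidecidable predicates are projections of decidable relations rather than domains of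
  programs. Closure under existential quantifiers then amounts to pairing witnesses, with no
  interleaving of computations.\<close>

definition semidec :: "('a::code \<Rightarrow> bool) \<Rightarrow> bool" where
  "semidec P \<longleftrightarrow> (\<exists>Q. decidable (\<lambda>p. Q (fst p) (snd p)) \<and> (\<forall>x. P x \<longleftrightarrow> (\<exists>s::nat. Q x s)))"

lemma semidecE:
  assumes "semidec P"
  obtains Q where "decidable (\<lambda>p. Q (fst p) (snd p :: nat))" "\<And>x. P x \<longleftrightarrow> (\<exists>s. Q x s)"
  using assms unfolding semidec_def by blast

lemma semidec_cong: "semidec Q \<Longrightarrow> (\<And>x. P x \<longleftrightarrow> Q x) \<Longrightarrow> semidec P"
  unfolding semidec_def by simp

named_theorems semidec_intros

lemma semidecI:
  fixes Q :: "'a::code \<Rightarrow> 'b::code \<Rightarrow> bool"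
  assumes "decidable (\<lambda>p. Q (fst p) (snd p))" and "\<And>x. P x \<longleftrightarrow> (\<exists>y. Q x y)"
  shows "semidec P"
  unfolding semidec_def
proof (intro exI conjI allI)
  show "decidable (\<lambda>p. Q (fst p) (dec (snd p)))"
    by (rule decidable_comp2 [OF assms(1)]) (intro computable_intros)+
  show "P x \<longleftrightarrow> (\<exists>s. Q x (dec s))" for x
    unfolding assms(2) by (metis dec_enc)
qed

lemma semidec_decidable: "decidable P \<Longrightarrow> semidec P"
  by (rule semidecI [of "\<lambda>x (_::nat). P x"]) (simp_all add: decidable_comp computable_intros)

lemma semidec_comp:
  assumes "semidec P" "computable g" shows "semidec (\<lambda>x. P (g x))"
proof -
  obtain Q where Q: "decidable (\<lambda>p. Q (fst p) (snd p :: nat))" "\<And>x. P x \<longleftrightarrow> (\<exists>s. Q x s)"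
    using assms(1) by (rule semidecE) blast
  have "decidable (\<lambda>p. Q (g (fst p)) (snd p))"
    using assms(2) by (intro decidable_comp2 [OF Q(1)] computable_comp [OF assms(2)] computable_intros)
  then show ?thesis by (rule semidecI) (simp add: Q(2))
qed

lemma semidec_comp2:
  "semidec (\<lambda>p. R (fst p) (snd p)) \<Longrightarrow> computable g \<Longrightarrow> computable h \<Longrightarrow>
    semidec (\<lambda>x. R (g x) (h x))"
  using semidec_comp [of "\<lambda>p. R (fst p) (snd p)" "\<lambda>x. (g x, h x)"] by (simp add: computable_Pair)

lemma semidec_comp3:
  "semidec (\<lambda>p. R (fst p) (fst (snd p)) (snd (snd p))) \<Longrightarrow>
    computable g \<Longrightarrow> computable h \<Longrightarrow> computable k \<Longrightarrow> semidec (\<lambda>x. R (g x) (h x) (k x))"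
  using semidec_comp [of "\<lambda>p. R (fst p) (fst (snd p)) (snd (snd p))" "\<lambda>x. (g x, h x, k x)"]
  by (simp add: computable_Pair)

lemma semidec_ex [semidec_intros]:
  fixes P :: "'a::code \<Rightarrow> 'b::code \<Rightarrow> bool"
  assumes "semidec (\<lambda>p. P (fst p) (snd p))"
  shows "semidec (\<lambda>x. \<exists>y. P x y)"
proof -
  obtain Q where Q: "decidable (\<lambda>p. Q (fst p) (snd p :: nat))" "\<And>x. P (fst x) (snd x) \<longleftrightarrow> (\<exists>s. Q x s)"
    using assms by (rule semidecE) blast
  have "decidable (\<lambda>p. Q (fst p, fst (snd p)) (snd (snd p)))"
    by (intro decidable_comp2 [OF Q(1)] computable_intros)
  then show ?thesis
    by (rule semidecI [where Q = "\<lambda>x q. Q (x, fst q) (snd q)"])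
      (use Q(2) in \<open>metis fst_conv snd_conv\<close>)
qed

lemma semidec_conj [semidec_intros]:
  assumes "semidec P" "semidec Q" shows "semidec (\<lambda>x. P x \<and> Q x)"
proof -
  obtain P' where P': "decidable (\<lambda>p. P' (fst p) (snd p :: nat))" "\<And>x. P x \<longleftrightarrow> (\<exists>s. P' x s)"
    using assms(1) by (rule semidecE) blast
  obtain Q' where Q': "decidable (\<lambda>p. Q' (fst p) (snd p :: nat))" "\<And>x. Q x \<longleftrightarrow> (\<exists>s. Q' x s)"
    using assms(2) by (rule semidecE) blast
  have "semidec (\<lambda>x. \<exists>s t. P' x s \<and> Q' x t)"
    by (intro semidec_ex semidec_decidable decidable_conj decidable_comp2 [OF P'(1)] decidable_comp2 [OF Q'(1)] computable_intros)
  then show ?thesis by (simp add: P' Q')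
qed

lemma semidec_disj [semidec_intros]:
  assumes "semidec P" "semidec Q" shows "semidec (\<lambda>x. P x \<or> Q x)"
proof -
  obtain P' where P': "decidable (\<lambda>p. P' (fst p) (snd p :: nat))" "\<And>x. P x \<longleftrightarrow> (\<exists>s. P' x s)"
    using assms(1) by (rule semidecE) blast
  obtain Q' where Q': "decidable (\<lambda>p. Q' (fst p) (snd p :: nat))" "\<And>x. Q x \<longleftrightarrow> (\<exists>s. Q' x s)"
    using assms(2) by (rule semidecE) blast
  have "semidec (\<lambda>x. \<exists>s. P' x s \<or> Q' x s)"
    by (intro semidec_ex semidec_decidable decidable_disj decidable_comp2 [OF P'(1)] decidable_comp2 [OF Q'(1)] computable_intros)
  then show ?thesis by (simp add: P' Q' ex_disj_distrib)
qed

text \<open>The witnesses for finitely many instances have a common bound.\<close>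

lemma semidec_all_less [semidec_intros]:
  assumes "semidec (\<lambda>p. P (fst p) (snd p))" "computable b"
  shows "semidec (\<lambda>x. \<forall>i<b x. P x (i::nat))"
proof -
  obtain Q where Q: "decidable (\<lambda>p. Q (fst p) (snd p :: nat))" "\<And>x. P (fst x) (snd x) \<longleftrightarrow> (\<exists>s. Q x s)"
    using assms(1) by (rule semidecE) blast
  have b: "computable (\<lambda>p. b (fst p))" using assms(2) by (rule computable_comp) (intro computable_intros)
  have "decidable (\<lambda>p. \<forall>i<b (fst p). \<exists>s<snd p. Q (fst p, i) s)"
    by (intro computable_intros decidable_comp2 [OF Q(1)] b)
  then show ?thesis
  proof (rule semidecI)
    fix x
    show "(\<forall>i<b x. P x i) \<longleftrightarrow> (\<exists>y. \<forall>i<b x. \<exists>s<y. Q (x, i) s)"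
    proof
      assume "\<forall>i<b x. P x i"
      then have "\<forall>i. \<exists>s. i < b x \<longrightarrow> Q (x, i) s" using Q(2) by force
      then obtain w where w: "\<And>i. i < b x \<Longrightarrow> Q (x, i) (w i)" by metis
      have "w i < Suc (Max (w ` {..<b x}))" if "i < b x" for i
        using that by (simp add: le_imp_less_Suc)
      with w show "\<exists>y. \<forall>i<b x. \<exists>s<y. Q (x, i) s" by blast
    next
      assume "\<exists>y. \<forall>i<b x. \<exists>s<y. Q (x, i) s"
      then show "\<forall>i<b x. P x i" using Q(2) by (metis fst_conv snd_conv)
    qed
  qed
qed

text \<open>Post's theorem. For every argument one of the two certificates appears at some stage; at
  the least such stage the first relation holds iff the predicate does, since the two can never both
  be certified.\<close>

theorem decidableI_semidec:
  assumes "semidec P" "semidec (\<lambda>x. \<not> P x)"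
  shows "decidable P"
proof -
  obtain P' where P': "decidable (\<lambda>p. P' (fst p) (snd p :: nat))" "\<And>x. P x \<longleftrightarrow> (\<exists>s. P' x s)"
    using assms(1) by (rule semidecE) blast
  obtain Q' where Q': "decidable (\<lambda>p. Q' (fst p) (snd p :: nat))" "\<And>x. \<not> P x \<longleftrightarrow> (\<exists>s. Q' x s)"
    using assms(2) by (rule semidecE) blast
  define w where "w x = (LEAST s. P' x s \<or> Q' x s)" for x
  have ex: "\<exists>s. P' x s \<or> Q' x s" for x using P' Q' by metis
  have "computable w"
    unfolding w_def by (intro computable_Least ex decidable_disj P' Q')
  then have "decidable (\<lambda>x. P' x (w x))"
    by (intro decidable_comp2 [OF P'(1)] computable_intros)
  moreover have "P' x (w x) \<longleftrightarrow> P x" for x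
    using LeastI_ex [OF ex, of x, folded w_def] P' Q' by metis
  ultimately show ?thesis by simp
qed

text \<open>A search over coded pairs of a value and a stage stops whenever some value exists.
  Nothing is claimed elsewhere, so the theorem applies to partial operations.\<close>

theorem semidec_selection:
  fixes R :: "'a::code \<Rightarrow> 'b::code \<Rightarrow> bool"
  assumes "semidec (\<lambda>p. R (fst p) (snd p))"
  shows "\<exists>e. \<forall>x. (\<exists>y. R x y) \<longrightarrow> (\<exists>y. R x y \<and> recf_eval e [enc x] = Some (enc y))"
proof -
  obtain Q where Q: "decidable (\<lambda>p. Q (fst p) (snd p :: nat))" "\<And>x. R (fst x) (snd x) \<longleftrightarrow> (\<exists>s. Q x s)"
    using assms by (rule semidecE) blast
  define Q' where "Q' x n = Q (x, fst (dec n :: 'b \<times> nat)) (snd (dec n :: 'b \<times> nat))" for x n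
  have "decidable (\<lambda>p. \<not> Q' (fst p) (snd p))"
    unfolding Q'_def by (intro computable_intros decidable_comp2 [OF Q(1)])
  then obtain e where e: "\<And>p. recf_eval e [enc p] = Some (enc (of_bool (\<not> Q' (fst p) (snd p)) :: nat))"
    unfolding decidable_def by (rule computableE) blast
  define m where "m = Minim (Comp e [Comp r_pair [Proj 1, Proj 0]])"
  have e': "recf_eval (Comp e [Comp r_pair [Proj 1, Proj 0]]) [n, enc x] = Some (of_bool (\<not> Q' x n))" for n x
    using e [of "(x, n)"] by simp
  have "\<exists>y. R x y \<and> recf_eval (Comp r_fst [m]) [enc x] = Some (enc y)" if R: "\<exists>y. R x y" for x
  proof -
    obtain y s where "Q (x, y) s" using R Q(2) by (metis fst_conv snd_conv)
    then have ex: "\<exists>n. Q' x n" unfolding Q'_def by (metis dec_enc fst_conv snd_conv)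
    define n where "n = (LEAST n. Q' x n)"
    have n: "Q' x n" unfolding n_def using ex by (rule LeastI_ex)
    obtain z t where zt: "(z, t) = (dec n :: 'b \<times> nat)" by (metis surj_pair)
    then have enc: "prod_encode (enc z, t) = n" by (metis enc_Pair enc_dec enc_nat)
    have "recf_eval m [enc x] = Some n"
      unfolding m_def n_def using ex by (subst eval_Minim [OF e']) auto
    then have "recf_eval (Comp r_fst [m]) [enc x] = Some (enc z)"
      by (simp flip: enc)
    moreover have "R x z" using n Q(2) [of "(x, z)"] unfolding Q'_def zt [symmetric] by auto
    ultimately show ?thesis by blast
  qed
  then show ?thesis by blast
qed

lemma computable_semidec_graph:
  fixes f :: "'a::code \<Rightarrow> 'b::code"
  assumes "semidec (\<lambda>p. f (fst p) = snd p)"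
  shows "computable f"
proof -
  from semidec_selection [OF assms]
  obtain e where "\<forall>x. \<exists>y. f x = y \<and> recf_eval e [enc x] = Some (enc y)" by auto
  then show ?thesis by (intro computableI [of e]) auto
qed

subsection \<open>Lists\<close>

lemma computable_Cons [computable_intros]:
  "computable g \<Longrightarrow> computable h \<Longrightarrow> computable (\<lambda>x. g x # h x)"
  by (rule computable_binary [of "Comp Succ [r_pair]" Cons]) simp_all

lemma computable_tl [computable_intros]:
  assumes "computable g" shows "computable (\<lambda>x. tl (g x))"
proof (rule computable_comp [OF _ assms])
  \<comment> \<open>The recursion serves as a case distinction: the code of a nonempty list is the
    successor of a pair code, which the step decodes while ignoring the recursive value.\<close>
  have "computable (\<lambda>xs::'b list. rec_nat [] (\<lambda>m _. snd (dec m :: 'b \<times> 'b list)) (enc xs))"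
    by (intro computable_rec_nat computable_intros)
  moreover have "rec_nat [] (\<lambda>m _. snd (dec m :: 'b \<times> 'b list)) (enc xs) = tl xs" for xs
  proof (cases xs)
    case (Cons a list)
    then show ?thesis by (simp flip: enc_Pair)
  qed simp
  ultimately show "computable (tl :: 'b list \<Rightarrow> _)" by simp
qed

text \<open>Unlike \<open>hd\<close> and \<open>nth\<close>, whose values are unspecified out of range, the following
  variants are computable everywhere.\<close>

definition hd0 :: "'a::code list \<Rightarrow> 'a" where
  "hd0 xs = (case xs of [] \<Rightarrow> dec 0 | x # _ \<Rightarrow> x)"

definition nth0 :: "'a::code list \<Rightarrow> nat \<Rightarrow> 'a" where
  "nth0 xs i = hd0 (drop i xs)"

lemma nth0: "i < length xs \<Longrightarrow> nth0 xs i = xs ! i"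
  by (simp add: nth0_def hd0_def flip: Cons_nth_drop_Suc)

lemma computable_hd0 [computable_intros]:
  assumes "computable g" shows "computable (\<lambda>x. hd0 (g x))"
proof (rule computable_comp [OF _ assms])
  have "computable (\<lambda>xs::'b list. rec_nat (dec 0) (\<lambda>m _. fst (dec m :: 'b \<times> 'b list)) (enc xs))"
    by (intro computable_rec_nat computable_intros)
  moreover have "rec_nat (dec 0) (\<lambda>m _. fst (dec m :: 'b \<times> 'b list)) (enc xs) = hd0 xs" for xs
  proof (cases xs)
    case (Cons a list)
    then show ?thesis by (simp add: hd0_def flip: enc_Pair)
  qed (simp add: hd0_def)
  ultimately show "computable (hd0 :: 'b list \<Rightarrow> _)" by simp
qed

lemma computable_drop [computable_intros]:
  assumes "computable n" "computable g" shows "computable (\<lambda>x. drop (n x) (g x))"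
proof -
  have "computable (\<lambda>x. rec_nat (g x) (\<lambda>_ v. tl v) (n x))"
    by (intro computable_rec_nat computable_intros assms)
  moreover have "rec_nat l (\<lambda>_ v. tl v) k = drop k l" for l :: "'b list" and k
    by (induction k) (simp_all add: drop_Suc tl_drop)
  ultimately show ?thesis by simp
qed

lemma computable_nth0 [computable_intros]:
  "computable g \<Longrightarrow> computable n \<Longrightarrow> computable (\<lambda>x. nth0 (g x) (n x))"
  unfolding nth0_def by (intro computable_intros)

lemma computable_length [computable_intros]:
  assumes "computable g" shows "computable (\<lambda>x. length (g x))"
proof (rule computable_comp [OF _ assms])
  have "computable (\<lambda>xs::'b list. LEAST n. drop n xs = [])"
    by (intro computable_Least computable_intros) auto
  moreover have "(LEAST n. drop n xs = []) = length xs" for xs :: "'b list"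
    by (rule Least_equality) simp_all
  ultimately show "computable (length :: 'b list \<Rightarrow> _)" by simp
qed

lemma all_set_nth0: "(\<forall>z\<in>set xs. P z) \<longleftrightarrow> (\<forall>i<length xs. P (nth0 xs i))"
  by (simp add: all_set_conv_all_nth nth0)

lemma ex_set_nth0: "(\<exists>z\<in>set xs. P z) \<longleftrightarrow> (\<exists>i<length xs. P (nth0 xs i))"
  by (metis in_set_conv_nth nth0)

lemma decidable_ball_set [computable_intros]:
  assumes "decidable (\<lambda>p. P (fst p) (snd p))" "computable l"
  shows "decidable (\<lambda>x. \<forall>z\<in>set (l x). P x z)"
  unfolding all_set_nth0
  by (intro computable_intros decidable_comp2 [OF assms(1)] computable_comp [OF assms(2)])

lemma decidable_bex_set [computable_intros]:
  assumes "decidable (\<lambda>p. P (fst p) (snd p))" "computable l"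
  shows "decidable (\<lambda>x. \<exists>z\<in>set (l x). P x z)"
  unfolding ex_set_nth0
  by (intro computable_intros decidable_comp2 [OF assms(1)] computable_comp [OF assms(2)])

lemma semidec_ball_set [semidec_intros]:
  assumes "semidec (\<lambda>p. P (fst p) (snd p))" "computable l"
  shows "semidec (\<lambda>x. \<forall>z\<in>set (l x). P x z)"
  unfolding all_set_nth0
  by (intro semidec_intros computable_intros semidec_comp2 [OF assms(1)] computable_comp [OF assms(2)])

lemma decidable_mem_set [computable_intros]:
  assumes "computable g" "computable l"
  shows "decidable (\<lambda>x. g x \<in> set (l x))"
proof -
  have "decidable (\<lambda>x. \<exists>z\<in>set (l x). g x = z)"
    by (intro computable_intros assms computable_comp [OF assms(1)])
  then show ?thesis by simp
qed

lemma semidec_bex_set [semidec_intros]: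
  assumes "semidec (\<lambda>p. P (fst p) (snd p))" "computable l"
  shows "semidec (\<lambda>x. \<exists>z\<in>set (l x). P x z)"
  unfolding Bex_def
  by (intro semidec_intros assms(1) semidec_decidable computable_intros computable_comp [OF assms(2)])

lemma decidable_prefix [computable_intros]:
  assumes "computable g" "computable h"
  shows "decidable (\<lambda>x. prefix (g x) (h x))"
proof -
  have "decidable (\<lambda>x. length (g x) \<le> length (h x) \<and>
      (\<forall>i<length (g x). nth0 (g x) i = nth0 (h x) i))"
    by (intro computable_intros assms computable_comp [OF assms(1)] computable_comp [OF assms(2)])
  moreover have "prefix xs ys \<longleftrightarrow> length xs \<le> length ys \<and> (\<forall>i<length xs. nth0 xs i = nth0 ys i)"
    for xs ys :: "'b list"
  proof
    assume "prefix xs ys"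
    then show "length xs \<le> length ys \<and> (\<forall>i<length xs. nth0 xs i = nth0 ys i)"
      by (auto simp: prefix_def nth0 nth_append)
  next
    assume *: "length xs \<le> length ys \<and> (\<forall>i<length xs. nth0 xs i = nth0 ys i)"
    then have "xs = take (length xs) ys"
      by (intro nth_equalityI) (auto simp: nth0)
    then show "prefix xs ys" by (metis take_is_prefix)
  qed
  ultimately show ?thesis by simp
qed

lemma append_eq_nth0:
  "xs @ ys = zs \<longleftrightarrow> length zs = length xs + length ys \<and>
    (\<forall>i<length xs. nth0 zs i = nth0 xs i) \<and> (\<forall>i<length ys. nth0 zs (length xs + i) = nth0 ys i)"
  (is "?L \<longleftrightarrow> ?R")
proof
  assume ?L
  then show ?R by (auto simp: nth0 nth_append)
next
  assume R: ?R
  show ?L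
  proof (rule nth_equalityI)
    show "length (xs @ ys) = length zs" using R by simp
    fix i assume i: "i < length (xs @ ys)"
    show "(xs @ ys) ! i = zs ! i"
    proof (cases "i < length xs")
      case True
      then show ?thesis using R i by (auto simp: nth_append nth0)
    next
      case False
      then have "i = length xs + (i - length xs)" "i - length xs < length ys" using i by auto
      then show ?thesis using R i False by (metis nth0 nth_append length_append)
    qed
  qed
qed

text \<open>The graph of append is decidable by comparing entries, and a total function with such a
  graph is computed by search.\<close>

lemma computable_append [computable_intros]:
  assumes "computable g" "computable h"
  shows "computable (\<lambda>x. g x @ h x)"
proof -
  have "decidable (\<lambda>p::('b list \<times> 'b list) \<times> 'b list. fst (fst p) @ snd (fst p) = snd p)"
    unfolding append_eq_nth0 by (intro computable_intros)
  then have "computable (\<lambda>p::'b list \<times> 'b list. fst p @ snd p)"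
    by (intro computable_semidec_graph semidec_decidable)
  from computable_comp2 [OF this assms] show ?thesis .
qed

subsection \<open>Graphs of partial recursive functions\<close>

lemma recf_eval_Comp_iff:
  "recf_eval (Comp f gs) xs = Some y \<longleftrightarrow>
    (\<exists>ys. list_all2 (\<lambda>g v. recf_eval g xs = Some v) gs ys \<and> recf_eval f ys = Some y)"
  (is "?L \<longleftrightarrow> ?R")
proof
  assume ?L
  then have "None \<notin> (\<lambda>g. recf_eval g xs) ` set gs"
    and "recf_eval f (map (\<lambda>g. the (recf_eval g xs)) gs) = Some y"
    by (auto simp: recf_eval.simps Let_def o_def split: if_splits)
  moreover from this(1) have "list_all2 (\<lambda>g v. recf_eval g xs = Some v) gs (map (\<lambda>g. the (recf_eval g xs)) gs)"
    unfolding list_all2_conv_all_nth by (metis image_eqI length_map nth_map nth_mem option.collapse)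
  ultimately show ?R by blast
next
  assume ?R
  then obtain ys where ys: "list_all2 (\<lambda>g v. recf_eval g xs = Some v) gs ys" "recf_eval f ys = Some y"
    by blast
  from ys(1) have "map (\<lambda>g. recf_eval g xs) gs = map Some ys"
    by (induction rule: list_all2_induct) auto
  with ys(2) show ?L by (auto simp: recf_eval.simps Let_def o_def)
qed

text \<open>The list \<open>c\<close> is the history of the recursion. Quantifying over it reduces a
  value of the recursion to finitely many values of \<open>f\<close> and \<open>g\<close>.\<close>

lemma recf_eval_PrimRec_iff:
  "recf_eval (PrimRec f g) xs = Some y \<longleftrightarrow>
    (xs \<noteq> [] \<and> (\<exists>c. recf_eval f (tl xs) = Some (nth0 c 0) \<and>
      (\<forall>m<hd0 xs. recf_eval g (m # nth0 c m # tl xs) = Some (nth0 c (Suc m))) \<and>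
      nth0 c (hd0 xs) = y))"
proof (cases xs)
  case Nil
  then show ?thesis by (simp add: recf_eval.simps)
next
  case (Cons n ys)
  let ?r = "\<lambda>k. recf_eval (PrimRec f g) (k # ys)"
  have r0: "?r 0 = recf_eval f ys" by (simp add: recf_eval.simps)
  have rS: "?r (Suc k) = (case ?r k of None \<Rightarrow> None | Some v \<Rightarrow> recf_eval g (k # v # ys))" for k
    by (simp add: recf_eval.simps)
  have "?r n = Some y \<longleftrightarrow> (\<exists>c. recf_eval f ys = Some (nth0 c 0) \<and>
      (\<forall>m<n. recf_eval g (m # nth0 c m # ys) = Some (nth0 c (Suc m))) \<and> nth0 c n = y)"
  proof
    assume y: "?r n = Some y"
    \<comment> \<open>A value at \<open>n\<close> forces values at all earlier counters, so the
      whole history is defined.\<close>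
    have def: "?r k \<noteq> None" if "k \<le> n" for k
      using that
    proof (induction rule: inc_induct)
      case base
      then show ?case using y by simp
    next
      case (step k)
      then show ?case by (auto simp: rS split: option.splits)
    qed
    define c where "c = map (\<lambda>k. the (?r k)) [0..<Suc n]"
    have c: "nth0 c k = the (?r k)" if "k \<le> n" for k
      using that by (subst nth0) (auto simp: c_def simp del: upt_Suc)
    have "recf_eval f ys = Some (nth0 c 0)" using def [of 0] by (auto simp: c r0)
    moreover have "recf_eval g (m # nth0 c m # ys) = Some (nth0 c (Suc m))" if "m < n" for m
      using def [of m] def [of "Suc m"] that by (auto simp: c rS Suc_le_eq split: option.splits)
    moreover have "nth0 c n = y" using y by (simp add: c)
    ultimately show "\<exists>c. recf_eval f ys = Some (nth0 c 0) \<and>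
      (\<forall>m<n. recf_eval g (m # nth0 c m # ys) = Some (nth0 c (Suc m))) \<and> nth0 c n = y" by blast
  next
    assume "\<exists>c. recf_eval f ys = Some (nth0 c 0) \<and>
      (\<forall>m<n. recf_eval g (m # nth0 c m # ys) = Some (nth0 c (Suc m))) \<and> nth0 c n = y"
    then obtain c where c: "recf_eval f ys = Some (nth0 c 0)"
      "\<And>m. m < n \<Longrightarrow> recf_eval g (m # nth0 c m # ys) = Some (nth0 c (Suc m))" "nth0 c n = y"
      by blast
    have "?r k = Some (nth0 c k)" if "k \<le> n" for k
      using that by (induction k) (simp_all add: r0 rS c)
    then show "?r n = Some y" using c(3) by simp
  qed
  then show ?thesis by (simp add: Cons hd0_def)
qed

text \<open>The zero that witnesses convergence need not be the least one, but the least zero lies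
  at or below it. Hence all values before the least zero are defined, and they are nonzero by
  minimality.\<close>

lemma recf_eval_Minim_iff:
  "recf_eval (Minim f) xs = Some y \<longleftrightarrow>
    recf_eval f (y # xs) = Some 0 \<and> (\<forall>m<y. \<exists>v. recf_eval f (m # xs) = Some (Suc v))"
  (is "?L \<longleftrightarrow> ?R")
proof
  let ?Z = "\<lambda>n. recf_eval f (n # xs) = Some 0"
  assume ?L
  then obtain n where n: "?Z n" "\<forall>m<n. recf_eval f (m # xs) \<noteq> None" and y: "y = (LEAST n. ?Z n)"
    by (auto simp: recf_eval.simps split: if_splits)
  have "?Z y" unfolding y using n(1) by (rule LeastI)
  moreover have "y \<le> n" unfolding y using n(1) by (rule Least_le)
  moreover have "\<exists>v. recf_eval f (m # xs) = Some (Suc v)" if "m < y" for m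
  proof -
    have "\<not> ?Z m" using that not_less_Least y by blast
    moreover have "recf_eval f (m # xs) \<noteq> None" using n(2) that \<open>y \<le> n\<close> by simp
    ultimately show ?thesis by (metis not0_implies_Suc option.exhaust)
  qed
  ultimately show ?R by blast
next
  assume R: ?R
  then have "(LEAST n. recf_eval f (n # xs) = Some 0) = y"
    by (intro Least_equality) (auto simp: not_less [symmetric])
  moreover have "\<forall>m<y. recf_eval f (m # xs) \<noteq> None" using R by fastforce
  ultimately show ?L using R by (auto simp: recf_eval.simps)
qed

text \<open>The program \<open>e\<close> is fixed, so an induction on its structure takes the place
  of a universal machine.\<close>

theorem semidec_recf_eval: "semidec (\<lambda>p. recf_eval e (fst p) = Some (snd p))"
proof (induction e)
  case Zero
  show ?case by (simp, intro semidec_decidable computable_intros)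
next
  case Succ
  have "recf_eval Succ xs = Some y \<longleftrightarrow> xs \<noteq> [] \<and> Suc (hd0 xs) = y" for xs y
    by (auto simp: recf_eval.simps hd0_def split: list.split)
  then show ?case by (simp, intro semidec_decidable computable_intros)
next
  case (Proj i)
  have "recf_eval (Proj i) xs = Some y \<longleftrightarrow> i < length xs \<and> nth0 xs i = y" for xs y
    by (auto simp: recf_eval.simps nth0)
  then show ?case by (simp, intro semidec_decidable computable_intros)
next
  case (Comp f gs)
  \<comment> \<open>The list \<open>gs\<close> is part of the program and not of the coded data, so
    the conjunction over it is built by an induction on \<open>gs\<close>.\<close>
  have "semidec (\<lambda>p. list_all2 (\<lambda>g v. recf_eval g (fst p) = Some v) gs (snd p))"
    using Comp.IH(2)
  proof (induction gs)
    case Nil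
    show ?case by (simp, intro semidec_decidable computable_intros)
  next
    case (Cons g gs)
    have eq: "list_all2 (\<lambda>g v. recf_eval g xs = Some v) (g # gs) ys \<longleftrightarrow>
        ys \<noteq> [] \<and> recf_eval g xs = Some (hd0 ys) \<and> list_all2 (\<lambda>g v. recf_eval g xs = Some v) gs (tl ys)" for xs ys
      by (cases ys) (auto simp: hd0_def)
    have g: "semidec (\<lambda>p. recf_eval g (fst p) = Some (snd p))" using Cons.prems by simp
    have gs: "semidec (\<lambda>p. list_all2 (\<lambda>g v. recf_eval g (fst p) = Some v) gs (snd p))"
      using Cons by simp
    show ?case unfolding eq
      by (intro semidec_conj semidec_comp2 [OF gs] semidec_comp2 [OF g] semidec_decidable computable_intros)
  qed
  note gs = this
  show ?case unfolding recf_eval_Comp_iff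
    by (intro semidec_intros semidec_comp2 [OF gs] semidec_comp2 [OF Comp.IH(1)] computable_intros)
next
  case (PrimRec f g)
  show ?case unfolding recf_eval_PrimRec_iff
    by (intro semidec_intros semidec_comp2 [OF PrimRec.IH(1)] semidec_comp2 [OF PrimRec.IH(2)]
        semidec_decidable[OF decidable_not] semidec_decidable[OF decidable_eq] computable_intros)
next
  case (Minim f)
  show ?case unfolding recf_eval_Minim_iff
    by (intro semidec_intros semidec_comp2 [OF Minim.IH] computable_intros)
qed

section \<open>Translation of the computability notions for sets and functions of strings\<close>

lemma computable_set_decidable:
  fixes P :: "'a::code \<Rightarrow> bool"
  shows "computable_set {n. P (dec n)} \<longleftrightarrow> decidable P"
proof -
  have "(\<forall>n. recf_eval e [n] = Some (of_bool (P (dec n)))) \<longleftrightarrow>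
      (\<forall>x. recf_eval e [enc x] = Some (of_bool (P x)))" for e
    by (metis dec_enc enc_dec)
  then show ?thesis
    by (simp only: computable_set_def decidable_def computable_def mem_Collect_eq enc_nat)
qed

lemma computable_string_set_decidable:
  assumes "computable_string_set A" shows "decidable (\<lambda>\<sigma>. \<sigma> \<in> A)"
proof -
  have "list_encode ` A = {n. dec n \<in> A}"
    by (auto simp: image_iff simp flip: enc_string) (metis enc_dec)
  then show ?thesis
    using assms computable_set_decidable [of "\<lambda>\<sigma>. \<sigma> \<in> A"] by (simp add: computable_string_set_def)
qed

lemma computable_string_bound_computable:
  assumes "computable_string_bound H"
  shows "computable (\<lambda>p. H (fst p) (snd p))"
proof -
  obtain e where "\<forall>\<sigma> i. recf_eval e [list_encode \<sigma>, i] = Some (H \<sigma> i)"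
    using assms unfolding computable_string_bound_def by blast
  then show ?thesis
    by (intro computable_binary [of e H] computable_intros) (simp add: enc_string)
qed

lemma semidec_graph_string1:
  assumes "partial_computable_string1 P"
  shows "semidec (\<lambda>p. P (fst p) = Some (snd p))"
proof -
  obtain e where e: "\<And>\<sigma>. recf_eval e [enc \<sigma>] = map_option enc (P \<sigma>)"
    using assms unfolding partial_computable_string1_def enc_string [symmetric]
    by (auto simp: enc_string [symmetric, abs_def])
  have "semidec (\<lambda>p::nat list \<times> nat list. recf_eval e [enc (fst p)] = Some (enc (snd p)))"
    by (intro semidec_comp2 [OF semidec_recf_eval] computable_intros)
  moreover have "recf_eval e [enc \<sigma>] = Some (enc \<rho>) \<longleftrightarrow> P \<sigma> = Some \<rho>" for \<sigma> \<rho>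
    by (auto simp: e)
  ultimately show ?thesis by simp
qed

lemma semidec_graph_string2:
  assumes "partial_computable_string2 P"
  shows "semidec (\<lambda>p. P (fst p) (fst (snd p)) = Some (snd (snd p)))"
proof -
  obtain e where e: "\<And>\<sigma> \<tau>. recf_eval e [enc \<sigma>, enc \<tau>] = map_option enc (P \<sigma> \<tau>)"
    using assms unfolding partial_computable_string2_def
    by (auto simp: enc_string [symmetric, abs_def])
  have "semidec (\<lambda>p::nat list \<times> nat list \<times> nat list.
      recf_eval e [enc (fst p), enc (fst (snd p))] = Some (enc (snd (snd p))))"
    by (intro semidec_comp2 [OF semidec_recf_eval] computable_intros)
  moreover have "recf_eval e [enc \<sigma>, enc \<tau>] = Some (enc \<rho>) \<longleftrightarrow> P \<sigma> \<tau> = Some \<rho>" for \<sigma> \<tau> \<rho>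
    by (auto simp: e)
  ultimately show ?thesis by simp
qed

section \<open>Haar computable copies from computable bases\<close>

text \<open>\<open>S\<close> acts as a promise: outside it \<open>R\<close> may have no value or
  many. The programs of a copy are constrained only on part of the codes, and \<open>S\<close> will
  express that part.\<close>

lemma semidec_computes:
  fixes R :: "'a::code \<Rightarrow> 'b::code \<Rightarrow> bool"
  assumes R: "semidec (\<lambda>p. R (fst p) (snd p))"
    and ex: "\<And>x. S x \<Longrightarrow> \<exists>y. R x y" and unique: "\<And>x y. S x \<Longrightarrow> R x y \<Longrightarrow> y = f x"
  shows "\<exists>e. \<forall>x. S x \<longrightarrow> recf_eval e [enc x] = Some (enc (f x))"
  using semidec_selection [OF R] ex unique by metis

lemma semidec_computes2:
  fixes R :: "'a::code \<Rightarrow> 'b::code \<Rightarrow> 'c::code \<Rightarrow> bool"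
  assumes R: "semidec (\<lambda>p. R (fst p) (fst (snd p)) (snd (snd p)))"
    and ex: "\<And>x y. S x y \<Longrightarrow> \<exists>z. R x y z"
    and unique: "\<And>x y z. S x y \<Longrightarrow> R x y z \<Longrightarrow> z = f x y"
  shows "\<exists>e. \<forall>x y. S x y \<longrightarrow> recf_eval e [enc x, enc y] = Some (enc (f x y))"
proof -
  have "semidec (\<lambda>p. R (fst (fst p)) (snd (fst p)) (snd p))"
    by (intro semidec_comp3 [OF R] computable_intros)
  from semidec_computes [OF this, of "\<lambda>p. S (fst p) (snd p)" "\<lambda>p. f (fst p) (snd p)"] ex unique
  obtain e where e: "\<forall>x. S (fst x) (snd x) \<longrightarrow> recf_eval e [enc x] = Some (enc (f (fst x) (snd x)))"
    by auto
  have "recf_eval (Comp e [r_pair]) [enc x, enc y] = Some (enc (f x y))" if "S x y" for x y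
    using e [rule_format, of "(x, y)"] that by simp
  then show ?thesis by blast
qed

definition list_Union :: "('c \<Rightarrow> 'q set) \<Rightarrow> 'c list \<Rightarrow> 'q set" where
  "list_Union B L = (\<Union>s\<in>set L. B s)"

lemma list_Union_append: "list_Union B (L @ M) = list_Union B L \<union> list_Union B M"
  by (auto simp: list_Union_def)

text \<open>A group with a countable base \<open>B\<close> of nonempty compact open sets, indexed by the
  decidable set of codes satisfying \<open>C\<close>, whose finite unions are coded by lists.\<close>

locale computable_base =
  fixes Q :: "('q, 'm) monoid_scheme" (structure) and X :: "'q topology"
    and B :: "'c::code \<Rightarrow> 'q set" and C :: "'c \<Rightarrow> bool"
  assumes tdlc: "tdlc_group Q X"
    and decidable_C: "decidable C"
    and B_nonempty: "C s \<Longrightarrow> B s \<noteq> {}"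
    and compactin_B: "C s \<Longrightarrow> compactin X (B s)"
    and openin_B: "C s \<Longrightarrow> openin X (B s)"
    and B_base: "openin X U \<Longrightarrow> x \<in> U \<Longrightarrow> \<exists>s. C s \<and> x \<in> B s \<and> B s \<subseteq> U"
    and semidec_subset: "semidec (\<lambda>p. list_all C (fst p) \<and> list_all C (snd p) \<and>
      list_Union B (fst p) \<subseteq> list_Union B (snd p))"
    and semidec_disjnt: "semidec (\<lambda>p. list_all C (fst p) \<and> list_all C (snd p) \<and>
      list_Union B (fst p) \<inter> list_Union B (snd p) = {})"
    and semidec_mult: "semidec (\<lambda>p. list_all C (fst p) \<and> list_all C (fst (snd p)) \<and>
      list_all C (snd (snd p)) \<and>
      list_Union B (fst p) <#> list_Union B (fst (snd p)) \<subseteq> list_Union B (snd (snd p)))"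
    and semidec_inv: "semidec (\<lambda>p. list_all C (fst p) \<and> list_all C (snd p) \<and>
      set_inv (list_Union B (fst p)) \<subseteq> list_Union B (snd p))"
begin

abbreviation D :: "'c list \<Rightarrow> 'q set" where "D \<equiv> list_Union B"
abbreviation valid :: "'c list \<Rightarrow> bool" where "valid \<equiv> list_all C"

sublocale group Q
  using tdlc by (simp add: tdlc_group_def topological_group_def)

lemma cancel_simps:
  "x \<in> carrier Q \<Longrightarrow> y \<in> carrier Q \<Longrightarrow> x \<otimes> (inv x \<otimes> y) = y"
  "x \<in> carrier Q \<Longrightarrow> y \<in> carrier Q \<Longrightarrow> inv x \<otimes> (x \<otimes> y) = y"
  by (simp_all flip: m_assoc)

lemma topspace_eq: "topspace X = carrier Q"
  and continuous_mult: "continuous_map (prod_topology X X) X (\<lambda>(x, y). x \<otimes> y)"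
  and continuous_inv: "continuous_map X X (\<lambda>x. inv x)"
  and Hausdorff: "Hausdorff_space X"
  using tdlc by (simp_all add: tdlc_group_def topological_group_def)

section \<open>Compact open subsets of the group\<close>

definition compact_open :: "'q set \<Rightarrow> bool" where
  "compact_open A \<longleftrightarrow> compactin X A \<and> openin X A"

lemma compact_open_carrier: "compact_open A \<Longrightarrow> A \<subseteq> carrier Q"
  unfolding compact_open_def by (metis openin_subset topspace_eq)

lemma compact_open_D: "valid L \<Longrightarrow> compact_open (D L)"
  unfolding compact_open_def list_Union_def
  by (auto intro!: compactin_Union openin_Union simp: list_all_iff compactin_B openin_B)

lemma D_carrier: "valid L \<Longrightarrow> x \<in> D L \<Longrightarrow> x \<in> carrier Q"
  using compact_open_D compact_open_carrier by blast

lemma D_empty_iff: "valid L \<Longrightarrow> D L = {} \<longleftrightarrow> L = []"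
  using B_nonempty by (cases L) (auto simp: list_Union_def)

text \<open>The base sets inside \<open>A\<close> cover it because \<open>A\<close> is open, and
  compactness leaves finitely many of them.\<close>

lemma compact_open_code:
  assumes "compact_open A"
  obtains L where "valid L" "D L = A"
proof -
  let ?F = "B ` {s. C s \<and> B s \<subseteq> A}"
  have "A \<subseteq> \<Union>?F"
    using assms B_base unfolding compact_open_def by blast
  moreover have "\<And>U. U \<in> ?F \<Longrightarrow> openin X U" using openin_B by blast
  ultimately obtain F where F: "finite F" "F \<subseteq> ?F" "A \<subseteq> \<Union>F"
    using compactinD [of X A ?F] assms unfolding compact_open_def by blast
  obtain S where S: "S \<subseteq> {s. C s \<and> B s \<subseteq> A}" "finite S" "F = B ` S"
    using finite_subset_image [OF F(1,2)] by blast
  obtain L where "set L = S" using S(2) finite_list by blast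
  with S F show thesis by (intro that [of L]) (auto simp: list_all_iff list_Union_def)
qed

lemma compact_open_closedin: "compact_open U \<Longrightarrow> closedin X U"
  using Hausdorff compactin_imp_closedin by (auto simp: compact_open_def)

lemma compact_open_Int: "compact_open U \<Longrightarrow> compact_open V \<Longrightarrow> compact_open (U \<inter> V)"
  using compact_open_closedin [of U]
  by (auto simp: compact_open_def intro: closed_Int_compactin)

lemma compact_open_Diff:
  assumes "compact_open U" "compact_open V" shows "compact_open (U - V)"
proof -
  have "closedin X (U - V)"
    using assms compact_open_closedin by (auto simp: compact_open_def intro: closedin_diff)
  then have "compactin X (U - V)"
    using assms(1) by (auto simp: compact_open_def intro: closed_compactin)
  then show ?thesis
    using assms compact_open_closedin by (auto simp: compact_open_def intro: openin_diff)
qed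

lemma compact_open_set_inv:
  assumes "compact_open A" shows "compact_open (set_inv A)"
proof -
  have eq: "set_inv A = (\<lambda>x. inv x) ` A" by (auto simp: SET_INV_def)
  have "compactin X ((\<lambda>x. inv x) ` A)"
    using assms continuous_inv image_compactin unfolding compact_open_def by metis
  moreover have "openin X {x \<in> topspace X. inv x \<in> A}"
    using assms continuous_inv unfolding compact_open_def continuous_map_def by blast
  moreover have "{x \<in> topspace X. inv x \<in> A} = (\<lambda>x. inv x) ` A"
    using compact_open_carrier [OF assms] by (auto simp: topspace_eq image_iff) (metis inv_inv)
  ultimately show ?thesis by (simp add: compact_open_def eq)
qed

lemma continuous_translate:
  assumes "a \<in> carrier Q" shows "continuous_map X X (\<lambda>x. a \<otimes> x)" "continuous_map X X (\<lambda>x. x \<otimes> a)"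
proof -
  have "continuous_map X (prod_topology X X) (\<lambda>x. (a, x))" "continuous_map X (prod_topology X X) (\<lambda>x. (x, a))"
    using assms by (auto intro!: continuous_map_pairedI simp: topspace_eq)
  from this [THEN continuous_map_compose, OF continuous_mult]
  show "continuous_map X X (\<lambda>x. a \<otimes> x)" "continuous_map X X (\<lambda>x. x \<otimes> a)"
    by (simp_all add: o_def)
qed

text \<open>Translates are compact as images under a translation and open as preimages under the
  inverse translation.\<close>

lemma compact_open_translate:
  assumes a: "a \<in> carrier Q" and A: "compact_open A"
  shows "compact_open (a <# A)" "compact_open (A #> a)"
proof -
  note AQ = compact_open_carrier [OF A]
  have l: "a <# A = (\<lambda>x. a \<otimes> x) ` A" and r: "A #> a = (\<lambda>x. x \<otimes> a) ` A"
    by (auto simp: l_coset_def r_coset_def)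
  have "compactin X ((\<lambda>x. a \<otimes> x) ` A)" "compactin X ((\<lambda>x. x \<otimes> a) ` A)"
    using A continuous_translate [OF a] image_compactin unfolding compact_open_def by metis+
  moreover have "openin X {x \<in> topspace X. inv a \<otimes> x \<in> A}" "openin X {x \<in> topspace X. x \<otimes> inv a \<in> A}"
    using A continuous_translate [OF inv_closed [OF a]]
    unfolding compact_open_def continuous_map_def by blast+
  moreover have "{x \<in> topspace X. inv a \<otimes> x \<in> A} = (\<lambda>x. a \<otimes> x) ` A"
  proof safe
    fix x assume "x \<in> topspace X" "inv a \<otimes> x \<in> A"
    then show "x \<in> (\<lambda>x. a \<otimes> x) ` A"
      using a by (intro image_eqI [of _ _ "inv a \<otimes> x"]) (auto simp: topspace_eq cancel_simps)
  qed (use a AQ in \<open>auto simp: topspace_eq cancel_simps\<close>)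
  moreover have "{x \<in> topspace X. x \<otimes> inv a \<in> A} = (\<lambda>x. x \<otimes> a) ` A"
  proof safe
    fix x assume "x \<in> topspace X" "x \<otimes> inv a \<in> A"
    then show "x \<in> (\<lambda>x. x \<otimes> a) ` A"
      using a by (intro image_eqI [of _ _ "x \<otimes> inv a"]) (auto simp: topspace_eq m_assoc)
  next
    fix x assume "x \<in> A"
    then show "x \<otimes> a \<otimes> inv a \<in> A" using a AQ by (simp add: m_assoc subset_iff)
  qed (use a AQ in \<open>auto simp: topspace_eq\<close>)
  ultimately show "compact_open (a <# A)" "compact_open (A #> a)"
    by (simp_all add: compact_open_def l r)
qed

text \<open>The product is compact as an image of \<open>A \<times> A'\<close> and open as a union
  of left translates of \<open>A'\<close>.\<close>

lemma compact_open_set_mult: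
  assumes A: "compact_open A" and A': "compact_open A'"
  shows "compact_open (A <#> A')"
proof -
  have "compactin X ((\<lambda>(x, y). x \<otimes> y) ` (A \<times> A'))"
    using A A' continuous_mult unfolding compact_open_def
    by (intro image_compactin [of "prod_topology X X"]) (auto simp: compactin_Times)
  moreover have "(\<lambda>(x, y). x \<otimes> y) ` (A \<times> A') = A <#> A'" by (auto simp: set_mult_def)
  moreover have "A <#> A' = (\<Union>a\<in>A. a <# A')" by (auto simp: set_mult_def l_coset_def)
  moreover have "openin X (\<Union>a\<in>A. a <# A')"
    using compact_open_translate(1) [OF _ A'] compact_open_carrier [OF A]
    unfolding compact_open_def by (intro openin_Union) blast
  ultimately show ?thesis by (simp add: compact_open_def)
qed

subsection \<open>Semidecidable relations between codes\<close>

definition Sub :: "'c list \<Rightarrow> 'c list \<Rightarrow> bool" where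
  "Sub L M \<longleftrightarrow> valid L \<and> valid M \<and> D L \<subseteq> D M"

definition Disj :: "'c list \<Rightarrow> 'c list \<Rightarrow> bool" where
  "Disj L M \<longleftrightarrow> valid L \<and> valid M \<and> D L \<inter> D M = {}"

definition Mul :: "'c list \<Rightarrow> 'c list \<Rightarrow> 'c list \<Rightarrow> bool" where
  "Mul L M N \<longleftrightarrow> valid L \<and> valid M \<and> valid N \<and> D L <#> D M \<subseteq> D N"

definition Invr :: "'c list \<Rightarrow> 'c list \<Rightarrow> bool" where
  "Invr L M \<longleftrightarrow> valid L \<and> valid M \<and> set_inv (D L) \<subseteq> D M"

lemma semidec_Sub [semidec_intros]:
  "computable f \<Longrightarrow> computable g \<Longrightarrow> semidec (\<lambda>x. Sub (f x) (g x))"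
  unfolding Sub_def by (rule semidec_comp2 [OF semidec_subset])

lemma semidec_Disj [semidec_intros]:
  "computable f \<Longrightarrow> computable g \<Longrightarrow> semidec (\<lambda>x. Disj (f x) (g x))"
  unfolding Disj_def by (rule semidec_comp2 [OF semidec_disjnt])

lemma semidec_Mul [semidec_intros]:
  "computable f \<Longrightarrow> computable g \<Longrightarrow> computable h \<Longrightarrow> semidec (\<lambda>x. Mul (f x) (g x) (h x))"
  unfolding Mul_def by (rule semidec_comp3 [OF semidec_mult])

lemma semidec_Invr [semidec_intros]:
  "computable f \<Longrightarrow> computable g \<Longrightarrow> semidec (\<lambda>x. Invr (f x) (g x))"
  unfolding Invr_def by (rule semidec_comp2 [OF semidec_inv])

lemma decidable_valid [computable_intros]:
  "computable f \<Longrightarrow> decidable (\<lambda>x. valid (f x))"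
  unfolding list_all_iff by (intro computable_intros decidable_comp [OF decidable_C])

lemma MulD: "Mul L M N \<Longrightarrow> x \<in> D L \<Longrightarrow> y \<in> D M \<Longrightarrow> x \<otimes> y \<in> D N"
  unfolding Mul_def set_mult_def by blast

lemma MulI:
  "valid L \<Longrightarrow> valid M \<Longrightarrow> valid N \<Longrightarrow> (\<And>x y. x \<in> D L \<Longrightarrow> y \<in> D M \<Longrightarrow> x \<otimes> y \<in> D N) \<Longrightarrow> Mul L M N"
  unfolding Mul_def set_mult_def by blast

lemma InvrD: "Invr L M \<Longrightarrow> x \<in> D L \<Longrightarrow> inv x \<in> D M"
  unfolding Invr_def SET_INV_def by blast

lemma InvrI: "valid L \<Longrightarrow> valid M \<Longrightarrow> (\<And>x. x \<in> D L \<Longrightarrow> inv x \<in> D M) \<Longrightarrow> Invr L M"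
  unfolding Invr_def SET_INV_def by blast

lemma Invr_exact:
  assumes "valid L" obtains M where "valid M" "Invr L M" "D M = set_inv (D L)"
  using compact_open_code [OF compact_open_set_inv [OF compact_open_D [OF assms]]] assms
  unfolding Invr_def by (metis order_refl)

lemma Mul_exact:
  assumes "valid L" "valid M" obtains N where "valid N" "Mul L M N" "D N = D L <#> D M"
  using compact_open_code [OF compact_open_set_mult [OF assms [THEN compact_open_D]]] assms
  unfolding Mul_def by (metis order_refl)

text \<open>Nonempty intersection in positive form: intersections of coded sets are coded, and since
  base sets are nonempty, a valid code describes a nonempty set iff it is a nonempty list.\<close>

definition Meets :: "'c list \<Rightarrow> 'c list \<Rightarrow> bool" where
  "Meets L M \<longleftrightarrow> (\<exists>N. N \<noteq> [] \<and> Sub N L \<and> Sub N M)"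

lemma semidec_Meets [semidec_intros]:
  assumes "computable f" "computable g" shows "semidec (\<lambda>x. Meets (f x) (g x))"
proof (rule semidec_comp2 [OF _ assms])
  show "semidec (\<lambda>p. Meets (fst p) (snd p))"
    unfolding Meets_def by (intro semidec_intros semidec_decidable [OF decidable_not] computable_intros)
qed

lemma Meets_iff: "Meets L M \<longleftrightarrow> valid L \<and> valid M \<and> D L \<inter> D M \<noteq> {}"
proof
  assume "Meets L M"
  then obtain N where N: "N \<noteq> []" "Sub N L" "Sub N M" unfolding Meets_def by blast
  then have "D N \<noteq> {}" using D_empty_iff by (auto simp: Sub_def)
  with N show "valid L \<and> valid M \<and> D L \<inter> D M \<noteq> {}" by (auto simp: Sub_def)
next
  assume *: "valid L \<and> valid M \<and> D L \<inter> D M \<noteq> {}"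
  then obtain N where "valid N" "D N = D L \<inter> D M"
    using compact_open_code compact_open_Int compact_open_D by metis
  with * show "Meets L M" unfolding Meets_def Sub_def using D_empty_iff by (intro exI [of _ N]) auto
qed

lemma decidable_Sub: "decidable (\<lambda>p. Sub (fst p) (snd p))"
proof (rule decidableI_semidec)
  show "semidec (\<lambda>p. Sub (fst p) (snd p))" by (intro semidec_intros computable_intros)
  have "semidec (\<lambda>p. (\<not> valid (fst p) \<or> \<not> valid (snd p)) \<or> (\<exists>N. Meets N (fst p) \<and> Disj N (snd p)))"
    by (rule semidec_disj [OF semidec_decidable]) (intro semidec_intros computable_intros)+
  moreover have "\<not> Sub L M \<longleftrightarrow> (\<not> valid L \<or> \<not> valid M) \<or> (\<exists>N. Meets N L \<and> Disj N M)" for L M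
  proof (cases "valid L \<and> valid M \<and> \<not> D L \<subseteq> D M")
    case True
    then obtain N where "valid N" "D N = D L - D M"
      using compact_open_code compact_open_Diff compact_open_D by metis
    with True have "Meets N L \<and> Disj N M" by (auto simp: Meets_iff Disj_def)
    with True show ?thesis by (auto simp: Sub_def)
  next
    case False
    then show ?thesis by (auto simp: Sub_def Meets_iff Disj_def)
  qed
  ultimately show "semidec (\<lambda>p. \<not> Sub (fst p) (snd p))" by simp
qed

lemmas decidable_Sub' [computable_intros] = decidable_comp2 [OF decidable_Sub]

subsection \<open>Compact open cosets\<close>

text \<open>Closure under the ternary heap operation. A nonempty set of this kind is a left coset of
  one subgroup and a right coset of another, in general different, one; the condition mentions
  neither, which makes it accessible to codes.\<close>

definition cosety :: "'q set \<Rightarrow> bool" where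
  "cosety A \<longleftrightarrow> A \<subseteq> carrier Q \<and> (\<forall>x\<in>A. \<forall>y\<in>A. \<forall>z\<in>A. x \<otimes> (inv y \<otimes> z) \<in> A)"

lemma cosety_Int: "cosety A \<Longrightarrow> cosety A' \<Longrightarrow> cosety (A \<inter> A')"
  unfolding cosety_def by auto

lemma cosety_set_inv: "cosety A \<Longrightarrow> cosety (set_inv A)"
proof -
  assume A: "cosety A"
  have "inv x \<otimes> (inv (inv y) \<otimes> inv z) \<in> set_inv A" if "x \<in> A" "y \<in> A" "z \<in> A" for x y z
  proof -
    have "x \<in> carrier Q" "y \<in> carrier Q" "z \<in> carrier Q" "z \<otimes> (inv y \<otimes> x) \<in> A"
      using that A by (auto simp: cosety_def)
    moreover from this have "inv x \<otimes> (inv (inv y) \<otimes> inv z) = inv (z \<otimes> (inv y \<otimes> x))"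
      by (simp add: inv_mult_group m_assoc)
    ultimately show ?thesis by (auto simp: SET_INV_def)
  qed
  then show ?thesis using A by (auto simp: cosety_def SET_INV_def)
qed

lemma cosety_subgroup: "subgroup U Q \<Longrightarrow> cosety U"
  unfolding cosety_def
  by (metis subgroup.m_closed subgroup.m_inv_closed subgroup.subset)

lemma cosety_lcoset:
  assumes U: "subgroup U Q" and a: "a \<in> carrier Q" shows "cosety (a <# U)"
proof -
  have UQ: "U \<subseteq> carrier Q" using U by (rule subgroup.subset)
  have "a \<otimes> x \<otimes> (inv (a \<otimes> y) \<otimes> (a \<otimes> z)) \<in> a <# U" if "x \<in> U" "y \<in> U" "z \<in> U" for x y z
  proof -
    have "a \<otimes> x \<otimes> (inv (a \<otimes> y) \<otimes> (a \<otimes> z)) = a \<otimes> (x \<otimes> (inv y \<otimes> z))"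
      using that a UQ by (simp add: subset_iff inv_mult_group m_assoc cancel_simps)
    moreover have "x \<otimes> (inv y \<otimes> z) \<in> U" using cosety_subgroup [OF U] that by (auto simp: cosety_def)
    ultimately show ?thesis by (auto simp: l_coset_def)
  qed
  then show ?thesis using a UQ by (auto simp: cosety_def l_coset_def)
qed

lemma cosety_rcoset:
  assumes U: "subgroup U Q" and a: "a \<in> carrier Q" shows "cosety (U #> a)"
proof -
  have UQ: "U \<subseteq> carrier Q" using U by (rule subgroup.subset)
  have "x \<otimes> a \<otimes> (inv (y \<otimes> a) \<otimes> (z \<otimes> a)) \<in> U #> a" if "x \<in> U" "y \<in> U" "z \<in> U" for x y z
  proof -
    have "x \<otimes> a \<otimes> (inv (y \<otimes> a) \<otimes> (z \<otimes> a)) = x \<otimes> (inv y \<otimes> z) \<otimes> a"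
      using that a UQ by (simp add: subset_iff inv_mult_group m_assoc cancel_simps)
    moreover have "x \<otimes> (inv y \<otimes> z) \<in> U" using cosety_subgroup [OF U] that by (auto simp: cosety_def)
    ultimately show ?thesis by (auto simp: r_coset_def)
  qed
  then show ?thesis using a UQ by (auto simp: cosety_def r_coset_def)
qed

text \<open>The two subgroups attached to a coset \<open>A\<close>: it is a left coset of
  \<open>set_inv A <#> A\<close> and a right coset of \<open>A <#> set_inv A\<close>. Closure of
  these sets under products is the ternary condition with one factor split off.\<close>

lemma cosety_stabilizers:
  assumes A: "cosety A" "compact_open A" and a: "a \<in> A"
  shows "set_inv A <#> A \<in> compact_open_subgroups Q X" "a <# (set_inv A <#> A) = A"
    and "A <#> set_inv A \<in> compact_open_subgroups Q X" "(A <#> set_inv A) #> a = A"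
proof -
  have AQ: "A \<subseteq> carrier Q" and clos: "\<And>x y z. x \<in> A \<Longrightarrow> y \<in> A \<Longrightarrow> z \<in> A \<Longrightarrow> x \<otimes> (inv y \<otimes> z) \<in> A"
    using A(1) by (auto simp: cosety_def)
  have l: "set_inv A <#> A = {inv x \<otimes> y | x y. x \<in> A \<and> y \<in> A}"
    and r: "A <#> set_inv A = {x \<otimes> inv y | x y. x \<in> A \<and> y \<in> A}"
    by (auto simp: SET_INV_def set_mult_def)
  have "subgroup (set_inv A <#> A) Q"
    unfolding l
  proof (rule subgroupI)
    show "{inv x \<otimes> y | x y. x \<in> A \<and> y \<in> A} \<subseteq> carrier Q" using AQ by auto
    show "{inv x \<otimes> y | x y. x \<in> A \<and> y \<in> A} \<noteq> {}" using a by blast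
  next
    fix u assume "u \<in> {inv x \<otimes> y | x y. x \<in> A \<and> y \<in> A}"
    then obtain x y where xy: "u = inv x \<otimes> y" "x \<in> A" "y \<in> A" by blast
    then have "inv u = inv y \<otimes> x" using AQ by (simp add: subset_iff inv_mult_group)
    with xy show "inv u \<in> {inv x \<otimes> y | x y. x \<in> A \<and> y \<in> A}" by blast
  next
    fix u v assume "u \<in> {inv x \<otimes> y | x y. x \<in> A \<and> y \<in> A}" "v \<in> {inv x \<otimes> y | x y. x \<in> A \<and> y \<in> A}"
    then obtain x y z w where xy: "u = inv x \<otimes> y" "x \<in> A" "y \<in> A" "v = inv z \<otimes> w" "z \<in> A" "w \<in> A" by blast
    then have "u \<otimes> v = inv x \<otimes> (y \<otimes> (inv z \<otimes> w))" using AQ by (simp add: subset_iff m_assoc)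
    with xy clos show "u \<otimes> v \<in> {inv x \<otimes> y | x y. x \<in> A \<and> y \<in> A}" by blast
  qed
  moreover have "subgroup (A <#> set_inv A) Q"
    unfolding r
  proof (rule subgroupI)
    show "{x \<otimes> inv y | x y. x \<in> A \<and> y \<in> A} \<subseteq> carrier Q" using AQ by auto
    show "{x \<otimes> inv y | x y. x \<in> A \<and> y \<in> A} \<noteq> {}" using a by blast
  next
    fix u assume "u \<in> {x \<otimes> inv y | x y. x \<in> A \<and> y \<in> A}"
    then obtain x y where xy: "u = x \<otimes> inv y" "x \<in> A" "y \<in> A" by blast
    then have "inv u = y \<otimes> inv x" using AQ by (simp add: subset_iff inv_mult_group)
    with xy show "inv u \<in> {x \<otimes> inv y | x y. x \<in> A \<and> y \<in> A}" by blast
  next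
    fix u v assume "u \<in> {x \<otimes> inv y | x y. x \<in> A \<and> y \<in> A}" "v \<in> {x \<otimes> inv y | x y. x \<in> A \<and> y \<in> A}"
    then obtain x y z w where xy: "u = x \<otimes> inv y" "x \<in> A" "y \<in> A" "v = z \<otimes> inv w" "z \<in> A" "w \<in> A" by blast
    then have "u \<otimes> v = (x \<otimes> (inv y \<otimes> z)) \<otimes> inv w" using AQ by (simp add: subset_iff m_assoc)
    with xy clos show "u \<otimes> v \<in> {x \<otimes> inv y | x y. x \<in> A \<and> y \<in> A}" by blast
  qed
  ultimately show "set_inv A <#> A \<in> compact_open_subgroups Q X" "A <#> set_inv A \<in> compact_open_subgroups Q X"
    using compact_open_set_mult compact_open_set_inv A(2)
    by (simp_all add: compact_open_subgroups_def compact_open_def)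
  show "a <# (set_inv A <#> A) = A"
  proof
    show "a <# (set_inv A <#> A) \<subseteq> A" unfolding l l_coset_def using clos a by auto
    show "A \<subseteq> a <# (set_inv A <#> A)"
    proof
      fix x assume x: "x \<in> A"
      then have "x = a \<otimes> (inv a \<otimes> x)" using a AQ by (simp add: subset_iff cancel_simps)
      with x a show "x \<in> a <# (set_inv A <#> A)" unfolding l l_coset_def by blast
    qed
  qed
  show "(A <#> set_inv A) #> a = A"
  proof
    have "x \<otimes> inv y \<otimes> a \<in> A" if "x \<in> A" "y \<in> A" for x y
      using clos [OF that a] that a AQ by (simp add: subset_iff m_assoc)
    then show "(A <#> set_inv A) #> a \<subseteq> A" unfolding r r_coset_def by auto
    show "A \<subseteq> (A <#> set_inv A) #> a"
    proof
      fix x assume x: "x \<in> A"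
      then have "x = x \<otimes> inv a \<otimes> a" using a AQ by (simp add: subset_iff m_assoc)
      with x a show "x \<in> (A <#> set_inv A) #> a" unfolding r r_coset_def by blast
    qed
  qed
qed

lemma lcosetE:
  assumes "A \<in> lcosets V" "subgroup V Q"
  obtains a where "a \<in> carrier Q" "A = a <# V" "a \<in> A"
  using assms by (auto simp: LCOSETS_def lcos_self)

lemma rcosetE:
  assumes "A \<in> rcosets V" "subgroup V Q"
  obtains a where "a \<in> carrier Q" "A = V #> a" "a \<in> A"
  using assms by (auto simp: RCOSETS_def rcos_self)

lemma meet_groupoid_carrier:
  "A \<in> mg_carrier (meet_groupoid_of Q X) \<longleftrightarrow> compact_open A \<and> cosety A"
proof
  assume "A \<in> mg_carrier (meet_groupoid_of Q X)"
  then consider "A = {}" | V where "V \<in> compact_open_subgroups Q X" "A \<in> lcosets V \<or> A \<in> rcosets V"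
    by (auto simp: meet_groupoid_of_def)
  then show "compact_open A \<and> cosety A"
  proof cases
    case 1
    then show ?thesis by (simp add: compact_open_def cosety_def)
  next
    case 2
    then have V: "subgroup V Q" "compact_open V" by (auto simp: compact_open_subgroups_def compact_open_def)
    from 2(2) show ?thesis
      using V compact_open_translate cosety_lcoset cosety_rcoset by (auto elim!: lcosetE rcosetE)
  qed
next
  assume A: "compact_open A \<and> cosety A"
  show "A \<in> mg_carrier (meet_groupoid_of Q X)"
  proof (cases "A = {}")
    case True
    then show ?thesis by (simp add: meet_groupoid_of_def)
  next
    case False
    then obtain a where a: "a \<in> A" by blast
    then have "a \<in> carrier Q" using A by (auto simp: cosety_def)
    with cosety_stabilizers(1,2) [OF _ _ a] A show ?thesis
      by (auto simp: meet_groupoid_of_def LCOSETS_def)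
  qed
qed

lemma set_inv_lcoset_mult:
  assumes V: "subgroup V Q" and a: "a \<in> carrier Q"
  shows "set_inv (a <# V) <#> (a <# V) = V"
proof -
  have VQ: "V \<subseteq> carrier Q" using V by (rule subgroup.subset)
  have eq: "inv (a \<otimes> x) \<otimes> (a \<otimes> y) = inv x \<otimes> y" if "x \<in> V" "y \<in> V" for x y
    using that a VQ by (simp add: subset_iff inv_mult_group m_assoc cancel_simps)
  show ?thesis
  proof
    show "set_inv (a <# V) <#> (a <# V) \<subseteq> V"
      using eq subgroup.m_closed [OF V] subgroup.m_inv_closed [OF V]
      by (auto simp: SET_INV_def set_mult_def l_coset_def)
    have one: "\<one> \<in> V" using V by (rule subgroup.one_closed)
    have "x \<in> set_inv (a <# V) <#> (a <# V)" if "x \<in> V" for x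
    proof -
      have "x = inv (a \<otimes> \<one>) \<otimes> (a \<otimes> x)" using eq [OF one that] that VQ by (simp add: subset_iff)
      then show ?thesis using one that by (auto simp: SET_INV_def set_mult_def l_coset_def)
    qed
    then show "V \<subseteq> set_inv (a <# V) <#> (a <# V)" by blast
  qed
qed

lemma rcoset_mult_set_inv:
  assumes V: "subgroup V Q" and a: "a \<in> carrier Q"
  shows "(V #> a) <#> set_inv (V #> a) = V"
proof -
  have VQ: "V \<subseteq> carrier Q" using V by (rule subgroup.subset)
  have eq: "(x \<otimes> a) \<otimes> inv (y \<otimes> a) = x \<otimes> inv y" if "x \<in> V" "y \<in> V" for x y
    using that a VQ by (simp add: subset_iff inv_mult_group m_assoc cancel_simps)
  show ?thesis
  proof
    show "(V #> a) <#> set_inv (V #> a) \<subseteq> V"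
      using eq subgroup.m_closed [OF V] subgroup.m_inv_closed [OF V]
      by (auto simp: SET_INV_def set_mult_def r_coset_def)
    have one: "\<one> \<in> V" using V by (rule subgroup.one_closed)
    have "x \<in> (V #> a) <#> set_inv (V #> a)" if "x \<in> V" for x
    proof -
      have "x = (x \<otimes> a) \<otimes> inv (\<one> \<otimes> a)" using eq [OF that one] that VQ by (simp add: subset_iff)
      then show ?thesis using one that by (auto simp: SET_INV_def set_mult_def r_coset_def)
    qed
    then show "V \<subseteq> (V #> a) <#> set_inv (V #> a)" by blast
  qed
qed

text \<open>The subgroup of which a set is a left (or right) coset is unique, being recovered from
  the set. The existential over \<open>V\<close> thus becomes an equality of two compact open sets
  computed from \<open>A\<close> and \<open>A'\<close>.\<close>

lemma product_defined_iff:
  assumes "compact_open A" "cosety A" "compact_open A'" "cosety A'"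
  shows "(\<exists>V\<in>compact_open_subgroups Q X. A \<in> lcosets V \<and> A' \<in> rcosets V) \<longleftrightarrow>
    A \<noteq> {} \<and> A' \<noteq> {} \<and> set_inv A <#> A = A' <#> set_inv A'" (is "?L \<longleftrightarrow> ?R")
proof
  assume ?L
  then obtain V where V: "V \<in> compact_open_subgroups Q X" "A \<in> lcosets V" "A' \<in> rcosets V" by blast
  then have sV: "subgroup V Q" by (simp add: compact_open_subgroups_def)
  obtain a where a: "a \<in> carrier Q" "A = a <# V" "a \<in> A" using V(2) sV by (rule lcosetE)
  obtain b where b: "b \<in> carrier Q" "A' = V #> b" "b \<in> A'" using V(3) sV by (rule rcosetE)
  show ?R
    using a b set_inv_lcoset_mult [OF sV a(1)] rcoset_mult_set_inv [OF sV b(1)] by auto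
next
  assume R: ?R
  then obtain a b where ab: "a \<in> A" "b \<in> A'" by blast
  then have "a \<in> carrier Q" "b \<in> carrier Q" using assms by (auto simp: cosety_def)
  with cosety_stabilizers(1,2) [OF assms(2,1) ab(1)] cosety_stabilizers(4) [OF assms(4,3) ab(2)] R
  show ?L by (intro bexI [of _ "set_inv A <#> A"]) (auto simp: LCOSETS_def RCOSETS_def)
qed

text \<open>\<open>inv x \<otimes> y\<close> lies in the subgroup shared by both factors, and this
  subgroup maps \<open>A'\<close> to itself from the left. The second claim also serves to recover
  the exact product from inclusions.\<close>

lemma product_cosety:
  assumes A: "cosety A" "cosety A'" and eq: "set_inv A <#> A = A' <#> set_inv A'"
  shows "cosety (A <#> A')" "\<And>x y z. x \<in> A \<Longrightarrow> y \<in> A \<Longrightarrow> z \<in> A' \<Longrightarrow> inv x \<otimes> (y \<otimes> z) \<in> A'"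
proof -
  have AQ: "A \<subseteq> carrier Q" "A' \<subseteq> carrier Q" using A by (auto simp: cosety_def)
  show 2: "inv x \<otimes> (y \<otimes> z) \<in> A'" if xyz: "x \<in> A" "y \<in> A" "z \<in> A'" for x y z
  proof -
    have "inv x \<otimes> y \<in> set_inv A <#> A" using xyz by (auto simp: set_mult_def SET_INV_def)
    then obtain u v where uv: "inv x \<otimes> y = u \<otimes> inv v" "u \<in> A'" "v \<in> A'"
      unfolding eq by (auto simp: set_mult_def SET_INV_def)
    have "inv x \<otimes> (y \<otimes> z) = u \<otimes> inv v \<otimes> z" using xyz AQ uv(1) by (simp add: subset_iff flip: m_assoc)
    also have "\<dots> = u \<otimes> (inv v \<otimes> z)" using uv xyz AQ by (simp add: subset_iff m_assoc)
    finally show ?thesis using A(2) uv xyz by (simp add: cosety_def)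
  qed
  have "(x \<otimes> x') \<otimes> (inv (y \<otimes> y') \<otimes> (z \<otimes> z')) \<in> A <#> A'"
    if "x \<in> A" "y \<in> A" "z \<in> A" "x' \<in> A'" "y' \<in> A'" "z' \<in> A'" for x y z x' y' z'
  proof -
    have "inv y \<otimes> (z \<otimes> z') \<in> A'" using 2 that by blast
    then have "x' \<otimes> (inv y' \<otimes> (inv y \<otimes> (z \<otimes> z'))) \<in> A'" using A(2) that by (simp add: cosety_def)
    moreover have "(x \<otimes> x') \<otimes> (inv (y \<otimes> y') \<otimes> (z \<otimes> z')) = x \<otimes> (x' \<otimes> (inv y' \<otimes> (inv y \<otimes> (z \<otimes> z'))))"
      using that AQ by (simp add: subset_iff inv_mult_group m_assoc)
    ultimately show ?thesis using that by (auto simp: set_mult_def)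
  qed
  then show "cosety (A <#> A')" using AQ by (auto simp: cosety_def set_mult_def)
qed

lemma mg_prod_iff:
  assumes "compact_open A" "cosety A" "compact_open A'" "cosety A'"
  shows "mg_prod (meet_groupoid_of Q X) A A' =
    (if A \<noteq> {} \<and> A' \<noteq> {} \<and> set_inv A <#> A = A' <#> set_inv A' then Some (A <#> A') else None)"
  unfolding meet_groupoid_of_def using product_defined_iff [OF assms] by simp

text \<open>Continuity of multiplication in terms of codes. It provides neighbourhoods on which the
  failure of a closure condition persists, as required for refuting that a code describes a
  coset.\<close>

lemma mult_nbhd:
  assumes "valid N" "x \<in> carrier Q" "y \<in> carrier Q" "x \<otimes> y \<in> D N"
  obtains L M where "x \<in> D L" "y \<in> D M" "Mul L M N"
proof -
  have "openin (prod_topology X X) {p \<in> topspace (prod_topology X X). (\<lambda>(x, y). x \<otimes> y) p \<in> D N}"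
    using continuous_mult compact_open_D [OF assms(1)] openin_continuous_map_preimage
    unfolding compact_open_def by blast
  moreover have "(x, y) \<in> {p \<in> topspace (prod_topology X X). (\<lambda>(x, y). x \<otimes> y) p \<in> D N}"
    using assms by (simp add: topspace_eq)
  ultimately have "\<exists>U V. openin X U \<and> openin X V \<and> x \<in> U \<and> y \<in> V \<and>
      U \<times> V \<subseteq> {p \<in> topspace (prod_topology X X). (\<lambda>(x, y). x \<otimes> y) p \<in> D N}"
    unfolding openin_prod_topology_alt by (elim allE impE)
  then obtain U V where UV: "openin X U" "openin X V" "x \<in> U" "y \<in> V"
    "U \<times> V \<subseteq> {p \<in> topspace (prod_topology X X). (\<lambda>(x, y). x \<otimes> y) p \<in> D N}"
    by (elim exE conjE)
  obtain s where s: "C s" "x \<in> B s" "B s \<subseteq> U" using B_base [OF UV(1,3)] by blast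
  obtain t where t: "C t" "y \<in> B t" "B t \<subseteq> V" using B_base [OF UV(2,4)] by blast
  have "a \<otimes> b \<in> D N" if "a \<in> U" "b \<in> V" for a b using UV(5) that by auto
  then have "Mul [s] [t] N"
    using s(1) t(1) assms(1) subsetD [OF s(3)] subsetD [OF t(3)]
    by (intro MulI) (simp_all add: list_Union_def [of B "[_]"])
  with s t show thesis by (intro that [of "[s]" "[t]"]) (auto simp: list_Union_def)
qed

lemma inv_nbhd:
  assumes "valid N" "x \<in> carrier Q" "inv x \<in> D N"
  obtains L where "x \<in> D L" "Invr L N"
proof -
  obtain L where "valid L" "Invr N L" "D L = set_inv (D N)" using assms(1) by (rule Invr_exact)
  with assms D_carrier [OF assms(1)] show thesis
    by (intro that [of L] InvrI) (auto simp: SET_INV_def intro!: bexI [of _ "inv x"])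
qed

definition Coset :: "'c list \<Rightarrow> bool" where
  "Coset L \<longleftrightarrow> valid L \<and> cosety (D L)"

lemma decidable_Coset: "decidable Coset"
proof (rule decidableI_semidec)
  \<comment> \<open>Upper bounds \<open>L'\<close> and \<open>N\<close> for the inverse and the
    product are enough, since enlarging them only strengthens the last condition.\<close>
  have "semidec (\<lambda>L. \<exists>L' N. Invr L L' \<and> Mul L' L N \<and> Mul L N L)"
    by (intro semidec_intros computable_intros)
  moreover have "Coset L \<longleftrightarrow> (\<exists>L' N. Invr L L' \<and> Mul L' L N \<and> Mul L N L)" for L
  proof
    assume L: "Coset L"
    then obtain L' where L': "valid L'" "Invr L L'" "D L' = set_inv (D L)"
      using Invr_exact by (auto simp: Coset_def)
    have vL: "valid L" using L by (simp add: Coset_def)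
    obtain N where N: "valid N" "Mul L' L N" "D N = D L' <#> D L"
      using L'(1) vL by (rule Mul_exact)
    have "Mul L N L"
      using L N(1) unfolding Coset_def cosety_def N(3) L'(3)
      by (intro MulI) (auto simp: N(3) L'(3) set_mult_def SET_INV_def)
    with L' N show "\<exists>L' N. Invr L L' \<and> Mul L' L N \<and> Mul L N L" by blast
  next
    assume "\<exists>L' N. Invr L L' \<and> Mul L' L N \<and> Mul L N L"
    then show "Coset L"
      unfolding Coset_def cosety_def using D_carrier InvrD MulD by (auto simp: Invr_def)
  qed
  ultimately show "semidec Coset" by (rule semidec_cong)
next
  \<comment> \<open>A refutation: \<open>L1\<close>, \<open>L2\<close>, \<open>L3\<close> surround
    points x, y, z of the set, \<open>M1\<close> contains the inverses of \<open>L2\<close>,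
    \<open>M\<close> the products of \<open>M1\<close> and \<open>L3\<close>, and \<open>Z\<close>,
    disjoint from the set, the products of \<open>L1\<close> and \<open>M\<close>. It is enough that
    each neighbourhood meets the set, as any points in these intersections violate closure.\<close>
  let ?R = "\<lambda>L. \<exists>Z L1 M M1 L2 L3. Meets L1 L \<and> Meets L2 L \<and> Meets L3 L \<and>
    Mul L1 M Z \<and> Mul M1 L3 M \<and> Invr L2 M1 \<and> Disj Z L"
  have "semidec (\<lambda>L. \<not> valid L \<or> ?R L)"
    by (rule semidec_disj [OF semidec_decidable]) (intro semidec_intros computable_intros)+
  moreover have "\<not> Coset L \<longleftrightarrow> \<not> valid L \<or> ?R L" for L
  proof (cases "valid L")
    case True
    have "\<not> Coset L" if "?R L"
    proof -
      from that obtain Z L1 M M1 L2 L3 where *: "Meets L1 L" "Meets L2 L" "Meets L3 L"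
        "Mul L1 M Z" "Mul M1 L3 M" "Invr L2 M1" "Disj Z L" by blast
      then obtain x y z where xyz: "x \<in> D L1" "x \<in> D L" "y \<in> D L2" "y \<in> D L" "z \<in> D L3" "z \<in> D L"
        unfolding Meets_iff by blast
      then have "x \<otimes> (inv y \<otimes> z) \<in> D Z" using * MulD InvrD by metis
      then show ?thesis using xyz *(7) by (auto simp: Coset_def cosety_def Disj_def)
    qed
    moreover have "?R L" if nC: "\<not> Coset L"
    proof -
      obtain x y z where xyz: "x \<in> D L" "y \<in> D L" "z \<in> D L" "x \<otimes> (inv y \<otimes> z) \<notin> D L"
        using nC True D_carrier by (auto simp: Coset_def cosety_def)
      note Q = xyz(1-3) [THEN D_carrier [OF True]]
      have "openin X (topspace X - D L)"
        using compact_open_closedin [OF compact_open_D [OF True]] by blast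
      then obtain s where s: "C s" "x \<otimes> (inv y \<otimes> z) \<in> B s" "B s \<subseteq> topspace X - D L"
        using B_base [of "topspace X - D L" "x \<otimes> (inv y \<otimes> z)"] xyz Q topspace_eq by auto
      then have Z: "valid [s]" "x \<otimes> (inv y \<otimes> z) \<in> D [s]" "Disj [s] L"
        using True by (auto simp: Disj_def list_Union_def)
      obtain L1 M where M: "x \<in> D L1" "inv y \<otimes> z \<in> D M" "Mul L1 M [s]"
        using mult_nbhd [OF Z(1) Q(1) m_closed [OF inv_closed [OF Q(2)] Q(3)] Z(2)] by blast
      then have vM: "valid M" "valid L1" by (auto simp: Mul_def)
      obtain M1 L3 where M1: "inv y \<in> D M1" "z \<in> D L3" "Mul M1 L3 M"
        using vM M Q by (auto elim: mult_nbhd)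
      then have vM1: "valid M1" "valid L3" by (auto simp: Mul_def)
      obtain L2 where L2: "y \<in> D L2" "Invr L2 M1" using vM1 Q M1 by (auto elim: inv_nbhd)
      then have "valid L2" by (simp add: Invr_def)
      then have "Meets L1 L" "Meets L2 L" "Meets L3 L"
        unfolding Meets_iff using M(1) M1(2) L2(1) xyz vM vM1 True by auto
      with M M1 L2 Z show ?thesis by blast
    qed
    ultimately show ?thesis using True by blast
  qed (simp add: Coset_def)
  ultimately show "semidec (\<lambda>L. \<not> Coset L)" by simp
qed

section \<open>Least codes and the copy of the meet groupoid\<close>

definition canonical :: "'c list \<Rightarrow> bool" where
  "canonical L \<longleftrightarrow> Coset L \<and> (\<forall>k<enc L. \<not> (Sub L (dec k) \<and> Sub (dec k) L))"

lemma decidable_canonical: "decidable canonical"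
proof -
  have "decidable (\<lambda>L. canonical L)"
    unfolding canonical_def by (intro computable_intros decidable_comp [OF decidable_Coset])
  then show ?thesis by simp
qed

lemmas decidable_canonical' [computable_intros] = decidable_comp [OF decidable_canonical]

lemma canonicalD: "canonical L \<Longrightarrow> valid L" "canonical L \<Longrightarrow> cosety (D L)" "canonical L \<Longrightarrow> compact_open (D L)"
  by (auto simp: canonical_def Coset_def compact_open_D)

lemma canonical_eqI:
  assumes "canonical L" "canonical M" "D L = D M" shows "L = M"
proof -
  have "Sub L M" "Sub M L" using assms canonicalD by (auto simp: Sub_def)
  then have "\<not> enc M < enc L" "\<not> enc L < enc M"
    using assms(1,2) unfolding canonical_def by (metis dec_enc)+
  then show ?thesis by (metis enc_eq_iff linorder_neqE_nat)
qed

lemma canonical_code: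
  assumes "compact_open A" "cosety A"
  obtains L where "canonical L" "D L = A"
proof -
  let ?P = "\<lambda>n. valid (dec n) \<and> D (dec n) = A"
  obtain M where "valid M" "D M = A" using assms(1) by (rule compact_open_code)
  then have ex: "?P (enc M)" by simp
  define n where "n = (LEAST n. ?P n)"
  have n: "?P n" unfolding n_def using ex by (rule LeastI)
  have "canonical (dec n)"
    unfolding canonical_def Coset_def
  proof (intro conjI allI impI)
    fix k assume "k < enc (dec n :: 'c list)"
    then have "\<not> ?P k" unfolding n_def by (intro not_less_Least) simp
    then show "\<not> (Sub (dec n) (dec k) \<and> Sub (dec k) (dec n))" using n by (auto simp: Sub_def)
  qed (use n assms in auto)
  with n show thesis by (intro that [of "dec n"]) auto
qed

definition codes :: "nat set" where
  "codes = {n. canonical (dec n)}"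

definition code_set :: "nat \<Rightarrow> 'q set" where
  "code_set n = D (dec n)"

lemma code_setD:
  assumes "n \<in> codes"
  shows "valid (dec n)" "cosety (code_set n)" "compact_open (code_set n)"
  using assms canonicalD by (auto simp: codes_def code_set_def)

lemma bij_code_set: "bij_betw code_set codes (mg_carrier (meet_groupoid_of Q X))"
  unfolding bij_betw_def
proof
  show "inj_on code_set codes"
    using canonical_eqI by (intro inj_onI) (metis code_set_def codes_def enc_dec mem_Collect_eq)
  show "code_set ` codes = mg_carrier (meet_groupoid_of Q X)"
  proof safe
    fix n assume "n \<in> codes"
    then show "code_set n \<in> mg_carrier (meet_groupoid_of Q X)"
      using code_setD by (simp add: meet_groupoid_carrier)
  next
    fix A assume "A \<in> mg_carrier (meet_groupoid_of Q X)"
    then obtain L where "canonical L" "D L = A"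
      using canonical_code by (auto simp: meet_groupoid_carrier)
    then show "A \<in> code_set ` codes"
      by (intro image_eqI [of _ _ "enc L"]) (simp_all add: code_set_def codes_def)
  qed
qed

definition code_of :: "'q set \<Rightarrow> nat" where
  "code_of = inv_into codes code_set"

lemma code_of:
  assumes "compact_open A" "cosety A"
  shows "code_of A \<in> codes" "code_set (code_of A) = A"
proof -
  have "A \<in> code_set ` codes"
    using assms bij_code_set by (simp add: bij_betw_def meet_groupoid_carrier)
  then show "code_of A \<in> codes" "code_set (code_of A) = A"
    unfolding code_of_def by (rule inv_into_into, rule f_inv_into_f)
qed

lemma code_of_eqI: "n \<in> codes \<Longrightarrow> code_set n = A \<Longrightarrow> n = code_of A"
  using bij_code_set unfolding code_of_def by (auto simp: bij_betw_def)

text \<open>The operations are transported along the bijection \<open>code_set\<close>, so that the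
  isomorphism is built in and the effort goes into their computability.\<close>

definition copy :: "nat meet_groupoid" where
  "copy = \<lparr> mg_carrier = codes,
     mg_inv = (\<lambda>a. code_of (set_inv (code_set a))),
     mg_meet = (\<lambda>a b. code_of (code_set a \<inter> code_set b)),
     mg_prod = (\<lambda>a b. map_option code_of (mg_prod (meet_groupoid_of Q X) (code_set a) (code_set b))) \<rparr>"

lemma mg_carrier_copy [simp]: "mg_carrier copy = codes"
  by (simp add: copy_def)

lemma meet_groupoid_closed:
  assumes "compact_open A" "cosety A" "compact_open A'" "cosety A'"
    and "mg_prod (meet_groupoid_of Q X) A A' = Some A''"
  shows "compact_open A''" "cosety A''"
  using assms(5) compact_open_set_mult [OF assms(1,3)] product_cosety [OF assms(2,4)]
  unfolding mg_prod_iff [OF assms(1-4)] by (auto split: if_splits)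

lemma mg_closed_copy: "mg_closed copy"
  unfolding mg_closed_def copy_def
  using meet_groupoid_closed [OF code_setD(3,2) code_setD(3,2)]
  by (auto intro!: code_of(1) compact_open_set_inv cosety_set_inv compact_open_Int cosety_Int
      code_setD)

lemma mg_iso_copy: "mg_iso code_set copy (meet_groupoid_of Q X)"
  unfolding mg_iso_def
proof (intro conjI ballI)
  show "bij_betw code_set (mg_carrier copy) (mg_carrier (meet_groupoid_of Q X))"
    using bij_code_set by (simp add: copy_def)
next
  fix a assume "a \<in> mg_carrier copy"
  then have a: "a \<in> codes" by (simp add: copy_def)
  then show "code_set (mg_inv copy a) = mg_inv (meet_groupoid_of Q X) (code_set a)"
    by (simp add: copy_def meet_groupoid_of_def code_of compact_open_set_inv cosety_set_inv code_setD)
  fix b assume "b \<in> mg_carrier copy"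
  then have b: "b \<in> codes" by (simp add: copy_def)
  show "code_set (mg_meet copy a b) = mg_meet (meet_groupoid_of Q X) (code_set a) (code_set b)"
    using a b by (simp add: copy_def meet_groupoid_of_def code_of compact_open_Int cosety_Int code_setD)
  show "map_option code_set (mg_prod copy a b) = mg_prod (meet_groupoid_of Q X) (code_set a) (code_set b)"
  proof (cases "mg_prod (meet_groupoid_of Q X) (code_set a) (code_set b)")
    case (Some A)
    then show ?thesis
      using meet_groupoid_closed [OF _ _ _ _ Some] a b code_setD
      by (simp add: copy_def code_of)
  qed (simp add: copy_def)
qed

subsection \<open>Computability of the copy\<close>

lemma codes_computable: "computable_set codes"
  unfolding codes_def computable_set_decidable by (rule decidable_canonical)

lemma decidable_codes [computable_intros]: "computable f \<Longrightarrow> decidable (\<lambda>x. f x \<in> codes)"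
  unfolding codes_def mem_Collect_eq by (intro computable_intros)

lemma copy_inv_computable: "\<exists>e. \<forall>a\<in>mg_carrier copy. recf_eval e [a] = Some (mg_inv copy a)"
proof -
  \<comment> \<open>\<open>Invr\<close> states only an inclusion; in both directions it pins down
    the inverse exactly, because inversion is an involution.\<close>
  let ?R = "\<lambda>a c. c \<in> codes \<and> Invr (dec a) (dec c) \<and> Invr (dec c) (dec a)"
  have "\<exists>e. \<forall>a. a \<in> codes \<longrightarrow> recf_eval e [enc a] = Some (enc (mg_inv copy a))"
  proof (rule semidec_computes [of ?R])
    show "semidec (\<lambda>p. ?R (fst p) (snd p))"
      by (intro semidec_conj semidec_decidable [OF decidable_codes] semidec_intros computable_intros)
  next
    fix a assume a: "a \<in> codes"
    let ?c = "code_of (set_inv (code_set a))"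
    have c: "?c \<in> codes" "code_set ?c = set_inv (code_set a)"
      using a by (simp_all add: code_of compact_open_set_inv cosety_set_inv code_setD)
    have "inv x \<in> code_set ?c" if "x \<in> code_set a" for x
      using that unfolding c(2) by (auto simp: SET_INV_def)
    moreover have "inv x \<in> code_set a" if "x \<in> code_set ?c" for x
      using that compact_open_carrier [OF code_setD(3) [OF a]] unfolding c(2) by (auto simp: SET_INV_def)
    ultimately have "Invr (dec a) (dec ?c)" "Invr (dec ?c) (dec a)"
      using code_setD(1) [OF a] code_setD(1) [OF c(1)] by (auto intro!: InvrI simp: code_set_def)
    with c show "\<exists>c. ?R a c" by blast
  next
    fix a c assume a: "a \<in> codes" and c: "?R a c"
    have "code_set c = set_inv (code_set a)"
    proof
      show "set_inv (code_set a) \<subseteq> code_set c" using c by (auto simp: Invr_def code_set_def)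
      show "code_set c \<subseteq> set_inv (code_set a)"
      proof
        fix x assume x: "x \<in> code_set c"
        then have "inv x \<in> code_set a" using c InvrD by (auto simp: code_set_def)
        moreover have "x \<in> carrier Q" using x c code_setD D_carrier by (metis code_set_def)
        then have "x = inv (inv x)" by simp
        ultimately show "x \<in> set_inv (code_set a)" unfolding SET_INV_def by blast
      qed
    qed
    then show "c = mg_inv copy a" using c by (simp add: copy_def code_of_eqI)
  qed
  then show ?thesis by (auto simp: copy_def)
qed

text \<open>Equality with the intersection in positive form: \<open>K\<close> absorbs the points of
  \<open>L\<close> that \<open>N\<close> misses, and being disjoint from \<open>M\<close> it shows
  that none of them belongs to the intersection.\<close>

definition Inter :: "'c list \<Rightarrow> 'c list \<Rightarrow> 'c list \<Rightarrow> bool" where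
  "Inter L M N \<longleftrightarrow> Sub N L \<and> Sub N M \<and> (\<exists>K. Sub L (N @ K) \<and> Disj K M)"

lemma semidec_Inter [semidec_intros]:
  assumes "computable f" "computable g" "computable h"
  shows "semidec (\<lambda>x. Inter (f x) (g x) (h x))"
proof (rule semidec_comp3 [OF _ assms])
  show "semidec (\<lambda>p. Inter (fst p) (fst (snd p)) (snd (snd p)))"
    unfolding Inter_def by (intro semidec_intros computable_intros)
qed

lemma Inter_iff: "Inter L M N \<longleftrightarrow> valid L \<and> valid M \<and> valid N \<and> D N = D L \<inter> D M"
proof
  assume "Inter L M N"
  then show "valid L \<and> valid M \<and> valid N \<and> D N = D L \<inter> D M"
    by (auto simp: Inter_def Sub_def Disj_def list_Union_append)
next
  assume *: "valid L \<and> valid M \<and> valid N \<and> D N = D L \<inter> D M"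
  then obtain K where "valid K" "D K = D L - D M"
    using compact_open_code compact_open_Diff compact_open_D by metis
  with * show "Inter L M N"
    unfolding Inter_def Sub_def Disj_def by (intro conjI exI [of _ K]) (auto simp: list_Union_append)
qed

lemma copy_meet_computable:
  "\<exists>e. \<forall>a\<in>mg_carrier copy. \<forall>b\<in>mg_carrier copy. recf_eval e [a, b] = Some (mg_meet copy a b)"
proof -
  let ?R = "\<lambda>a b c. c \<in> codes \<and> Inter (dec a) (dec b) (dec c)"
  have "\<exists>e. \<forall>a b. a \<in> codes \<and> b \<in> codes \<longrightarrow> recf_eval e [enc a, enc b] = Some (enc (mg_meet copy a b))"
  proof (rule semidec_computes2 [of ?R])
    show "semidec (\<lambda>p. ?R (fst p) (fst (snd p)) (snd (snd p)))"
      by (intro semidec_conj semidec_decidable [OF decidable_codes] semidec_intros computable_intros)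
  next
    fix a b assume ab: "a \<in> codes \<and> b \<in> codes"
    let ?c = "code_of (code_set a \<inter> code_set b)"
    have "?c \<in> codes" "code_set ?c = code_set a \<inter> code_set b"
      using ab by (simp_all add: code_of compact_open_Int cosety_Int code_setD)
    with ab show "\<exists>c. ?R a b c" by (intro exI [of _ ?c]) (simp add: Inter_iff code_setD flip: code_set_def)
  next
    fix a b c assume "a \<in> codes \<and> b \<in> codes" "?R a b c"
    then show "c = mg_meet copy a b" by (simp add: copy_def code_of_eqI Inter_iff code_set_def)
  qed
  then show ?thesis by (auto simp: copy_def)
qed

text \<open>For a coset A coded by \<open>L\<close>, this describes the subgroup of which A is a
  left coset. \<open>Mul L' L V\<close> bounds \<open>V\<close> from below by the quotients of
  elements of A; \<open>Mul L V L\<close> bounds it from above, since \<open>v\<close> equals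
  \<open>inv a \<otimes> (a \<otimes> v)\<close> for a point \<open>a\<close> of A, supplied by
  \<open>L \<noteq> []\<close>.\<close>

definition LStab :: "'c list \<Rightarrow> 'c list \<Rightarrow> bool" where
  "LStab L V \<longleftrightarrow> L \<noteq> [] \<and> (\<exists>L'. Invr L L' \<and> Mul L' L V \<and> Mul L V L)"

definition RStab :: "'c list \<Rightarrow> 'c list \<Rightarrow> bool" where
  "RStab L V \<longleftrightarrow> L \<noteq> [] \<and> (\<exists>L'. Invr L L' \<and> Mul L L' V \<and> Mul V L L)"

lemma semidec_LStab [semidec_intros]:
  assumes "computable f" "computable g" shows "semidec (\<lambda>x. LStab (f x) (g x))"
proof (rule semidec_comp2 [OF _ assms])
  show "semidec (\<lambda>p. LStab (fst p) (snd p))"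
    unfolding LStab_def by (intro semidec_intros semidec_decidable [OF decidable_not] computable_intros)
qed

lemma semidec_RStab [semidec_intros]:
  assumes "computable f" "computable g" shows "semidec (\<lambda>x. RStab (f x) (g x))"
proof (rule semidec_comp2 [OF _ assms])
  show "semidec (\<lambda>p. RStab (fst p) (snd p))"
    unfolding RStab_def by (intro semidec_intros semidec_decidable [OF decidable_not] computable_intros)
qed

lemma LStabD:
  assumes "LStab L V"
  shows "valid L" "valid V" "D L \<noteq> {}" "D V = set_inv (D L) <#> D L" "\<And>a. a \<in> D L \<Longrightarrow> a <# D V = D L"
proof -
  obtain L' where L': "Invr L L'" "Mul L' L V" "Mul L V L" "L \<noteq> []" using assms by (auto simp: LStab_def)
  then show v: "valid L" "valid V" "D L \<noteq> {}" using D_empty_iff by (auto simp: Mul_def)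
  have 1: "inv x \<otimes> y \<in> D V" if "x \<in> D L" "y \<in> D L" for x y
    using L' that InvrD MulD by metis
  have 2: "x \<otimes> v \<in> D L" if "x \<in> D L" "v \<in> D V" for x v
    using L' that MulD by metis
  show "D V = set_inv (D L) <#> D L"
  proof
    show "set_inv (D L) <#> D L \<subseteq> D V" using 1 by (auto simp: set_mult_def SET_INV_def)
    obtain a where a: "a \<in> D L" using v by blast
    show "D V \<subseteq> set_inv (D L) <#> D L"
    proof
      fix x assume x: "x \<in> D V"
      then have "x = inv a \<otimes> (a \<otimes> x)" using a v D_carrier by (simp add: cancel_simps)
      with a 2 [OF a x] show "x \<in> set_inv (D L) <#> D L" unfolding set_mult_def SET_INV_def by blast
    qed
  qed
  fix a assume a: "a \<in> D L"
  show "a <# D V = D L"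
  proof
    show "a <# D V \<subseteq> D L" using 2 a by (auto simp: l_coset_def)
    show "D L \<subseteq> a <# D V"
    proof
      fix x assume x: "x \<in> D L"
      then have "x = a \<otimes> (inv a \<otimes> x)" using a v D_carrier by (simp add: cancel_simps)
      with 1 [OF a x] show "x \<in> a <# D V" unfolding l_coset_def by blast
    qed
  qed
qed

lemma RStabD:
  assumes "RStab L V"
  shows "valid L" "valid V" "D L \<noteq> {}" "D V = D L <#> set_inv (D L)"
proof -
  obtain L' where L': "Invr L L'" "Mul L L' V" "Mul V L L" "L \<noteq> []" using assms by (auto simp: RStab_def)
  then show v: "valid L" "valid V" "D L \<noteq> {}" using D_empty_iff by (auto simp: Mul_def)
  have 1: "x \<otimes> inv y \<in> D V" if "x \<in> D L" "y \<in> D L" for x y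
    using L' that InvrD MulD by metis
  have 2: "v \<otimes> x \<in> D L" if "x \<in> D L" "v \<in> D V" for x v
    using L' that MulD by metis
  show "D V = D L <#> set_inv (D L)"
  proof
    show "D L <#> set_inv (D L) \<subseteq> D V" using 1 by (auto simp: set_mult_def SET_INV_def)
    obtain a where a: "a \<in> D L" using v by blast
    show "D V \<subseteq> D L <#> set_inv (D L)"
    proof
      fix x assume x: "x \<in> D V"
      then have "x = (x \<otimes> a) \<otimes> inv a" using a v D_carrier by (simp add: m_assoc)
      with a 2 [OF a x] show "x \<in> D L <#> set_inv (D L)" unfolding set_mult_def SET_INV_def by blast
    qed
  qed
qed

lemma LStab_ex:
  assumes "valid L" "cosety (D L)" "L \<noteq> []" "valid V" "D V = set_inv (D L) <#> D L"
  shows "LStab L V"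
proof -
  obtain L' where L': "valid L'" "Invr L L'" "D L' = set_inv (D L)" using assms(1) by (rule Invr_exact)
  have "Mul L' L V" using L' assms by (simp add: Mul_def)
  moreover have "Mul L V L"
    using assms by (intro MulI) (auto simp: cosety_def set_mult_def SET_INV_def)
  ultimately show ?thesis using L' assms by (auto simp: LStab_def)
qed

lemma RStab_ex:
  assumes "valid L" "cosety (D L)" "L \<noteq> []" "valid V" "D V = D L <#> set_inv (D L)"
  shows "RStab L V"
proof -
  obtain L' where L': "valid L'" "Invr L L'" "D L' = set_inv (D L)" using assms(1) by (rule Invr_exact)
  have "Mul L L' V" using L' assms by (simp add: Mul_def)
  moreover have "Mul V L L"
  proof (rule MulI)
    fix v z assume "v \<in> D V" "z \<in> D L"
    then obtain x y where xy: "x \<in> D L" "y \<in> D L" "z \<in> D L" "v = x \<otimes> inv y"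
      using assms by (auto simp: set_mult_def SET_INV_def)
    then have "v \<otimes> z = x \<otimes> (inv y \<otimes> z)" using D_carrier [OF assms(1)] by (simp add: m_assoc)
    then show "v \<otimes> z \<in> D L" using xy assms(2) by (simp add: cosety_def)
  qed (use assms in auto)
  ultimately show ?thesis using L' assms by (auto simp: RStab_def)
qed

lemma stab_codes:
  assumes "valid L" "cosety (D L)" "L \<noteq> []"
  obtains V V' where "LStab L V" "RStab L V'"
proof -
  have "compact_open (set_inv (D L) <#> D L)" "compact_open (D L <#> set_inv (D L))"
    using assms by (simp_all add: compact_open_set_mult compact_open_set_inv compact_open_D)
  then show thesis
    using assms that LStab_ex RStab_ex compact_open_code by metis
qed

lemma copy_prod_iff:
  assumes "a \<in> codes" "b \<in> codes"
  shows "mg_prod copy a b =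
    (if code_set a \<noteq> {} \<and> code_set b \<noteq> {} \<and>
        set_inv (code_set a) <#> code_set a = code_set b <#> set_inv (code_set b)
     then Some (code_of (code_set a <#> code_set b)) else None)"
  using assms by (simp add: copy_def mg_prod_iff code_setD)

lemma copy_prod_defined_computable:
  "\<exists>e. \<forall>a\<in>mg_carrier copy. \<forall>b\<in>mg_carrier copy.
     recf_eval e [a, b] = Some (of_bool (mg_prod copy a b \<noteq> None))"
proof -
  let ?pos = "\<lambda>a b. \<exists>V. LStab (dec a) V \<and> RStab (dec b) V"
  \<comment> \<open>\<open>LStab\<close> and \<open>RStab\<close> determine the described sets
    exactly, so a single pair of codes with different sets refutes definedness. Codes of the empty
    set are treated apart because both relations exclude them.\<close>
  let ?neg = "\<lambda>a b. ((dec a :: 'c list) = [] \<or> (dec b :: 'c list) = []) \<or>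
    (\<exists>V V'. LStab (dec a) V \<and> RStab (dec b) V' \<and> \<not> (Sub V V' \<and> Sub V' V))"
  let ?R = "\<lambda>a b (c::nat). (c = 1 \<and> ?pos a b) \<or> (c = 0 \<and> ?neg a b)"
  have pos: "mg_prod copy a b \<noteq> None" if ab: "a \<in> codes" "b \<in> codes" and "?pos a b" for a b
  proof -
    from that(3) obtain V where V: "LStab (dec a) V" "RStab (dec b) V" by blast
    then show ?thesis
      using LStabD(3,4) [OF V(1)] RStabD(3,4) [OF V(2)]
      by (simp add: copy_prod_iff [OF ab] code_set_def)
  qed
  have neg: "mg_prod copy a b = None" if ab: "a \<in> codes" "b \<in> codes" and "?neg a b" for a b
    using that(3)
  proof (elim disjE exE conjE)
    fix V V' assume V: "LStab (dec a) V" "RStab (dec b) V'" "\<not> (Sub V V' \<and> Sub V' V)"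
    then have "D V \<noteq> D V'" using LStabD RStabD by (auto simp: Sub_def)
    then show ?thesis using LStabD(4) [OF V(1)] RStabD(4) [OF V(2)]
      unfolding copy_prod_iff [OF that(1,2)] code_set_def by auto
  qed (auto simp: copy_prod_iff [OF ab] code_set_def list_Union_def)
  have "\<exists>e. \<forall>a b. a \<in> codes \<and> b \<in> codes \<longrightarrow>
      recf_eval e [enc a, enc b] = Some (enc (of_bool (mg_prod copy a b \<noteq> None) :: nat))"
  proof (rule semidec_computes2 [of ?R])
    show "semidec (\<lambda>p. ?R (fst p) (fst (snd p)) (snd (snd p)))"
      by (intro semidec_intros semidec_decidable [OF decidable_not] semidec_decidable [OF decidable_eq]
          computable_intros)
  next
    fix a b assume ab: "a \<in> codes \<and> b \<in> codes"
    have "?pos a b \<or> ?neg a b"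
    proof (cases "(dec a :: 'c list) = [] \<or> (dec b :: 'c list) = []")
      case False
      have v: "valid (dec a)" "cosety (D (dec a))" "valid (dec b)" "cosety (D (dec b))"
        using code_setD(1,2) ab by (auto simp: code_set_def)
      obtain V W where V: "LStab (dec a) V" "RStab (dec a) W"
        using v(1,2) False by (auto elim: stab_codes)
      obtain W' V' where V': "LStab (dec b) W'" "RStab (dec b) V'"
        using v(3,4) False by (auto elim: stab_codes)
      show ?thesis
      proof (cases "Sub V V' \<and> Sub V' V")
        case True
        then have eq: "D V = D V'" by (auto simp: Sub_def)
        have "RStab (dec b) V"
          using RStabD [OF V'(2)] LStabD [OF V(1)] False v(3,4)
          by (intro RStab_ex) (simp_all add: eq)
        with V show ?thesis by blast
      qed (use V V' in blast)
    qed blast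
    then show "\<exists>c. ?R a b c" by blast
  next
    fix a b c assume ab: "a \<in> codes \<and> b \<in> codes" and R: "?R a b c"
    from R show "c = of_bool (mg_prod copy a b \<noteq> None)"
    proof
      assume c: "c = 1 \<and> ?pos a b"
      then show ?thesis using pos [OF conjunct1 [OF ab] conjunct2 [OF ab] conjunct2 [OF c]] by simp
    next
      assume c: "c = 0 \<and> ?neg a b"
      then show ?thesis using neg [OF conjunct1 [OF ab] conjunct2 [OF ab] conjunct2 [OF c]] by simp
    qed
  qed
  then obtain e where e: "\<forall>a b. a \<in> codes \<and> b \<in> codes \<longrightarrow>
      recf_eval e [a, b] = Some (of_bool (mg_prod copy a b \<noteq> None))"
    unfolding enc_nat by blast
  show ?thesis
    by (intro exI [of _ e] ballI) (use e in \<open>simp only: mg_carrier_copy\<close>)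
qed

lemma copy_prod_computable:
  "\<exists>e. \<forall>a\<in>mg_carrier copy. \<forall>b\<in>mg_carrier copy. \<forall>c.
     mg_prod copy a b = Some c \<longrightarrow> recf_eval e [a, b] = Some c"
proof -
  \<comment> \<open>\<open>Mul\<close> bounds the product from above by the set of \<open>c\<close>.
    The converse inclusion is expressed by multiplying with inverses: if
    \<open>inv u \<otimes> x\<close> lies in the second factor then \<open>x\<close> lies in the
    product. The true product satisfies this by \<open>product_cosety\<close>.\<close>
  let ?R = "\<lambda>a b c. c \<in> codes \<and> Mul (dec a) (dec b) (dec c) \<and>
    (\<exists>L. Invr (dec a) L \<and> Mul L (dec c) (dec b))"
  have prod: "code_set a \<noteq> {}" "code_set b \<noteq> {}"
      "set_inv (code_set a) <#> code_set a = code_set b <#> set_inv (code_set b)"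
      "mg_prod copy a b = Some (code_of (code_set a <#> code_set b))"
    if "a \<in> codes" "b \<in> codes" "mg_prod copy a b \<noteq> None" for a b
    using that by (auto simp: copy_prod_iff split: if_splits)
  have "\<exists>e. \<forall>a b. a \<in> codes \<and> b \<in> codes \<and> mg_prod copy a b \<noteq> None \<longrightarrow>
      recf_eval e [enc a, enc b] = Some (enc (the (mg_prod copy a b)))"
  proof (rule semidec_computes2 [of ?R])
    show "semidec (\<lambda>p. ?R (fst p) (fst (snd p)) (snd (snd p)))"
      by (intro semidec_conj semidec_decidable [OF decidable_codes] semidec_intros computable_intros)
  next
    fix a b assume "a \<in> codes \<and> b \<in> codes \<and> mg_prod copy a b \<noteq> None"
    then have ab: "a \<in> codes" "b \<in> codes" and def: "mg_prod copy a b \<noteq> None" by auto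
    note p = prod [OF ab def]
    note cos = product_cosety [OF code_setD(2) [OF ab(1)] code_setD(2) [OF ab(2)] p(3)]
    let ?c = "code_of (code_set a <#> code_set b)"
    have c: "?c \<in> codes" "code_set ?c = code_set a <#> code_set b"
      using ab cos by (simp_all add: code_of compact_open_set_mult code_setD)
    obtain L where L: "valid L" "Invr (dec a) L" "D L = set_inv (D (dec a))"
      using code_setD(1) [OF ab(1)] by (rule Invr_exact)
    have "Mul (dec a) (dec b) (dec ?c)"
      using code_setD c ab by (simp add: Mul_def code_set_def)
    moreover have "Mul L (dec ?c) (dec b)"
    proof (rule MulI)
      fix x y assume "x \<in> D L" "y \<in> D (dec ?c)"
      then obtain u v w where "u \<in> code_set a" "v \<in> code_set a" "w \<in> code_set b" "x = inv u" "y = v \<otimes> w"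
        using c(2) L(3) by (auto simp: set_mult_def SET_INV_def code_set_def)
      then show "x \<otimes> y \<in> D (dec b)" using cos(2) by (simp add: code_set_def)
    qed (use L code_setD ab c in auto)
    ultimately show "\<exists>c. ?R a b c" using c L by blast
  next
    fix a b c assume "a \<in> codes \<and> b \<in> codes \<and> mg_prod copy a b \<noteq> None" and R: "?R a b c"
    then have ab: "a \<in> codes" "b \<in> codes" and def: "mg_prod copy a b \<noteq> None" by auto
    note p = prod [OF ab def]
    from R obtain L where L: "Invr (dec a) L" "Mul L (dec c) (dec b)" by blast
    obtain u where u: "u \<in> D (dec a)" using p(1) by (auto simp: code_set_def)
    have "code_set c = code_set a <#> code_set b"
    proof
      show "code_set a <#> code_set b \<subseteq> code_set c" using R by (auto simp: Mul_def code_set_def)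
      show "code_set c \<subseteq> code_set a <#> code_set b"
      proof
        fix x assume x: "x \<in> code_set c"
        then have "inv u \<otimes> x \<in> code_set b" using L InvrD [OF L(1) u] MulD by (simp add: code_set_def)
        moreover have "x \<in> carrier Q" "u \<in> carrier Q"
          using x u R L D_carrier by (auto simp: Mul_def code_set_def)
        then have "x = u \<otimes> (inv u \<otimes> x)" by (simp add: cancel_simps)
        ultimately show "x \<in> code_set a <#> code_set b"
          using u unfolding set_mult_def code_set_def by blast
      qed
    qed
    then show "c = the (mg_prod copy a b)" using R p(4) by (simp add: code_of_eqI)
  qed
  then show ?thesis by fastforce
qed

section \<open>Indices of subgroups from finite certificates\<close>

lemma subgroup_index_eqI:
  assumes U: "subgroup U Q" and K: "subgroup K Q" "K \<subseteq> U"
    and F: "\<And>i. i < n \<Longrightarrow> F i \<subseteq> U" "\<And>i. i < n \<Longrightarrow> F i \<noteq> {}"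
      "\<And>i x. i < n \<Longrightarrow> x \<in> F i \<Longrightarrow> F i = x <# K"
      "\<And>i j. i < n \<Longrightarrow> j < i \<Longrightarrow> F i \<inter> F j = {}" "U \<subseteq> (\<Union>i<n. F i)"
  shows "subgroup_index Q U K = n"
proof -
  have eq: "lcosets\<^bsub>Q\<lparr>carrier := U\<rparr>\<^esub> K = F ` {..<n}"
  proof
    show "lcosets\<^bsub>Q\<lparr>carrier := U\<rparr>\<^esub> K \<subseteq> F ` {..<n}"
    proof
      fix A assume "A \<in> lcosets\<^bsub>Q\<lparr>carrier := U\<rparr>\<^esub> K"
      then obtain x where x: "x \<in> U" "A = x <# K" by (auto simp: LCOSETS_def l_coset_def)
      then obtain i where "i < n" "x \<in> F i" using F(5) by blast
      with F(3) x show "A \<in> F ` {..<n}" by auto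
    qed
    show "F ` {..<n} \<subseteq> lcosets\<^bsub>Q\<lparr>carrier := U\<rparr>\<^esub> K"
    proof safe
      fix i assume i: "i < n"
      then obtain x where "x \<in> F i" using F(2) by blast
      with F(1,3) i have "x \<in> U" "F i = x <# K" by auto
      then show "F i \<in> lcosets\<^bsub>Q\<lparr>carrier := U\<rparr>\<^esub> K" by (auto simp: LCOSETS_def l_coset_def)
    qed
  qed
  have "inj_on F {..<n}"
    using F(2,4) by (intro inj_onI) (metis Int_absorb lessThan_iff linorder_neqE_nat)
  then show ?thesis by (simp add: subgroup_index_def eq card_image)
qed

text \<open>A certificate that U splits into \<open>n\<close> left cosets of the intersection
  \<open>K\<close>: \<open>LStab\<close> makes each entry of \<open>Ls\<close> a nonempty left coset
  of \<open>K\<close>, and the entries are pairwise disjoint. Covering is stated through a code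
  \<open>M\<close> whose base sets each lie in a single coset, which avoids concatenating a varying
  number of codes.\<close>

definition Index :: "'c list \<Rightarrow> 'c list \<Rightarrow> nat \<Rightarrow> bool" where
  "Index U V n \<longleftrightarrow> (\<exists>K Ls. Inter U V K \<and> length Ls = n \<and>
    (\<forall>i<n. LStab (nth0 Ls i) K \<and> Sub (nth0 Ls i) U) \<and>
    (\<forall>i<n. \<forall>j<i. Disj (nth0 Ls i) (nth0 Ls j)) \<and>
    (\<exists>M. Sub U M \<and> (\<forall>s\<in>set M. \<exists>L\<in>set Ls. Sub [s] L)))"

lemma semidec_Index:
  "semidec (\<lambda>p. Index (fst p) (fst (snd p)) (snd (snd p)))"
  unfolding Index_def
  by (intro semidec_intros semidec_decidable [OF decidable_eq] computable_intros)

lemma Index_unique: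
  assumes "subgroup (D U) Q" "subgroup (D V) Q" "Index U V n"
  shows "n = subgroup_index Q (D U) (D U \<inter> D V)"
proof -
  obtain K Ls M where *: "Inter U V K" "length Ls = n"
    "\<And>i. i < n \<Longrightarrow> LStab (Ls ! i) K \<and> Sub (Ls ! i) U"
    "\<And>i j. i < n \<Longrightarrow> j < i \<Longrightarrow> Disj (Ls ! i) (Ls ! j)"
    "Sub U M" "\<And>s. s \<in> set M \<Longrightarrow> \<exists>L\<in>set Ls. Sub [s] L"
    using assms(3) unfolding Index_def by (auto simp: nth0)
  have K: "D K = D U \<inter> D V" using *(1) by (simp add: Inter_iff)
  have "subgroup_index Q (D U) (D K) = n"
  proof (rule subgroup_index_eqI [where F = "\<lambda>i. D (Ls ! i)"])
    show "subgroup (D K) Q" unfolding K using assms(1,2) by (rule subgroups_Inter_pair)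
    show "D U \<subseteq> (\<Union>i<n. D (Ls ! i))"
    proof
      fix x assume "x \<in> D U"
      then obtain s where "s \<in> set M" "x \<in> B s" using *(5) by (auto simp: Sub_def list_Union_def)
      with *(6) obtain L where "L \<in> set Ls" "x \<in> D L" by (force simp: Sub_def list_Union_def)
      then show "x \<in> (\<Union>i<n. D (Ls ! i))" using *(2) by (auto simp: in_set_conv_nth)
    qed
    show "D (Ls ! i) \<inter> D (Ls ! j) = {}" if "i < n" "j < i" for i j
      using *(4) [OF that] by (simp add: Disj_def)
  next
    fix i assume i: "i < n"
    note L = LStabD [OF conjunct1 [OF *(3) [OF i]]]
    show "D (Ls ! i) \<subseteq> D U" using *(3) [OF i] by (simp add: Sub_def)
    show "D (Ls ! i) \<noteq> {}" by (rule L(3))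
    show "D (Ls ! i) = x <# D K" if "x \<in> D (Ls ! i)" for x using L(5) [OF that] by simp
  qed (use assms K in auto)
  then show ?thesis by (simp add: K)
qed

text \<open>The left cosets of the open subgroup \<open>?H\<close> cover the compact set
  \<open>D U\<close>, so finitely many suffice, and distinct cosets are disjoint. Hence the
  certificate exists, and with it finiteness of the index.\<close>

lemma Index_ex:
  assumes U: "subgroup (D U) Q" "valid U" and V: "subgroup (D V) Q" "valid V"
  shows "\<exists>n. Index U V n"
proof -
  let ?H = "D U \<inter> D V"
  have H: "subgroup ?H Q" "compact_open ?H"
    using U V by (simp_all add: subgroups_Inter_pair compact_open_Int compact_open_D)
  then obtain K where K: "valid K" "D K = ?H" using compact_open_code by metis
  have UQ: "D U \<subseteq> carrier Q" using U D_carrier by blast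
  let ?F = "(\<lambda>a. a <# ?H) ` D U"
  have sub: "a <# ?H \<subseteq> D U" if "a \<in> D U" for a
    using that subgroup.m_closed [OF U(1)] by (auto simp: l_coset_def)
  have self: "a \<in> a <# ?H" if "a \<in> D U" for a
    using that lcos_self [OF _ H(1)] UQ by blast
  have "D U \<subseteq> \<Union>?F" using self by auto
  moreover have "openin X A" if "A \<in> ?F" for A
    using that compact_open_translate(1) [OF _ H(2)] UQ by (auto simp: compact_open_def)
  ultimately obtain F where F: "finite F" "F \<subseteq> ?F" "D U \<subseteq> \<Union>F"
    using compactinD [of X "D U" ?F] compact_open_D [OF U(2)] unfolding compact_open_def by blast
  obtain As where As: "set As = F" "distinct As" using finite_distinct_list [OF F(1)] by blast
  have ex: "\<exists>L. valid L \<and> D L = A" if "A \<in> F" for A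
  proof -
    obtain a where "a \<in> carrier Q" "A = a <# ?H" using \<open>A \<in> F\<close> F(2) UQ by blast
    then have "compact_open A" using compact_open_translate(1) [OF _ H(2)] by simp
    then show ?thesis by (metis compact_open_code)
  qed
  define c where "c A = (SOME L. valid L \<and> D L = A)" for A
  have c: "valid (c A)" "D (c A) = A" if "A \<in> F" for A
    using someI_ex [OF ex [OF that]] by (auto simp: c_def)
  let ?Ls = "map c As" and ?n = "length As"
  have nF: "As ! i \<in> F" if "i < ?n" for i using that As by auto
  have 1: "LStab (nth0 ?Ls i) K \<and> Sub (nth0 ?Ls i) U" if i: "i < ?n" for i
  proof -
    obtain a where a: "a \<in> D U" "As ! i = a <# ?H" using nF [OF i] F(2) by blast
    have aQ: "a \<in> carrier Q" using a UQ by blast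
    have L: "valid (c (As ! i))" "D (c (As ! i)) = a <# ?H" using c [OF nF [OF i]] a by auto
    have "LStab (c (As ! i)) K"
    proof (rule LStab_ex)
      show "c (As ! i) \<noteq> []" using L D_empty_iff self [OF a(1)] by auto
      show "cosety (D (c (As ! i)))" unfolding L(2) using H(1) aQ by (rule cosety_lcoset)
      show "D K = set_inv (D (c (As ! i))) <#> D (c (As ! i))"
        unfolding L(2) set_inv_lcoset_mult [OF H(1) aQ] by (rule K(2))
    qed (use L K in auto)
    then show ?thesis using i L U sub [OF a(1)] by (simp add: nth0 Sub_def)
  qed
  have 2: "Disj (nth0 ?Ls i) (nth0 ?Ls j)" if "i < ?n" "j < i" for i j
  proof -
    have j: "j < ?n" using that by simp
    have "As ! i \<noteq> As ! j" using that j As(2) by (simp add: nth_eq_iff_index_eq)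
    moreover have "F \<subseteq> lcosets ?H"
      using F(2) UQ unfolding LCOSETS_def by blast
    then have "As ! i \<in> lcosets ?H" "As ! j \<in> lcosets ?H"
      using nF [OF that(1)] nF [OF j] by auto
    ultimately have "As ! i \<inter> As ! j = {}" using lcos_disjoint [OF H(1)] by (auto simp: pairwise_def disjnt_def)
    then show ?thesis using that j c [OF nF] by (simp add: nth0 Disj_def)
  qed
  \<comment> \<open>The concatenated codes of the cosets serve as \<open>M\<close>: each base set
    occurring in one of them lies in that coset.\<close>
  have 3: "Sub U (concat ?Ls)"
    using U c As F(3) by (fastforce simp: Sub_def list_Union_def list_all_iff)
  have 4: "\<exists>L\<in>set ?Ls. Sub [s] L" if s: "s \<in> set (concat ?Ls)" for s
  proof -
    obtain A where A: "A \<in> F" "s \<in> set (c A)" using s As by auto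
    then have "Sub [s] (c A)" using c(1) [OF A(1)] by (auto simp: Sub_def list_all_iff list_Union_def)
    with A As show ?thesis by auto
  qed
  have "Inter U V K" using U V K by (simp add: Inter_iff)
  then have "Index U V ?n"
    unfolding Index_def using 1 2 3 4 by (intro exI [of _ K] exI [of _ ?Ls]) (auto intro!: exI [of _ "concat ?Ls"])
  then show ?thesis by blast
qed

lemma copy_index_computable:
  "\<exists>e. \<forall>u\<in>mg_carrier copy. \<forall>v\<in>mg_carrier copy. subgroup (code_set u) Q \<longrightarrow> subgroup (code_set v) Q \<longrightarrow>
     recf_eval e [u, v] = Some (subgroup_index Q (code_set u) (code_set u \<inter> code_set v))"
proof -
  have "\<exists>e. \<forall>u v. (u \<in> codes \<and> v \<in> codes \<and> subgroup (code_set u) Q \<and> subgroup (code_set v) Q) \<longrightarrow>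
      recf_eval e [enc u, enc v] = Some (enc (subgroup_index Q (code_set u) (code_set u \<inter> code_set v)))"
  proof (rule semidec_computes2 [of "\<lambda>u v n. Index (dec u) (dec v) n"])
    show "semidec (\<lambda>p. Index (dec (fst p)) (dec (fst (snd p))) (snd (snd p)))"
      by (intro semidec_comp3 [OF semidec_Index] computable_intros)
  qed (auto simp: code_set_def intro: Index_ex Index_unique dest: code_setD(1))
  then show ?thesis by (auto simp: copy_def)
qed

theorem computably_tdlc: "computably_tdlc Q X"
proof -
  have "Haar_computable_copy copy Q X"
    unfolding Haar_computable_copy_def
    using codes_computable
    by (intro conjI mg_closed_copy copy_inv_computable copy_meet_computable
        copy_prod_defined_computable copy_prod_computable
        exI [of _ code_set] mg_iso_copy copy_index_computable) simp
  then show ?thesis using tdlc by (auto simp: computably_tdlc_def)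
qed

end

section \<open>Path spaces of trees\<close>

lemma length_init [simp]: "length (init f n) = n"
  by (simp add: init_def)

lemma nth_init [simp]: "i < n \<Longrightarrow> init f n ! i = f i"
  by (simp add: init_def)

lemma init_Suc: "init f (Suc n) = init f n @ [f n]"
  by (simp add: init_def)

lemma init_eq_iff: "init f n = init g n \<longleftrightarrow> (\<forall>i<n. f i = g i)"
  by (auto simp: init_def)

lemma prefix_init: "m \<le> n \<Longrightarrow> prefix (init f m) (init f n)"
  using take_is_prefix [of m "init f n"] by (simp add: init_def take_map min_absorb1)

lemma init_prefixD:
  assumes "prefix \<sigma> (init f n)" shows "init f (length \<sigma>) = \<sigma>"
proof (rule nth_equalityI)
  fix i assume "i < length (init f (length \<sigma>))"
  then have "i < length \<sigma>" "length \<sigma> \<le> n" using prefix_length_le [OF assms] by auto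
  moreover obtain zs where "init f n = \<sigma> @ zs" using assms by (rule prefixE)
  with \<open>i < length \<sigma>\<close> have "init f n ! i = \<sigma> ! i" by (simp only: nth_append if_True)
  ultimately show "init f (length \<sigma>) ! i = \<sigma> ! i" by simp
qed simp

lemma init_prefix_iff: "length \<sigma> \<le> n \<Longrightarrow> prefix \<sigma> (init f n) \<longleftrightarrow> init f (length \<sigma>) = \<sigma>"
  by (metis init_prefixD prefix_init)

lemma paths_init: "f \<in> paths T \<Longrightarrow> init f n \<in> T"
  by (simp add: paths_def)

lemma cone_init [simp]: "f \<in> cone T (init f n) \<longleftrightarrow> f \<in> paths T"
  by (simp add: cone_def)

lemma cone_subset_paths: "cone T \<sigma> \<subseteq> paths T"
  by (auto simp: cone_def)

lemma cone_mono: "prefix \<sigma> \<tau> \<Longrightarrow> cone T \<tau> \<subseteq> cone T \<sigma>"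
  unfolding cone_def by (auto intro: init_prefixD [of \<sigma> _ "length \<tau>"])

lemma cone_init_mono: "m \<le> n \<Longrightarrow> cone T (init f n) \<subseteq> cone T (init f m)"
  by (intro cone_mono prefix_init)

lemma coneD: "f \<in> cone T \<sigma> \<Longrightarrow> f \<in> paths T \<and> init f (length \<sigma>) = \<sigma> \<and> \<sigma> \<in> T"
  unfolding cone_def by (metis (mono_tags, lifting) mem_Collect_eq paths_init)

lemma cone_nonempty:
  assumes "tree T" "leafless T" "\<sigma> \<in> T" shows "cone T \<sigma> \<noteq> {}"
proof -
  have "\<exists>s. s 0 = \<sigma> \<and> (\<forall>n. s n \<in> T \<and> (\<exists>x. s (Suc n) = s n @ [x]))"
    using dependent_nat_choice [of "\<lambda>n s. s \<in> T \<and> (n = 0 \<longrightarrow> s = \<sigma>)" "\<lambda>_ s s'. \<exists>x. s' = s @ [x]"]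
      assms unfolding leafless_def by (metis Zero_not_Suc)
  then obtain s where s: "s 0 = \<sigma>" "\<And>n. s n \<in> T" "\<And>n. \<exists>x. s (Suc n) = s n @ [x]" by blast
  have len: "length (s n) = length \<sigma> + n" for n
    using s(3) by (induction n) (simp add: s(1), metis add_Suc_right length_append_singleton)
  have pre: "prefix (s m) (s n)" if "m \<le> n" for m n
    using that by (induction rule: dec_induct) (auto, metis prefixI prefix_order.trans s(3))
  \<comment> \<open>\<open>s (Suc i)\<close> has length \<open>length \<sigma> + Suc i\<close>, so
    its entry at \<open>i\<close> exists even when \<sigma> is empty.\<close>
  define f where "f i = s (Suc i) ! i" for i
  have init: "init f k = take k (s n)" if "k \<le> length \<sigma> + n" for k n
  proof (rule nth_equalityI)
    fix i assume "i < length (init f k)"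
    then have i: "i < k" by simp
    have "prefix (s (Suc i)) (s (max (Suc i) n))" "prefix (s n) (s (max (Suc i) n))" by (auto intro: pre)
    then have "s (Suc i) ! i = s n ! i"
      using i that by (auto simp: prefix_def nth_append len)
        (metis add_Suc_right len less_add_Suc2 nth_append order_less_le_trans)
    then show "init f k ! i = take k (s n) ! i" using i by (simp add: f_def)
  qed (use that in \<open>simp add: len\<close>)
  have "init f k \<in> T" for k
    using init [of k k] s(2) [of k] assms(1) unfolding tree_def by (metis le_add2 take_is_prefix)
  moreover have "init f (length \<sigma>) = \<sigma>" using init [of "length \<sigma>" 0] by (simp add: s(1))
  ultimately have "f \<in> cone T \<sigma>" by (simp add: cone_def paths_def)
  then show ?thesis by blast
qed

lemma topspace_path_space [simp]: "topspace (path_space T) = paths T"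
  by (simp add: path_space_def)

lemma open_init_eq: "open {f :: nat \<Rightarrow> nat. init f n = \<sigma>}"
proof (cases "length \<sigma> = n")
  case True
  have "{f. init f n = \<sigma>} = (\<Inter>i\<in>{..<n}. (\<lambda>f. f i) -` {\<sigma> ! i})"
    using True by (auto simp: list_eq_iff_nth_eq)
  moreover have "open \<dots>"
    by (intro open_INT finite_lessThan ballI open_vimage open_discrete continuous_on_product_coordinates)
  ultimately show ?thesis by simp
next
  case False
  then have "{f. init f n = \<sigma>} = {}" by auto
  then show ?thesis by simp
qed

lemma open_contains_init:
  fixes f :: "nat \<Rightarrow> nat"
  assumes "open U" "f \<in> U"
  shows "\<exists>n. \<forall>g. init g n = init f n \<longrightarrow> g \<in> U"
proof -
  have "openin (product_topology (\<lambda>_. euclidean) UNIV) U" using assms(1) by (simp add: open_fun_def)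
  from product_topology_open_contains_basis [OF this assms(2)]
  obtain V where V: "f \<in> (\<Pi>\<^sub>E i\<in>UNIV. V i)" "finite {i. V i \<noteq> (UNIV :: nat set)}" "(\<Pi>\<^sub>E i\<in>UNIV. V i) \<subseteq> U"
    by auto
  obtain n where n: "\<And>i. V i \<noteq> UNIV \<Longrightarrow> i < n"
    using V(2) finite_nat_set_iff_bounded by auto
  have "g \<in> U" if "init g n = init f n" for g
  proof -
    have "g i \<in> V i" for i
      using that V(1) n [of i] unfolding init_eq_iff by (cases "V i = UNIV") (auto simp: PiE_iff)
    then show ?thesis using V(3) by auto
  qed
  then show ?thesis by blast
qed

lemma openin_path_space:
  "openin (path_space T) U \<longleftrightarrow> U \<subseteq> paths T \<and> (\<forall>f\<in>U. \<exists>n. cone T (init f n) \<subseteq> U)"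
proof
  assume "openin (path_space T) U"
  then obtain S where S: "open S" "U = paths T \<inter> S" by (auto simp: path_space_def openin_open)
  show "U \<subseteq> paths T \<and> (\<forall>f\<in>U. \<exists>n. cone T (init f n) \<subseteq> U)"
  proof (intro conjI ballI)
    fix f assume "f \<in> U"
    then obtain n where "\<forall>g. init g n = init f n \<longrightarrow> g \<in> S" using S open_contains_init [of S f] by auto
    then have "cone T (init f n) \<subseteq> U" using S by (auto simp: cone_def)
    then show "\<exists>n. cone T (init f n) \<subseteq> U" ..
  qed (use S in auto)
next
  assume U: "U \<subseteq> paths T \<and> (\<forall>f\<in>U. \<exists>n. cone T (init f n) \<subseteq> U)"
  then obtain n where n: "\<And>f. f \<in> U \<Longrightarrow> cone T (init f (n f)) \<subseteq> U" by metis
  let ?S = "\<Union>f\<in>U. {g. init g (n f) = init f (n f)}"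
  have "open ?S" by (intro open_UN ballI open_init_eq)
  moreover have "U = paths T \<inter> ?S" using U n by (fastforce simp: cone_def)
  ultimately show "openin (path_space T) U" by (auto simp: path_space_def openin_open)
qed

lemma closedin_cone: "closedin (path_space T) (cone T \<sigma>)"
  unfolding closedin_def
proof (intro conjI)
  show "openin (path_space T) (topspace (path_space T) - cone T \<sigma>)"
    unfolding openin_path_space
  proof (intro conjI ballI exI)
    fix f assume f: "f \<in> topspace (path_space T) - cone T \<sigma>"
    then show "cone T (init f (length \<sigma>)) \<subseteq> topspace (path_space T) - cone T \<sigma>"
      by (auto simp: cone_def)
  qed auto
qed (use cone_subset_paths in auto)

definition compact_strings :: "nat list set \<Rightarrow> nat list set" where
  "compact_strings T = {\<sigma> \<in> T. compactin (path_space T) (cone T \<sigma>)}"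

text \<open>A cone inside a compact neighbourhood is compact because cones are closed. Lengthening
  the string preserves this, so the cone can also be made to fit into \<open>U\<close>.\<close>

lemma compact_strings_base:
  assumes "locally_compact_space (path_space T)" "openin (path_space T) U" "f \<in> U"
  shows "\<exists>n. init f n \<in> compact_strings T \<and> cone T (init f n) \<subseteq> U"
proof -
  have f: "f \<in> paths T" using assms(2,3) openin_path_space by blast
  obtain V K where V: "openin (path_space T) V" "compactin (path_space T) K" "f \<in> V" "V \<subseteq> K"
    using assms(1) f unfolding locally_compact_space_def by auto
  obtain m where m: "cone T (init f m) \<subseteq> V" using V(1,3) openin_path_space by blast
  obtain n where n: "cone T (init f n) \<subseteq> U" using assms(2,3) openin_path_space by blast
  have "cone T (init f (max m n)) \<subseteq> cone T (init f m)" "cone T (init f (max m n)) \<subseteq> cone T (init f n)"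
    by (auto intro!: cone_init_mono)
  moreover from this(1) have "compactin (path_space T) (cone T (init f (max m n)))"
    using m V closed_compactin [OF V(2) _ closedin_cone] by blast
  ultimately show ?thesis
    using n f by (intro exI [of _ "max m n"]) (auto simp: compact_strings_def paths_init)
qed

subsection \<open>Compactness as a semidecidable condition\<close>

text \<open>A finite certificate for a product of two cones being covered by a family of such products:
  a set of pairs of strings, closed under passing to successor pairs until a member of the family
  is reached.\<close>

definition covered ::
  "nat list set \<Rightarrow> (nat list \<Rightarrow> nat \<Rightarrow> nat) \<Rightarrow> (nat list \<Rightarrow> nat list \<Rightarrow> bool) \<Rightarrow> nat list \<Rightarrow> nat list \<Rightarrow> bool" where
  "covered T H \<Psi> \<sigma> \<tau> \<longleftrightarrow> (\<exists>Z. (\<sigma>, \<tau>) \<in> set Z \<and> (\<forall>z\<in>set Z.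
     (\<exists>\<alpha> \<beta>. prefix \<alpha> (fst z) \<and> prefix \<beta> (snd z) \<and> \<Psi> \<alpha> \<beta>) \<or>
     (\<forall>i<Suc (H \<sigma> (length (fst z))). \<forall>j<Suc (H \<tau> (length (snd z))).
        fst z @ [i] \<in> T \<and> snd z @ [j] \<in> T \<longrightarrow> (fst z @ [i], snd z @ [j]) \<in> set Z)))"

lemma semidec_covered:
  assumes T: "decidable (\<lambda>\<sigma>. \<sigma> \<in> T)" and H: "computable (\<lambda>p. H (fst p) (snd p))"
    and \<Psi>: "semidec (\<lambda>p. \<Psi> (fst p) (fst (snd p)) (snd (snd p)))"
    and "computable f" "computable g"
  shows "semidec (\<lambda>x. covered T H (\<Psi> x) (f x) (g x))"
proof -
  have "semidec (\<lambda>p. covered T H (\<Psi> (fst p)) (fst (snd p)) (snd (snd p)))"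
    unfolding covered_def
    by (intro semidec_ex semidec_conj semidec_disj semidec_ball_set semidec_comp3 [OF \<Psi>]
        semidec_decidable [OF decidable_mem_set] semidec_decidable [OF decidable_prefix]
        semidec_decidable [OF decidable_all_less] decidable_comp [OF T] computable_comp2 [OF H] computable_intros)
  from semidec_comp3 [OF this computable_id assms(4,5)] show ?thesis .
qed

text \<open>If two paths met no member of the family, their prefixes would form infinitely many
  pairs in the finite list \<open>Z\<close>, the bound \<open>H\<close> ensuring that no successor
  is overlooked. Conversely, compactness of the product of cones gives a uniform depth, and all
  pairs up to that depth form a finite certificate.\<close>

lemma covered_iff:
  assumes T: "tree T" "leafless T"
    and H: "\<And>\<sigma> \<rho> i. \<sigma> \<in> compact_strings T \<Longrightarrow> \<rho> \<in> T \<Longrightarrow> prefix \<sigma> \<rho> \<Longrightarrow> i < length \<rho> \<Longrightarrow> \<rho> ! i \<le> H \<sigma> i"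
    and \<sigma>: "\<sigma> \<in> compact_strings T" and \<tau>: "\<tau> \<in> compact_strings T"
  shows "covered T H \<Psi> \<sigma> \<tau> \<longleftrightarrow> (\<forall>f\<in>cone T \<sigma>. \<forall>g\<in>cone T \<tau>. \<exists>k l. \<Psi> (init f k) (init g l))"
proof
  assume "covered T H \<Psi> \<sigma> \<tau>"
  then obtain Z where Z: "(\<sigma>, \<tau>) \<in> set Z"
    "\<And>a b i j. (a, b) \<in> set Z \<Longrightarrow> \<not> (\<exists>\<alpha> \<beta>. prefix \<alpha> a \<and> prefix \<beta> b \<and> \<Psi> \<alpha> \<beta>) \<Longrightarrow>
       i \<le> H \<sigma> (length a) \<Longrightarrow> j \<le> H \<tau> (length b) \<Longrightarrow> a @ [i] \<in> T \<Longrightarrow> b @ [j] \<in> T \<Longrightarrow> (a @ [i], b @ [j]) \<in> set Z"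
    unfolding covered_def by (fastforce simp: less_Suc_eq_le)
  show "\<forall>f\<in>cone T \<sigma>. \<forall>g\<in>cone T \<tau>. \<exists>k l. \<Psi> (init f k) (init g l)"
  proof (intro ballI, rule ccontr)
    fix f g assume f: "f \<in> cone T \<sigma>" and g: "g \<in> cone T \<tau>" and no: "\<nexists>k l. \<Psi> (init f k) (init g l)"
    let ?a = "\<lambda>k. init f (length \<sigma> + k)" and ?b = "\<lambda>k. init g (length \<tau> + k)"
    have no': "\<not> (\<exists>\<alpha> \<beta>. prefix \<alpha> (?a k) \<and> prefix \<beta> (?b k) \<and> \<Psi> \<alpha> \<beta>)" for k
      using no init_prefixD by metis
    have in_T: "?a k \<in> T" "?b k \<in> T" for k
      using f g by (auto simp: cone_def paths_init)
    have pre: "prefix \<sigma> (?a k)" "prefix \<tau> (?b k)" for k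
      using f g init_prefix_iff by (auto simp: cone_def)
    have step: "?a (Suc k) = ?a k @ [f (length \<sigma> + k)]" "?b (Suc k) = ?b k @ [g (length \<tau> + k)]" for k
      by (simp_all add: init_Suc)
    have in_Z: "(?a k, ?b k) \<in> set Z" for k
    proof (induction k)
      case 0
      then show ?case using Z(1) f g by (simp add: cone_def)
    next
      case (Suc k)
      have "f (length \<sigma> + k) \<le> H \<sigma> (length (?a k))"
        using H [OF \<sigma> in_T(1) pre(1), of "length \<sigma> + k" "Suc k"] by simp
      moreover have "g (length \<tau> + k) \<le> H \<tau> (length (?b k))"
        using H [OF \<tau> in_T(2) pre(2), of "length \<tau> + k" "Suc k"] by simp
      ultimately show ?case
        using Z(2) [OF Suc no'] in_T [of "Suc k"] unfolding step by blast
    qed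
    have "inj (\<lambda>k. (?a k, ?b k))" by (auto intro!: injI dest!: arg_cong [where f = length])
    moreover have "finite (range (\<lambda>k. (?a k, ?b k)))" using in_Z by (auto intro: finite_subset [of _ "set Z"])
    ultimately show False using finite_imageD by blast
  qed
next
  assume ex: "\<forall>f\<in>cone T \<sigma>. \<forall>g\<in>cone T \<tau>. \<exists>k l. \<Psi> (init f k) (init g l)"
  \<comment> \<open>The closure of \<Psi> under extension: witnesses with prefixes of different
    lengths can then be compared at a common length.\<close>
  define \<Phi> where "\<Phi> a b \<longleftrightarrow> (\<exists>\<alpha> \<beta>. prefix \<alpha> a \<and> prefix \<beta> b \<and> \<Psi> \<alpha> \<beta>)" for a b
  have \<Phi>_mono: "\<Phi> a' b'" if "\<Phi> a b" "prefix a a'" "prefix b b'" for a b a' b'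
    using that unfolding \<Phi>_def by (meson prefix_order.trans)
  let ?U = "\<lambda>k. {p. \<Phi> (init (fst p) k) (init (snd p) k)}"
  have U: "open (?U k)" for k
  proof -
    have "?U k = (\<Union>p\<in>?U k. {f. init f k = init (fst p) k} \<times> {g. init g k = init (snd p) k})"
      by auto
    moreover have "open \<dots>" by (intro open_UN ballI open_Times open_init_eq)
    ultimately show ?thesis by simp
  qed
  have "compact (cone T \<sigma> \<times> cone T \<tau>)"
    using \<sigma> \<tau> by (intro compact_Times) (auto simp: compact_strings_def path_space_def compactin_subtopology)
  moreover have "cone T \<sigma> \<times> cone T \<tau> \<subseteq> (\<Union>k\<in>UNIV. ?U k)"
  proof clarify
    fix f g assume "f \<in> cone T \<sigma>" "g \<in> cone T \<tau>"
    then obtain k l where "\<Psi> (init f k) (init g l)" using ex by blast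
    moreover have "prefix (init f k) (init f (max k l))" "prefix (init g l) (init g (max k l))"
      by (simp_all add: prefix_init)
    ultimately have "\<Phi> (init f (max k l)) (init g (max k l))"
      unfolding \<Phi>_def by blast
    then show "(f, g) \<in> (\<Union>k\<in>UNIV. ?U k)" by auto
  qed
  ultimately obtain K where K: "finite K" "cone T \<sigma> \<times> cone T \<tau> \<subseteq> (\<Union>k\<in>K. ?U k)"
    using U by (auto elim: compactE_image [of _ UNIV ?U])
  obtain m where m: "\<And>k. k \<in> K \<Longrightarrow> k \<le> m" using K(1) finite_nat_set_iff_bounded_le by auto
  \<comment> \<open>Strings of a leafless tree extend to paths, and the finite subcover uses only
    lengths up to \<open>m\<close>; hence pairs of strings of length at least \<open>m\<close>
    already carry a witness.\<close>
  have bar: "\<Phi> a b" if ab: "a \<in> T" "b \<in> T" "prefix \<sigma> a" "prefix \<tau> b" "m \<le> length a" "m \<le> length b" for a b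
  proof -
    obtain f g where fg: "f \<in> cone T a" "g \<in> cone T b"
      using cone_nonempty [OF T ab(1)] cone_nonempty [OF T ab(2)] by blast
    then have "f \<in> cone T \<sigma>" "g \<in> cone T \<tau>" using cone_mono that by blast+
    then obtain k where k: "k \<in> K" "\<Phi> (init f k) (init g k)" using K(2) by auto
    have "prefix (init f k) (init f (length a))" "prefix (init g k) (init g (length b))"
      using m [OF k(1)] that by (auto intro!: prefix_init)
    with k(2) fg show ?thesis unfolding cone_def using \<Phi>_mono by force
  qed
  \<comment> \<open>The bound on entries leaves finitely many strings of each length below a string
    with compact cone.\<close>
  have fin: "finite {a \<in> T. prefix \<upsilon> a \<and> length a \<le> n}" if "\<upsilon> \<in> compact_strings T" for \<upsilon> n
  proof (rule finite_subset)
    show "{a \<in> T. prefix \<upsilon> a \<and> length a \<le> n} \<subseteq> {xs. set xs \<subseteq> {..Max (H \<upsilon> ` {..n})} \<and> length xs \<le> n}"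
    proof safe
      fix a x assume a: "a \<in> T" "prefix \<upsilon> a" "length a \<le> n" "x \<in> set a"
      then obtain i where i: "i < length a" "x = a ! i" by (metis in_set_conv_nth)
      then have "x \<le> H \<upsilon> i" using H [OF that a(1,2)] by simp
      also have "\<dots> \<le> Max (H \<upsilon> ` {..n})" using i a by (intro Max_ge) auto
      finally show "x \<le> Max (H \<upsilon> ` {..n})" .
    qed
    show "finite {xs. set xs \<subseteq> {..Max (H \<upsilon> ` {..n})} \<and> length xs \<le> n}"
      by (rule finite_lists_length_le) simp
  qed
  define A where "A \<upsilon> = {a \<in> T. prefix \<upsilon> a \<and> length a \<le> length \<upsilon> + m}" for \<upsilon>
  \<comment> \<open>Both strings grow by one entry at each step, so a pair keeps the difference of
    the lengths of \<sigma> and \<tau>, and both strings reach the final depth \<open>m\<close> at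
    the same time.\<close>
  define S where "S = {(a, b) \<in> A \<sigma> \<times> A \<tau>. length a + length \<tau> = length b + length \<sigma>}"
  have "finite (A \<sigma> \<times> A \<tau>)" using fin \<sigma> \<tau> by (simp add: A_def)
  moreover have "S \<subseteq> A \<sigma> \<times> A \<tau>" by (auto simp: S_def)
  ultimately obtain Z where Z: "set Z = S" using finite_list finite_subset by metis
  show "covered T H \<Psi> \<sigma> \<tau>"
    unfolding covered_def \<Phi>_def [symmetric]
  proof (intro exI [of _ Z] conjI ballI)
    show "(\<sigma>, \<tau>) \<in> set Z" using \<sigma> \<tau> by (auto simp: Z S_def A_def compact_strings_def)
  next
    fix z assume "z \<in> set Z"
    then obtain a b where z: "z = (a, b)" "a \<in> T" "b \<in> T" "prefix \<sigma> a" "prefix \<tau> b"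
      "length a \<le> length \<sigma> + m" "length b \<le> length \<tau> + m" "length a + length \<tau> = length b + length \<sigma>"
      by (auto simp: Z S_def A_def)
    show "\<Phi> (fst z) (snd z) \<or> (\<forall>i<Suc (H \<sigma> (length (fst z))). \<forall>j<Suc (H \<tau> (length (snd z))).
        fst z @ [i] \<in> T \<and> snd z @ [j] \<in> T \<longrightarrow> (fst z @ [i], snd z @ [j]) \<in> set Z)"
    proof (cases "length a = length \<sigma> + m")
      case True
      then show ?thesis using bar [of a b] z by auto
    next
      case False
      then have "length a < length \<sigma> + m" "length b < length \<tau> + m" using z by auto
      then show ?thesis using z by (auto simp: Z S_def A_def)
    qed
  qed
qed

subsection \<open>Computable functions on paths\<close>

text \<open>The outputs are consistent with \<open>h\<close>, and they become arbitrarily long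
  because their union is a total function.\<close>

lemma path_graph_memI:
  assumes "path_graph h = \<Union>{string_graph \<rho> | \<rho> n. P n = Some \<rho>}"
  shows "P n = Some \<rho> \<Longrightarrow> init h (length \<rho>) = \<rho>" "\<exists>n \<rho>. P n = Some \<rho> \<and> k < length \<rho>"
proof -
  have *: "init h (length \<rho>) = \<rho>" if "P n = Some \<rho>" for n \<rho>
  proof (rule nth_equalityI)
    fix i assume "i < length (init h (length \<rho>))"
    then have "(i, \<rho> ! i) \<in> string_graph \<rho>" by (auto simp: string_graph_def)
    then have "(i, \<rho> ! i) \<in> path_graph h" unfolding assms using that by blast
    then show "init h (length \<rho>) ! i = \<rho> ! i" using \<open>i < _\<close> by (auto simp: path_graph_def)
  qed simp
  show "P n = Some \<rho> \<Longrightarrow> init h (length \<rho>) = \<rho>" by (rule *)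
  have "(k, h k) \<in> path_graph h" by (auto simp: path_graph_def)
  then show "\<exists>n \<rho>. P n = Some \<rho> \<and> k < length \<rho>" unfolding assms by (auto simp: string_graph_def)
qed

text \<open>\<open>J \<alpha> \<rho>\<close> says that the output on \<alpha> extends \<rho>. One
  output determines the value on the whole cone up to its length, which gives soundness; unboundedly
  long outputs give completeness at every precision \<rho>.\<close>

lemma computable_path_fun_relation:
  assumes "computable_path_fun T S \<Psi>"
  obtains J where "semidec (\<lambda>p. J (fst p) (snd p))"
    "\<And>\<alpha> \<rho> f. J \<alpha> \<rho> \<Longrightarrow> f \<in> cone T \<alpha> \<Longrightarrow> \<Psi> f \<in> cone S \<rho>"
    "\<And>\<rho> f. f \<in> paths T \<Longrightarrow> \<Psi> f \<in> cone S \<rho> \<Longrightarrow> \<exists>k. J (init f k) \<rho>"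
proof -
  have "\<Psi> ` paths T \<subseteq> paths S" using assms unfolding computable_path_fun_def by (rule conjunct1)
  then have maps: "\<Psi> f \<in> paths S" if "f \<in> paths T" for f using that by blast
  from assms obtain P where P: "partial_computable_string1 P"
    and gr': "\<forall>f\<in>paths T. path_graph (\<Psi> f) = \<Union>{string_graph \<rho> | \<rho> n. P (init f n) = Some \<rho>}"
    unfolding computable_path_fun_def by (elim conjE exE) (rule that)
  note gr = bspec [OF gr']
  let ?J = "\<lambda>\<alpha> \<rho>. \<exists>\<rho>'. P \<alpha> = Some \<rho>' \<and> prefix \<rho> \<rho>'"
  show thesis
  proof (rule that [of ?J])
    show "semidec (\<lambda>p. ?J (fst p) (snd p))"
      by (intro semidec_intros semidec_comp2 [OF semidec_graph_string1 [OF P]]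
          semidec_decidable [OF decidable_prefix] computable_intros)
  next
    fix \<alpha> \<rho> f assume J: "?J \<alpha> \<rho>" and f: "f \<in> cone T \<alpha>"
    then obtain \<rho>' where \<rho>': "P (init f (length \<alpha>)) = Some \<rho>'" "prefix \<rho> \<rho>'" by (auto simp: cone_def)
    have "init (\<Psi> f) (length \<rho>') = \<rho>'"
      using path_graph_memI(1) [OF gr \<rho>'(1)] f by (simp add: cone_def)
    then show "\<Psi> f \<in> cone S \<rho>" using \<rho>'(2) maps [of f] f init_prefixD [of \<rho> "\<Psi> f" "length \<rho>'"] by (simp add: cone_def)
  next
    fix \<rho> f assume f: "f \<in> paths T" and \<rho>: "\<Psi> f \<in> cone S \<rho>"
    obtain n \<rho>' where \<rho>': "P (init f n) = Some \<rho>'" "length \<rho> < length \<rho>'"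
      using path_graph_memI(2) [OF gr [OF f]] by blast
    have "init (\<Psi> f) (length \<rho>') = \<rho>'" by (rule path_graph_memI(1) [OF gr [OF f] \<rho>'(1)])
    then have "prefix \<rho> \<rho>'" using coneD [OF \<rho>] \<rho>'(2) init_prefix_iff by (metis less_imp_le)
    with \<rho>'(1) show "\<exists>k. ?J (init f k) \<rho>" by blast
  qed
qed

text \<open>As in the unary case. Since the program reads strings of equal length, completeness
  provides a single depth \<open>k\<close> for both arguments.\<close>

lemma computable_path_fun2_relation:
  assumes "computable_path_fun2 T S \<Psi>"
  obtains E where "semidec (\<lambda>p. E (fst p) (fst (snd p)) (snd (snd p)))"
    "\<And>\<alpha> \<beta> \<rho> f g. E \<alpha> \<beta> \<rho> \<Longrightarrow> f \<in> cone T \<alpha> \<Longrightarrow> g \<in> cone T \<beta> \<Longrightarrow> \<Psi> f g \<in> cone S \<rho>"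
    "\<And>\<rho> f g. f \<in> paths T \<Longrightarrow> g \<in> paths T \<Longrightarrow> \<Psi> f g \<in> cone S \<rho> \<Longrightarrow> \<exists>k. E (init f k) (init g k) \<rho>"
proof -
  have "\<forall>f\<in>paths T. \<forall>g\<in>paths T. \<Psi> f g \<in> paths S"
    using assms unfolding computable_path_fun2_def by (rule conjunct1)
  then have maps: "\<Psi> f g \<in> paths S" if "f \<in> paths T" "g \<in> paths T" for f g using that by blast
  from assms obtain P where P: "partial_computable_string2 P"
    and len: "\<forall>\<sigma> \<tau> \<rho>. P \<sigma> \<tau> = Some \<rho> \<longrightarrow> \<sigma> \<in> T \<and> \<tau> \<in> T \<and> length \<sigma> = length \<tau> \<and> \<rho> \<in> S"
    and gr': "\<forall>f\<in>paths T. \<forall>g\<in>paths T.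
      path_graph (\<Psi> f g) = \<Union>{string_graph \<rho> | \<rho> n. P (init f n) (init g n) = Some \<rho>}"
    unfolding computable_path_fun2_def by (elim conjE exE) (rule that)
  note gr = bspec [OF bspec [OF gr']]
  let ?E = "\<lambda>\<alpha> \<beta> \<rho>. \<exists>\<rho>'. P \<alpha> \<beta> = Some \<rho>' \<and> prefix \<rho> \<rho>'"
  show thesis
  proof (rule that [of ?E])
    show "semidec (\<lambda>p. ?E (fst p) (fst (snd p)) (snd (snd p)))"
      by (intro semidec_intros semidec_comp3 [OF semidec_graph_string2 [OF P]]
          semidec_decidable [OF decidable_prefix] computable_intros)
  next
    fix \<alpha> \<beta> \<rho> f g assume E: "?E \<alpha> \<beta> \<rho>" and fg: "f \<in> cone T \<alpha>" "g \<in> cone T \<beta>"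
    then obtain \<rho>' where "P \<alpha> \<beta> = Some \<rho>'" "prefix \<rho> \<rho>'" by blast
    then have \<rho>': "P (init f (length \<alpha>)) (init g (length \<alpha>)) = Some \<rho>'" "prefix \<rho> \<rho>'"
      using len [rule_format, of \<alpha> \<beta> \<rho>'] fg by (auto simp: cone_def)
    have "init (\<Psi> f g) (length \<rho>') = \<rho>'"
      using path_graph_memI(1) [OF gr, of f g "length \<alpha>" \<rho>'] \<rho>'(1) fg by (simp add: cone_def)
    then show "\<Psi> f g \<in> cone S \<rho>" using \<rho>'(2) maps [of f g] fg init_prefixD [of \<rho> "\<Psi> f g" "length \<rho>'"] by (simp add: cone_def)
  next
    fix \<rho> f g assume f: "f \<in> paths T" "g \<in> paths T" and \<rho>: "\<Psi> f g \<in> cone S \<rho>"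
    obtain n \<rho>' where \<rho>': "P (init f n) (init g n) = Some \<rho>'" "length \<rho> < length \<rho>'"
      using path_graph_memI(2) [OF gr [OF f]] by blast
    have "init (\<Psi> f g) (length \<rho>') = \<rho>'"
      using path_graph_memI(1) [OF gr [OF f]] \<rho>'(1) by blast
    then have "prefix \<rho> \<rho>'" using coneD [OF \<rho>] \<rho>'(2) init_prefix_iff by (metis less_imp_le)
    with \<rho>'(1) show "\<exists>k. ?E (init f k) (init g k) \<rho>" by blast
  qed
qed

section \<open>The quotient by a closed normal subgroup\<close>

text \<open>\<open>E \<alpha> \<beta> \<rho>\<close> and \<open>J \<alpha> \<rho>\<close> certify \<open>[\<alpha>][\<beta>] \<subseteq> [\<rho>]\<close> and \<open>[\<alpha>]\<inverse> \<subseteq> [\<rho>]\<close>.\<close>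

locale Baire_quotient = normal N G
  for G :: "((nat \<Rightarrow> nat), 'm) monoid_scheme" (structure) and N +
  fixes T :: "nat list set" and H :: "nat list \<Rightarrow> nat \<Rightarrow> nat"
    and E :: "nat list \<Rightarrow> nat list \<Rightarrow> nat list \<Rightarrow> bool" and J :: "nat list \<Rightarrow> nat list \<Rightarrow> bool"
  assumes carrier: "carrier G = paths T"
    and closed: "closedin (path_space T) N"
    and tree: "tree T" and leafless: "leafless T"
    and locally_compact: "locally_compact_space (path_space T)"
    and decidable_T: "decidable (\<lambda>\<sigma>. \<sigma> \<in> T)"
    and decidable_compact: "decidable (\<lambda>\<sigma>. \<sigma> \<in> compact_strings T)"
    and decidable_N: "decidable (\<lambda>\<sigma>. \<sigma> \<in> subtree_of T N)"
    and computable_H: "computable (\<lambda>p. H (fst p) (snd p))"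
    and bound_H: "\<And>\<sigma> \<rho> i. \<sigma> \<in> compact_strings T \<Longrightarrow> \<rho> \<in> T \<Longrightarrow> prefix \<sigma> \<rho> \<Longrightarrow> i < length \<rho> \<Longrightarrow> \<rho> ! i \<le> H \<sigma> i"
    and semidec_E: "semidec (\<lambda>p. E (fst p) (fst (snd p)) (snd (snd p)))"
    and E_sound: "\<And>\<alpha> \<beta> \<rho> f g. E \<alpha> \<beta> \<rho> \<Longrightarrow> f \<in> cone T \<alpha> \<Longrightarrow> g \<in> cone T \<beta> \<Longrightarrow> f \<otimes> g \<in> cone T \<rho>"
    and E_complete: "\<And>\<rho> f g. f \<in> paths T \<Longrightarrow> g \<in> paths T \<Longrightarrow> f \<otimes> g \<in> cone T \<rho> \<Longrightarrow>
      \<exists>k. E (init f k) (init g k) \<rho>"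
    and semidec_J: "semidec (\<lambda>p. J (fst p) (snd p))"
    and J_sound: "\<And>\<alpha> \<rho> f. J \<alpha> \<rho> \<Longrightarrow> f \<in> cone T \<alpha> \<Longrightarrow> inv f \<in> cone T \<rho>"
    and J_complete: "\<And>\<rho> f. f \<in> paths T \<Longrightarrow> inv f \<in> cone T \<rho> \<Longrightarrow> \<exists>k. J (init f k) \<rho>"
begin

abbreviation \<pi> :: "(nat \<Rightarrow> nat) \<Rightarrow> (nat \<Rightarrow> nat) set" where "\<pi> f \<equiv> N #> f"
abbreviation Y :: "(nat \<Rightarrow> nat) set topology" where "Y \<equiv> quotient_group_topology G (path_space T) N"

section \<open>The quotient map and the images of cones\<close>

definition B :: "nat list \<Rightarrow> (nat \<Rightarrow> nat) set set" where "B \<sigma> = \<pi> ` cone T \<sigma>"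

lemma paths_closed: "f \<in> paths T \<Longrightarrow> g \<in> paths T \<Longrightarrow> f \<otimes> g \<in> paths T" "f \<in> paths T \<Longrightarrow> inv f \<in> paths T"
  using m_closed inv_closed by (simp_all flip: carrier)

lemma N_paths: "n \<in> N \<Longrightarrow> n \<in> paths T"
  using subset carrier by auto

lemma \<pi>_eq_iff:
  assumes "f \<in> paths T" "g \<in> paths T"
  shows "\<pi> f = \<pi> g \<longleftrightarrow> inv f \<otimes> g \<in> N"
proof -
  have fg: "f \<in> carrier G" "g \<in> carrier G" using assms by (simp_all add: carrier)
  have "\<pi> f = \<pi> g \<longleftrightarrow> g \<in> \<pi> f"
    using fg repr_independence repr_independenceD subgroup_axioms by metis
  also have "\<dots> \<longleftrightarrow> g \<in> f <# N" using coset_eq fg by simp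
  also have "\<dots> \<longleftrightarrow> inv f \<otimes> g \<in> N"
    using lcos_module_imp [OF is_group fg(1)] fg
    by (auto simp: l_coset_def intro!: bexI [of _ "inv f \<otimes> g"]) (simp flip: m_assoc)
  finally show ?thesis .
qed

text \<open>Normality turns the right coset into a left one, so a coset is explored by multiplying
  on the right with elements of \<open>N\<close>. The certificates for membership in coded sets use
  this form.\<close>

lemma \<pi>_eq_iff_ex:
  assumes "f \<in> paths T" "g \<in> paths T"
  shows "\<pi> f = \<pi> g \<longleftrightarrow> (\<exists>n\<in>N. f \<otimes> n = g)"
proof -
  have fg: "f \<in> carrier G" "g \<in> carrier G" using assms by (simp_all add: carrier)
  have "inv f \<otimes> g \<in> N \<longleftrightarrow> (\<exists>n\<in>N. f \<otimes> n = g)"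
  proof
    assume "inv f \<otimes> g \<in> N"
    then show "\<exists>n\<in>N. f \<otimes> n = g" using fg by (intro bexI [of _ "inv f \<otimes> g"]) (simp_all flip: m_assoc)
  next
    assume "\<exists>n\<in>N. f \<otimes> n = g"
    then obtain n where n: "n \<in> N" "g = f \<otimes> n" by blast
    then have "inv f \<otimes> g = n" using fg subset by (auto simp flip: m_assoc)
    with n show "inv f \<otimes> g \<in> N" by simp
  qed
  then show ?thesis by (simp add: \<pi>_eq_iff [OF assms])
qed

lemma Mod_mult: "f \<in> paths T \<Longrightarrow> g \<in> paths T \<Longrightarrow> \<pi> f \<otimes>\<^bsub>G Mod N\<^esub> \<pi> g = \<pi> (f \<otimes> g)"
  by (simp add: FactGroup_def rcos_sum carrier)

lemma Mod_carrier: "carrier (G Mod N) = \<pi> ` paths T"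
  by (auto simp: FactGroup_def RCOSETS_def carrier)

lemma Mod_inv: "f \<in> paths T \<Longrightarrow> inv\<^bsub>G Mod N\<^esub> (\<pi> f) = \<pi> (inv f)"
  by (simp add: inv_FactGroup Mod_carrier rcos_inv carrier)

lemma quotient_map_\<pi>: "quotient_map (path_space T) Y \<pi>"
  unfolding quotient_group_topology_def by (rule quotient_map_quotient_topology)

lemma topspace_Y: "topspace Y = \<pi> ` paths T"
  using quotient_imp_surjective_map [OF quotient_map_\<pi>] by simp

lemma openin_Y: "openin Y U \<longleftrightarrow> U \<subseteq> \<pi> ` paths T \<and> openin (path_space T) {f \<in> paths T. \<pi> f \<in> U}"
  unfolding quotient_group_topology_def openin_quotient_topology by simp

lemma \<pi>_mem_B_iff: "f \<in> paths T \<Longrightarrow> \<pi> f \<in> B \<sigma> \<longleftrightarrow> (\<exists>n\<in>N. f \<otimes> n \<in> cone T \<sigma>)"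
  unfolding B_def image_iff
proof
  assume f: "f \<in> paths T"
  {
    assume "\<exists>g\<in>cone T \<sigma>. \<pi> f = \<pi> g"
    then show "\<exists>n\<in>N. f \<otimes> n \<in> cone T \<sigma>" using f coneD \<pi>_eq_iff_ex by metis
  next
    assume "\<exists>n\<in>N. f \<otimes> n \<in> cone T \<sigma>"
    then show "\<exists>g\<in>cone T \<sigma>. \<pi> f = \<pi> g" using f coneD \<pi>_eq_iff_ex by metis
  }
qed

text \<open>The quotient map is open: if \<open>f \<otimes> n\<close> lies in the cone of \<sigma>,
  then by continuity so does \<open>g \<otimes> n\<close> for all \<open>g\<close> near
  \<open>f\<close>, with the same \<open>n\<close>.\<close>

lemma openin_B: "openin Y (B \<sigma>)"
  unfolding openin_Y
proof
  show "B \<sigma> \<subseteq> \<pi> ` paths T" unfolding B_def using cone_subset_paths by blast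
  show "openin (path_space T) {f \<in> paths T. \<pi> f \<in> B \<sigma>}"
    unfolding openin_path_space
  proof (intro conjI ballI)
    fix f assume "f \<in> {f \<in> paths T. \<pi> f \<in> B \<sigma>}"
    then obtain n where f: "f \<in> paths T" and n: "n \<in> N" "f \<otimes> n \<in> cone T \<sigma>" using \<pi>_mem_B_iff by auto
    then obtain k where k: "E (init f k) (init n k) \<sigma>" using E_complete N_paths by blast
    have "g \<in> paths T \<and> \<pi> g \<in> B \<sigma>" if "g \<in> cone T (init f k)" for g
    proof -
      have "g \<otimes> n \<in> cone T \<sigma>" using E_sound [OF k that] N_paths [OF n(1)] by simp
      then show ?thesis using that coneD \<pi>_mem_B_iff n(1) by metis
    qed
    then show "\<exists>k. cone T (init f k) \<subseteq> {f \<in> paths T. \<pi> f \<in> B \<sigma>}" by blast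
  qed blast
qed

lemma compactin_B: "\<sigma> \<in> compact_strings T \<Longrightarrow> compactin Y (B \<sigma>)"
  unfolding B_def compact_strings_def
  using quotient_imp_continuous_map [OF quotient_map_\<pi>] image_compactin by blast

lemma Y_nbhd:
  assumes "openin Y U" "f \<in> paths T" "\<pi> f \<in> U"
  shows "\<exists>n. init f n \<in> compact_strings T \<and> B (init f n) \<subseteq> U"
proof -
  have "openin (path_space T) {f \<in> paths T. \<pi> f \<in> U}" using assms(1) by (simp add: openin_Y)
  from compact_strings_base [OF locally_compact this, of f] assms(2,3) show ?thesis
    by (auto simp: B_def)
qed

lemma B_base:
  assumes "openin Y U" "x \<in> U"
  shows "\<exists>\<sigma>. \<sigma> \<in> compact_strings T \<and> x \<in> B \<sigma> \<and> B \<sigma> \<subseteq> U"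
proof -
  obtain f where f: "f \<in> paths T" "x = \<pi> f" using assms openin_Y by blast
  then show ?thesis using Y_nbhd [OF assms(1) f(1)] assms(2) by (auto simp: B_def)
qed

lemma openin_YI:
  assumes "\<And>f. f \<in> paths T \<Longrightarrow> \<pi> f \<in> U \<Longrightarrow> \<exists>n. B (init f n) \<subseteq> U" "U \<subseteq> \<pi> ` paths T"
  shows "openin Y U"
proof (subst openin_subopen, intro ballI)
  fix x assume "x \<in> U"
  then obtain f where f: "f \<in> paths T" "x = \<pi> f" using assms(2) by blast
  then obtain n where "B (init f n) \<subseteq> U" using assms(1) \<open>x \<in> U\<close> by blast
  moreover have "x \<in> B (init f n)" using f by (simp add: B_def)
  ultimately show "\<exists>V. openin Y V \<and> x \<in> V \<and> V \<subseteq> U" using openin_B by blast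
qed

text \<open>If the cosets differ then \<open>f\<inverse>g\<close> has a prefix outside the tree of \<open>N\<close>.\<close>

lemma \<pi>_neq_iff:
  assumes f: "f \<in> paths T" and g: "g \<in> paths T"
  shows "\<pi> f \<noteq> \<pi> g \<longleftrightarrow>
    (\<exists>k l. \<exists>\<iota> \<rho>. J (init f k) \<iota> \<and> E \<iota> (init g l) \<rho> \<and> \<rho> \<notin> subtree_of T N)"
proof
  assume "\<pi> f \<noteq> \<pi> g"
  then have "inv f \<otimes> g \<in> paths T - N" using f g by (simp add: \<pi>_eq_iff paths_closed)
  moreover have "openin (path_space T) (paths T - N)" using closed by (simp add: closedin_def)
  ultimately obtain m where m: "cone T (init (inv f \<otimes> g) m) \<subseteq> paths T - N"
    using openin_path_space by blast
  let ?\<rho> = "init (inv f \<otimes> g) m"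
  have "?\<rho> \<notin> subtree_of T N" using m by (auto simp: subtree_of_def)
  moreover obtain l where l: "E (init (inv f) l) (init g l) ?\<rho>"
    using E_complete [of "inv f" g ?\<rho>] f g paths_closed by auto
  moreover obtain k where "J (init f k) (init (inv f) l)"
    using J_complete [of f "init (inv f) l"] f paths_closed by auto
  ultimately show "\<exists>k l. \<exists>\<iota> \<rho>. J (init f k) \<iota> \<and> E \<iota> (init g l) \<rho> \<and> \<rho> \<notin> subtree_of T N" by blast
next
  assume "\<exists>k l. \<exists>\<iota> \<rho>. J (init f k) \<iota> \<and> E \<iota> (init g l) \<rho> \<and> \<rho> \<notin> subtree_of T N"
  then obtain k l \<iota> \<rho> where *: "J (init f k) \<iota>" "E \<iota> (init g l) \<rho>" "\<rho> \<notin> subtree_of T N" by blast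
  then have "inv f \<otimes> g \<in> cone T \<rho>" using J_sound E_sound f g by simp
  then have "inv f \<otimes> g \<notin> N" using *(3) coneD by (auto simp: subtree_of_def)
  then show "\<pi> f \<noteq> \<pi> g" using f g by (simp add: \<pi>_eq_iff)
qed

section \<open>The quotient as a totally disconnected locally compact group\<close>

lemma Hausdorff_Y: "Hausdorff_space Y"
  unfolding Hausdorff_space_def
proof (intro allI impI)
  fix x y assume "x \<in> topspace Y \<and> y \<in> topspace Y \<and> x \<noteq> y"
  then obtain f g where fg: "f \<in> paths T" "g \<in> paths T" "x = \<pi> f" "y = \<pi> g" "\<pi> f \<noteq> \<pi> g"
    unfolding topspace_Y by blast
  then obtain k l \<iota> \<rho> where *: "J (init f k) \<iota>" "E \<iota> (init g l) \<rho>" "\<rho> \<notin> subtree_of T N"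
    using \<pi>_neq_iff by blast
  \<comment> \<open>The witness of inequality involves only prefixes of the two paths, so it
    separates all cosets through the two cones at once.\<close>
  have "\<pi> f' \<noteq> \<pi> g'" if "f' \<in> cone T (init f k)" "g' \<in> cone T (init g l)" for f' g'
  proof -
    have "f' \<in> paths T" "g' \<in> paths T" "init f' k = init f k" "init g' l = init g l"
      using that by (auto simp: cone_def)
    with * show ?thesis using \<pi>_neq_iff by metis
  qed
  then have "disjnt (B (init f k)) (B (init g l))" by (force simp: B_def disjnt_iff)
  moreover have "x \<in> B (init f k)" "y \<in> B (init g l)" using fg by (auto simp: B_def)
  ultimately show "\<exists>U V. openin Y U \<and> openin Y V \<and> x \<in> U \<and> y \<in> V \<and> disjnt U V"
    using openin_B by blast
qed

lemma topological_group_Y: "topological_group (G Mod N) Y"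
  unfolding topological_group_def
proof (intro conjI)
  show "group (G Mod N)" by (rule factorgroup_is_group)
  show "topspace Y = carrier (G Mod N)" by (simp add: topspace_Y Mod_carrier)
  show "continuous_map Y Y (\<lambda>x. inv\<^bsub>G Mod N\<^esub> x)"
    unfolding continuous_map
  proof (intro conjI allI impI)
    show "(\<lambda>x. inv\<^bsub>G Mod N\<^esub> x) ` topspace Y \<subseteq> topspace Y"
      by (auto simp: topspace_Y Mod_inv paths_closed)
    fix U assume U: "openin Y U"
    show "openin Y {x \<in> topspace Y. inv\<^bsub>G Mod N\<^esub> x \<in> U}"
    proof (rule openin_YI)
      fix f assume f: "f \<in> paths T" and "\<pi> f \<in> {x \<in> topspace Y. inv\<^bsub>G Mod N\<^esub> x \<in> U}"
      then have "\<pi> (inv f) \<in> U" by (simp add: Mod_inv)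
      then obtain n where n: "B (init (inv f) n) \<subseteq> U" using Y_nbhd [OF U] f paths_closed by blast
      obtain k where k: "J (init f k) (init (inv f) n)"
        using J_complete [of f "init (inv f) n"] f paths_closed by auto
      have "\<pi> g \<in> topspace Y \<and> inv\<^bsub>G Mod N\<^esub> (\<pi> g) \<in> U" if "g \<in> cone T (init f k)" for g
        using J_sound [OF k that] n coneD [OF that] by (auto simp: Mod_inv B_def topspace_Y)
      then show "\<exists>n. B (init f n) \<subseteq> {x \<in> topspace Y. inv\<^bsub>G Mod N\<^esub> x \<in> U}"
        unfolding B_def by blast
    qed (auto simp: topspace_Y)
  qed
  show "continuous_map (prod_topology Y Y) Y (\<lambda>(x, y). x \<otimes>\<^bsub>G Mod N\<^esub> y)"
    unfolding continuous_map
  proof (intro conjI allI impI)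
    show "(\<lambda>(x, y). x \<otimes>\<^bsub>G Mod N\<^esub> y) ` topspace (prod_topology Y Y) \<subseteq> topspace Y"
      by (auto simp: topspace_Y rcos_sum carrier paths_closed)
    fix U assume U: "openin Y U"
    let ?V = "{p \<in> topspace (prod_topology Y Y). (case p of (x, y) \<Rightarrow> x \<otimes>\<^bsub>G Mod N\<^esub> y) \<in> U}"
    show "openin (prod_topology Y Y) ?V"
      unfolding openin_prod_topology_alt
    proof (intro allI impI)
      fix x y assume "(x, y) \<in> ?V"
      then obtain f g where fg: "f \<in> paths T" "g \<in> paths T" "x = \<pi> f" "y = \<pi> g" "\<pi> (f \<otimes> g) \<in> U"
        by (auto simp: topspace_Y rcos_sum carrier)
      then obtain n where n: "B (init (f \<otimes> g) n) \<subseteq> U" using Y_nbhd [OF U] paths_closed by blast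
      obtain k where k: "E (init f k) (init g k) (init (f \<otimes> g) n)"
        using E_complete [of f g "init (f \<otimes> g) n"] fg paths_closed by auto
      have "(\<pi> f', \<pi> g') \<in> ?V" if "f' \<in> cone T (init f k)" "g' \<in> cone T (init g k)" for f' g'
      proof -
        have "f' \<in> paths T" "g' \<in> paths T" using that coneD by blast+
        moreover have "\<pi> (f' \<otimes> g') \<in> U" using E_sound [OF k that] n by (auto simp: B_def)
        ultimately show ?thesis by (simp add: topspace_Y rcos_sum carrier)
      qed
      then have "B (init f k) \<times> B (init g k) \<subseteq> ?V" unfolding B_def by blast
      moreover have "x \<in> B (init f k)" "y \<in> B (init g k)" using fg by (auto simp: B_def)
      ultimately show "\<exists>U' V'. openin Y U' \<and> openin Y V' \<and> x \<in> U' \<and> y \<in> V' \<and> U' \<times> V' \<subseteq> ?V"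
        using openin_B by blast
    qed
  qed
qed

lemma tdlc_Y: "tdlc_group (G Mod N) Y"
  unfolding tdlc_group_def
proof (intro conjI topological_group_Y Hausdorff_Y)
  show "totally_disconnected_space Y"
    unfolding totally_disconnected_space_def
  proof (intro allI impI)
    fix S assume S: "connectedin Y S"
    have "a = b" if ab: "a \<in> S" "b \<in> S" for a b
    proof (rule ccontr)
      assume "a \<noteq> b"
      moreover have "a \<in> topspace Y" "b \<in> topspace Y" using S ab connectedin_subset_topspace by blast+
      ultimately obtain U V where UV: "openin Y U" "a \<in> U" "b \<in> V" "disjnt U V"
        using Hausdorff_Y unfolding Hausdorff_space_def by metis
      then obtain \<sigma> where \<sigma>: "\<sigma> \<in> compact_strings T" "a \<in> B \<sigma>" "B \<sigma> \<subseteq> U" using B_base by blast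
      \<comment> \<open>Compact base sets are closed in a Hausdorff space, so they are clopen and
        cannot split a connected set.\<close>
      then have "closedin Y (B \<sigma>)" using compactin_B compactin_imp_closedin Hausdorff_Y by blast
      then have "S \<subseteq> B \<sigma> \<or> disjnt S (B \<sigma>)" using S openin_B connectedin_clopen_cases by blast
      with \<sigma> UV ab show False by (auto simp: disjnt_iff)
    qed
    then show "\<exists>a. S \<subseteq> {a}" by blast
  qed
  show "locally_compact_space Y"
    unfolding locally_compact_space_def
    by (metis B_base compactin_B openin_B openin_topspace order_refl)
qed

subsection \<open>The base of the quotient is computable\<close>

abbreviation D :: "nat list list \<Rightarrow> (nat \<Rightarrow> nat) set set" where "D \<equiv> list_Union B"
abbreviation C :: "nat list \<Rightarrow> bool" where "C \<equiv> \<lambda>\<sigma>. \<sigma> \<in> compact_strings T"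
abbreviation TN :: "nat list set" where "TN \<equiv> subtree_of T N"

lemma \<pi>_mem_D_iff: "f \<in> paths T \<Longrightarrow> \<pi> f \<in> D L \<longleftrightarrow> (\<exists>n\<in>N. \<exists>\<rho>\<in>set L. f \<otimes> n \<in> cone T \<rho>)"
  by (auto simp: list_Union_def \<pi>_mem_B_iff)

lemma TN_init: "n \<in> N \<Longrightarrow> init n k \<in> TN"
  using N_paths by (force simp: subtree_of_def paths_init)

lemma TN_E: assumes "\<nu> \<in> TN" obtains n where "n \<in> N" "n \<in> cone T \<nu>"
  using assms by (auto simp: subtree_of_def)

lemma mem_D_certificate:
  assumes "f \<in> paths T"
  shows "\<pi> f \<in> D L \<longleftrightarrow> (\<exists>k. \<exists>\<nu> \<rho>. \<nu> \<in> TN \<and> \<rho> \<in> set L \<and> E (init f k) \<nu> \<rho>)"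
proof
  assume "\<pi> f \<in> D L"
  then obtain n \<rho> where n: "n \<in> N" "\<rho> \<in> set L" "f \<otimes> n \<in> cone T \<rho>" using \<pi>_mem_D_iff assms by blast
  moreover obtain k where "E (init f k) (init n k) \<rho>"
    using E_complete [OF assms N_paths [OF n(1)] n(3)] by blast
  ultimately show "\<exists>k. \<exists>\<nu> \<rho>. \<nu> \<in> TN \<and> \<rho> \<in> set L \<and> E (init f k) \<nu> \<rho>"
    using TN_init by blast
next
  assume "\<exists>k. \<exists>\<nu> \<rho>. \<nu> \<in> TN \<and> \<rho> \<in> set L \<and> E (init f k) \<nu> \<rho>"
  then obtain k \<nu> \<rho> where *: "\<nu> \<in> TN" "\<rho> \<in> set L" "E (init f k) \<nu> \<rho>" by blast
  from *(1) obtain n where "n \<in> N" "n \<in> cone T \<nu>" by (rule TN_E)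
  then have "f \<otimes> n \<in> cone T \<rho>" using E_sound [OF *(3)] assms by simp
  then show "\<pi> f \<in> D L" using \<open>n \<in> N\<close> * assms \<pi>_mem_D_iff by blast
qed

text \<open>The triple product is bracketed as \<open>f \<otimes> (g \<otimes> n)\<close>, with
  \<beta> approximating \<open>g \<otimes> n\<close>, so that each of the two paths enters one
  product only. The depths \<open>k\<close> and \<open>l\<close> are independent because the two
  products may require different precision.\<close>

lemma mult_mem_D_certificate:
  assumes f: "f \<in> paths T" and g: "g \<in> paths T"
  shows "\<pi> (f \<otimes> g) \<in> D L \<longleftrightarrow>
    (\<exists>k l. \<exists>\<nu> \<beta> \<rho>. \<nu> \<in> TN \<and> \<rho> \<in> set L \<and> E (init g l) \<nu> \<beta> \<and> E (init f k) \<beta> \<rho>)"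
proof
  assume "\<pi> (f \<otimes> g) \<in> D L"
  then obtain n \<rho> where n: "n \<in> N" "\<rho> \<in> set L" "(f \<otimes> g) \<otimes> n \<in> cone T \<rho>"
    using \<pi>_mem_D_iff paths_closed f g by blast
  have n': "n \<in> paths T" using n(1) by (rule N_paths)
  have "f \<otimes> (g \<otimes> n) \<in> cone T \<rho>" using n f g n' by (simp add: m_assoc carrier)
  then obtain k where k: "E (init f k) (init (g \<otimes> n) k) \<rho>"
    using E_complete [OF f paths_closed(1) [OF g n']] by blast
  obtain l where "E (init g l) (init n l) (init (g \<otimes> n) k)"
    using E_complete [of g n "init (g \<otimes> n) k"] g n' paths_closed by auto
  with n k show "\<exists>k l. \<exists>\<nu> \<beta> \<rho>. \<nu> \<in> TN \<and> \<rho> \<in> set L \<and> E (init g l) \<nu> \<beta> \<and> E (init f k) \<beta> \<rho>"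
    using TN_init by blast
next
  assume "\<exists>k l. \<exists>\<nu> \<beta> \<rho>. \<nu> \<in> TN \<and> \<rho> \<in> set L \<and> E (init g l) \<nu> \<beta> \<and> E (init f k) \<beta> \<rho>"
  then obtain k l \<nu> \<beta> \<rho> where *: "\<nu> \<in> TN" "\<rho> \<in> set L" "E (init g l) \<nu> \<beta>" "E (init f k) \<beta> \<rho>" by blast
  from *(1) obtain n where n: "n \<in> N" "n \<in> cone T \<nu>" by (rule TN_E)
  have "f \<otimes> (g \<otimes> n) \<in> cone T \<rho>" using E_sound [OF *(4)] E_sound [OF *(3)] n f g by simp
  then have "(f \<otimes> g) \<otimes> n \<in> cone T \<rho>" using f g N_paths [OF n(1)] by (simp add: m_assoc carrier)
  then show "\<pi> (f \<otimes> g) \<in> D L" using n * f g paths_closed \<pi>_mem_D_iff by blast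
qed

lemma inv_mem_D_certificate:
  assumes f: "f \<in> paths T"
  shows "\<pi> (inv f) \<in> D L \<longleftrightarrow>
    (\<exists>k. \<exists>\<iota> \<nu> \<rho>. \<nu> \<in> TN \<and> \<rho> \<in> set L \<and> J (init f k) \<iota> \<and> E \<iota> \<nu> \<rho>)"
proof
  assume "\<pi> (inv f) \<in> D L"
  then obtain k \<nu> \<rho> where *: "\<nu> \<in> TN" "\<rho> \<in> set L" "E (init (inv f) k) \<nu> \<rho>"
    using mem_D_certificate f paths_closed by blast
  obtain l where "J (init f l) (init (inv f) k)"
    using J_complete [of f "init (inv f) k"] f paths_closed by auto
  with * show "\<exists>k. \<exists>\<iota> \<nu> \<rho>. \<nu> \<in> TN \<and> \<rho> \<in> set L \<and> J (init f k) \<iota> \<and> E \<iota> \<nu> \<rho>" by blast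
next
  assume "\<exists>k. \<exists>\<iota> \<nu> \<rho>. \<nu> \<in> TN \<and> \<rho> \<in> set L \<and> J (init f k) \<iota> \<and> E \<iota> \<nu> \<rho>"
  then obtain k \<iota> \<nu> \<rho> where *: "\<nu> \<in> TN" "\<rho> \<in> set L" "J (init f k) \<iota>" "E \<iota> \<nu> \<rho>" by blast
  from *(1) obtain n where n: "n \<in> N" "n \<in> cone T \<nu>" by (rule TN_E)
  have "inv f \<otimes> n \<in> cone T \<rho>" using E_sound [OF *(4)] J_sound [OF *(3)] n f by simp
  then show "\<pi> (inv f) \<in> D L" using n * f paths_closed \<pi>_mem_D_iff by blast
qed

lemmas decidable_strings [computable_intros] =
  decidable_comp [OF decidable_T] decidable_comp [OF decidable_compact] decidable_comp [OF decidable_N]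

lemma decidable_valid [computable_intros]: "computable f \<Longrightarrow> decidable (\<lambda>x. list_all C (f x))"
  unfolding list_all_iff by (intro computable_intros)

lemma covered_cones_iff:
  "\<sigma> \<in> compact_strings T \<Longrightarrow> \<tau> \<in> compact_strings T \<Longrightarrow>
    covered T H \<Psi> \<sigma> \<tau> \<longleftrightarrow> (\<forall>f\<in>cone T \<sigma>. \<forall>g\<in>cone T \<tau>. \<exists>k l. \<Psi> (init f k) (init g l))"
  by (rule covered_iff [OF tree leafless bound_H])

lemma mem_D_E: assumes "x \<in> D L" obtains \<sigma> f where "\<sigma> \<in> set L" "f \<in> cone T \<sigma>" "f \<in> paths T" "x = \<pi> f"
proof -
  obtain \<sigma> f where "\<sigma> \<in> set L" "f \<in> cone T \<sigma>" "x = \<pi> f"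
    using assms by (auto simp: list_Union_def B_def)
  then show thesis using that coneD by blast
qed

lemma D_I: "\<sigma> \<in> set L \<Longrightarrow> f \<in> cone T \<sigma> \<Longrightarrow> \<pi> f \<in> D L"
  by (auto simp: list_Union_def B_def)

text \<open>A condition on a single path is expressed with the second cone repeating the first.\<close>

lemma semidec_cone_condition:
  assumes \<Psi>: "semidec (\<lambda>p. \<Psi> (fst p) (snd p))"
    and R: "\<And>L M. list_all C L \<Longrightarrow> list_all C M \<Longrightarrow>
      R L M \<longleftrightarrow> (\<forall>\<sigma>\<in>set L. \<forall>f\<in>cone T \<sigma>. \<exists>k. \<Psi> M (init f k))"
  shows "semidec (\<lambda>p. list_all C (fst p) \<and> list_all C (snd p) \<and> R (fst p) (snd p))"
proof -
  have "semidec (\<lambda>p. list_all C (fst p) \<and> list_all C (snd p) \<and>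
      (\<forall>\<sigma>\<in>set (fst p). covered T H (\<lambda>\<alpha> \<beta>. \<Psi> (snd p) \<alpha>) \<sigma> \<sigma>))"
    by (intro semidec_conj semidec_ball_set semidec_decidable [OF decidable_valid]
        semidec_covered [OF decidable_T computable_H, where \<Psi> = "\<lambda>p \<alpha> \<beta>. \<Psi> (snd (fst p)) \<alpha>"]
        semidec_comp2 [OF \<Psi>] computable_intros)
  then show ?thesis
  proof (rule semidec_cong)
    fix p :: "nat list list \<times> nat list list"
    obtain L M where p: "p = (L, M)" by fastforce
    have "covered T H (\<lambda>\<alpha> \<beta>. \<Psi> M \<alpha>) \<sigma> \<sigma> \<longleftrightarrow> (\<forall>f\<in>cone T \<sigma>. \<exists>k. \<Psi> M (init f k))"
      if "\<sigma> \<in> compact_strings T" for \<sigma>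
      by (subst covered_cones_iff [OF that that]) auto
    then show "list_all C (fst p) \<and> list_all C (snd p) \<and> R (fst p) (snd p) \<longleftrightarrow>
        list_all C (fst p) \<and> list_all C (snd p) \<and>
        (\<forall>\<sigma>\<in>set (fst p). covered T H (\<lambda>\<alpha> \<beta>. \<Psi> (snd p) \<alpha>) \<sigma> \<sigma>)"
      using R unfolding p by (auto simp: list_all_iff)
  qed
qed

lemma semidec_subset: "semidec (\<lambda>p. list_all C (fst p) \<and> list_all C (snd p) \<and> D (fst p) \<subseteq> D (snd p))"
proof (rule semidec_cone_condition [of "\<lambda>M \<alpha>. \<exists>\<nu> \<rho>. \<nu> \<in> TN \<and> \<rho> \<in> set M \<and> E \<alpha> \<nu> \<rho>"])
  show "semidec (\<lambda>p. \<exists>\<nu> \<rho>. \<nu> \<in> TN \<and> \<rho> \<in> set (fst p) \<and> E (snd p) \<nu> \<rho>)"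
    by (intro semidec_ex semidec_conj semidec_decidable [OF decidable_strings(3)]
        semidec_decidable [OF decidable_mem_set] semidec_comp3 [OF semidec_E] computable_intros)
  fix L M
  have "D L \<subseteq> D M \<longleftrightarrow> (\<forall>\<sigma>\<in>set L. \<forall>f\<in>cone T \<sigma>. \<pi> f \<in> D M)"
    by (auto elim!: mem_D_E intro: D_I)
  then show "D L \<subseteq> D M \<longleftrightarrow> (\<forall>\<sigma>\<in>set L. \<forall>f\<in>cone T \<sigma>. \<exists>k. \<exists>\<nu> \<rho>. \<nu> \<in> TN \<and> \<rho> \<in> set M \<and> E (init f k) \<nu> \<rho>)"
    using mem_D_certificate [OF conjunct1 [OF coneD]] by simp
qed

lemma semidec_inv:
  "semidec (\<lambda>p. list_all C (fst p) \<and> list_all C (snd p) \<and> set_inv\<^bsub>G Mod N\<^esub> (D (fst p)) \<subseteq> D (snd p))"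
proof (rule semidec_cone_condition [of "\<lambda>M \<alpha>. \<exists>\<iota> \<nu> \<rho>. \<nu> \<in> TN \<and> \<rho> \<in> set M \<and> J \<alpha> \<iota> \<and> E \<iota> \<nu> \<rho>"])
  show "semidec (\<lambda>p. \<exists>\<iota> \<nu> \<rho>. \<nu> \<in> TN \<and> \<rho> \<in> set (fst p) \<and> J (snd p) \<iota> \<and> E \<iota> \<nu> \<rho>)"
    by (intro semidec_ex semidec_conj semidec_decidable [OF decidable_strings(3)]
        semidec_decidable [OF decidable_mem_set] semidec_comp2 [OF semidec_J]
        semidec_comp3 [OF semidec_E] computable_intros)
  fix L M
  have "set_inv\<^bsub>G Mod N\<^esub> (D L) \<subseteq> D M \<longleftrightarrow> (\<forall>\<sigma>\<in>set L. \<forall>f\<in>cone T \<sigma>. inv\<^bsub>G Mod N\<^esub> (\<pi> f) \<in> D M)"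
    by (auto simp: SET_INV_def elim!: mem_D_E intro: D_I)
  also have "\<dots> \<longleftrightarrow> (\<forall>\<sigma>\<in>set L. \<forall>f\<in>cone T \<sigma>. \<pi> (inv f) \<in> D M)"
    using Mod_inv [OF conjunct1 [OF coneD]] by (intro ball_cong refl) simp
  finally show "set_inv\<^bsub>G Mod N\<^esub> (D L) \<subseteq> D M \<longleftrightarrow>
      (\<forall>\<sigma>\<in>set L. \<forall>f\<in>cone T \<sigma>. \<exists>k. \<exists>\<iota> \<nu> \<rho>. \<nu> \<in> TN \<and> \<rho> \<in> set M \<and> J (init f k) \<iota> \<and> E \<iota> \<nu> \<rho>)"
    using inv_mem_D_certificate [OF conjunct1 [OF coneD]] by simp
qed

text \<open>Images of cones are disjoint iff the cosets of all pairs of paths differ. Each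
  difference has a witness in prefixes of the two paths, so this is a covering condition on products
  of cones.\<close>

lemma semidec_disjnt:
  "semidec (\<lambda>p. list_all C (fst p) \<and> list_all C (snd p) \<and> D (fst p) \<inter> D (snd p) = {})"
proof -
  let ?\<Psi> = "\<lambda>\<alpha> \<beta>. \<exists>\<iota> \<rho>. J \<alpha> \<iota> \<and> E \<iota> \<beta> \<rho> \<and> \<rho> \<notin> TN"
  have "semidec (\<lambda>p. list_all C (fst p) \<and> list_all C (snd p) \<and>
      (\<forall>\<sigma>\<in>set (fst p). \<forall>\<tau>\<in>set (snd p). covered T H ?\<Psi> \<sigma> \<tau>))"
    by (intro semidec_conj semidec_ball_set semidec_decidable [OF decidable_valid]
        semidec_covered [OF decidable_T computable_H, where \<Psi> = "\<lambda>_. ?\<Psi>"]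
        semidec_ex semidec_comp2 [OF semidec_J] semidec_comp3 [OF semidec_E]
        semidec_decidable [OF decidable_not] computable_intros)
  then show ?thesis
  proof (rule semidec_cong)
    fix p :: "nat list list \<times> nat list list"
    obtain L M where p: "p = (L, M)" by fastforce
    have "D L \<inter> D M = {} \<longleftrightarrow> (\<forall>\<sigma>\<in>set L. \<forall>\<tau>\<in>set M. \<forall>f\<in>cone T \<sigma>. \<forall>g\<in>cone T \<tau>. \<pi> f \<noteq> \<pi> g)"
      by (fastforce simp: list_Union_def B_def)
    also have "\<dots> \<longleftrightarrow> (\<forall>\<sigma>\<in>set L. \<forall>\<tau>\<in>set M. covered T H ?\<Psi> \<sigma> \<tau>)"
      if "list_all C L" "list_all C M"
    proof (intro ball_cong refl)
      fix \<sigma> \<tau> assume "\<sigma> \<in> set L" "\<tau> \<in> set M"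
      then have "\<sigma> \<in> compact_strings T" "\<tau> \<in> compact_strings T" using that by (auto simp: list_all_iff)
      note cov = covered_cones_iff [OF this]
      show "(\<forall>f\<in>cone T \<sigma>. \<forall>g\<in>cone T \<tau>. \<pi> f \<noteq> \<pi> g) \<longleftrightarrow> covered T H ?\<Psi> \<sigma> \<tau>"
        unfolding cov
      proof (intro ball_cong refl)
        fix f g assume "f \<in> cone T \<sigma>" "g \<in> cone T \<tau>"
        then have "f \<in> paths T" "g \<in> paths T" using coneD by blast+
        then show "\<pi> f \<noteq> \<pi> g \<longleftrightarrow> (\<exists>k l. ?\<Psi> (init f k) (init g l))" by (rule \<pi>_neq_iff)
      qed
    qed
    finally show "list_all C (fst p) \<and> list_all C (snd p) \<and> D (fst p) \<inter> D (snd p) = {} \<longleftrightarrow>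
        list_all C (fst p) \<and> list_all C (snd p) \<and>
        (\<forall>\<sigma>\<in>set (fst p). \<forall>\<tau>\<in>set (snd p). covered T H ?\<Psi> \<sigma> \<tau>)"
      unfolding p fst_conv snd_conv by blast
  qed
qed

text \<open>Here too the certificate reads prefixes of both paths, and compactness of the product of
  the two cones makes finitely many certificates sufficient.\<close>

lemma semidec_mult:
  "semidec (\<lambda>p. list_all C (fst p) \<and> list_all C (fst (snd p)) \<and> list_all C (snd (snd p)) \<and>
      D (fst p) <#>\<^bsub>G Mod N\<^esub> D (fst (snd p)) \<subseteq> D (snd (snd p)))"
proof -
  let ?\<Psi> = "\<lambda>K \<alpha> \<beta>. \<exists>\<nu> \<beta>' \<rho>. \<nu> \<in> TN \<and> \<rho> \<in> set K \<and> E \<beta> \<nu> \<beta>' \<and> E \<alpha> \<beta>' \<rho>"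
  have "semidec (\<lambda>p. list_all C (fst p) \<and> list_all C (fst (snd p)) \<and> list_all C (snd (snd p)) \<and>
      (\<forall>\<sigma>\<in>set (fst p). \<forall>\<tau>\<in>set (fst (snd p)). covered T H (?\<Psi> (snd (snd p))) \<sigma> \<tau>))"
    by (intro semidec_conj semidec_ball_set semidec_decidable [OF decidable_valid]
        semidec_covered [OF decidable_T computable_H, where \<Psi> = "\<lambda>p. ?\<Psi> (snd (snd (fst (fst p))))"]
        semidec_ex semidec_comp3 [OF semidec_E] semidec_decidable [OF decidable_strings(3)]
        semidec_decidable [OF decidable_mem_set] computable_intros)
  then show ?thesis
  proof (rule semidec_cong)
    fix p :: "nat list list \<times> nat list list \<times> nat list list"
    obtain L M K where p: "p = (L, M, K)" using prod_cases3 by blast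
    have "D L <#>\<^bsub>G Mod N\<^esub> D M \<subseteq> D K \<longleftrightarrow>
        (\<forall>\<sigma>\<in>set L. \<forall>\<tau>\<in>set M. \<forall>f\<in>cone T \<sigma>. \<forall>g\<in>cone T \<tau>. \<pi> f \<otimes>\<^bsub>G Mod N\<^esub> \<pi> g \<in> D K)"
      by (fastforce simp: set_mult_def list_Union_def [of B L] list_Union_def [of B M] B_def)
    also have "\<dots> \<longleftrightarrow> (\<forall>\<sigma>\<in>set L. \<forall>\<tau>\<in>set M. covered T H (?\<Psi> K) \<sigma> \<tau>)"
      if "list_all C L" "list_all C M"
    proof (intro ball_cong refl)
      fix \<sigma> \<tau> assume "\<sigma> \<in> set L" "\<tau> \<in> set M"
      then have "\<sigma> \<in> compact_strings T" "\<tau> \<in> compact_strings T" using that by (auto simp: list_all_iff)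
      note cov = covered_cones_iff [OF this]
      show "(\<forall>f\<in>cone T \<sigma>. \<forall>g\<in>cone T \<tau>. \<pi> f \<otimes>\<^bsub>G Mod N\<^esub> \<pi> g \<in> D K) \<longleftrightarrow> covered T H (?\<Psi> K) \<sigma> \<tau>"
        unfolding cov
      proof (intro ball_cong refl)
        fix f g assume "f \<in> cone T \<sigma>" "g \<in> cone T \<tau>"
        then have "f \<in> paths T" "g \<in> paths T" using coneD by blast+
        then show "\<pi> f \<otimes>\<^bsub>G Mod N\<^esub> \<pi> g \<in> D K \<longleftrightarrow> (\<exists>k l. ?\<Psi> K (init f k) (init g l))"
          by (simp only: Mod_mult mult_mem_D_certificate)
      qed
    qed
    finally show "list_all C (fst p) \<and> list_all C (fst (snd p)) \<and> list_all C (snd (snd p)) \<and>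
        D (fst p) <#>\<^bsub>G Mod N\<^esub> D (fst (snd p)) \<subseteq> D (snd (snd p)) \<longleftrightarrow>
        list_all C (fst p) \<and> list_all C (fst (snd p)) \<and> list_all C (snd (snd p)) \<and>
        (\<forall>\<sigma>\<in>set (fst p). \<forall>\<tau>\<in>set (fst (snd p)). covered T H (?\<Psi> (snd (snd p))) \<sigma> \<tau>)"
      unfolding p fst_conv snd_conv by blast
  qed
qed

theorem computably_tdlc_quotient: "computably_tdlc (G Mod N) Y"
proof -
  interpret base: computable_base "G Mod N" Y B C
  proof
    show "B \<sigma> \<noteq> {}" if "C \<sigma>" for \<sigma>
      using that cone_nonempty [OF tree leafless] by (auto simp: B_def compact_strings_def)
  qed (simp_all add: tdlc_Y decidable_compact compactin_B openin_B B_base semidec_subset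
      semidec_disjnt semidec_mult semidec_inv)
  show ?thesis by (rule base.computably_tdlc)
qed

end

theorem theorem11p9:
  fixes T :: "nat list set"
    and G :: "(nat \<Rightarrow> nat) monoid"
    and N :: "(nat \<Rightarrow> nat) set"
  assumes "tdlc_group G (path_space T)"
    and "computable_Baire_presentation T G"
    and "N \<lhd> G"
    and "closedin (path_space T) N"
    and "computable_tree (subtree_of T N)"
  shows "computably_tdlc (G Mod N) (quotient_group_topology G (path_space T) N)"
proof -
  have T: "comp_locally_compact T" and carrier: "carrier G = paths T"
    and "computable_path_fun2 T T (mult G)" "computable_path_fun T T (m_inv G)"
    using assms(2) by (auto simp: computable_Baire_presentation_def)
  obtain E where E: "semidec (\<lambda>p. E (fst p) (fst (snd p)) (snd (snd p)))"
    "\<And>\<alpha> \<beta> \<rho> f g. E \<alpha> \<beta> \<rho> \<Longrightarrow> f \<in> cone T \<alpha> \<Longrightarrow> g \<in> cone T \<beta> \<Longrightarrow> f \<otimes>\<^bsub>G\<^esub> g \<in> cone T \<rho>"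
    "\<And>\<rho> f g. f \<in> paths T \<Longrightarrow> g \<in> paths T \<Longrightarrow> f \<otimes>\<^bsub>G\<^esub> g \<in> cone T \<rho> \<Longrightarrow>
      \<exists>k. E (init f k) (init g k) \<rho>"
    using \<open>computable_path_fun2 T T (mult G)\<close> by (rule computable_path_fun2_relation) blast
  obtain J where J: "semidec (\<lambda>p. J (fst p) (snd p))"
    "\<And>\<alpha> \<rho> f. J \<alpha> \<rho> \<Longrightarrow> f \<in> cone T \<alpha> \<Longrightarrow> inv\<^bsub>G\<^esub> f \<in> cone T \<rho>"
    "\<And>\<rho> f. f \<in> paths T \<Longrightarrow> inv\<^bsub>G\<^esub> f \<in> cone T \<rho> \<Longrightarrow> \<exists>k. J (init f k) \<rho>"
    using \<open>computable_path_fun T T (m_inv G)\<close> by (rule computable_path_fun_relation) blast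
  obtain H where H: "computable_string_bound H"
    "\<And>\<sigma> \<rho> i. \<sigma> \<in> compact_strings T \<Longrightarrow> \<rho> \<in> T \<Longrightarrow> prefix \<sigma> \<rho> \<Longrightarrow> i < length \<rho> \<Longrightarrow> \<rho> ! i \<le> H \<sigma> i"
    using T unfolding comp_locally_compact_def compact_strings_def by blast
  interpret Baire_quotient G N T H E J
  proof (rule Baire_quotient.intro [OF assms(3)], unfold_locales)
    show "tree T" "leafless T" "locally_compact_space (path_space T)" "decidable (\<lambda>\<sigma>. \<sigma> \<in> T)"
      "decidable (\<lambda>\<sigma>. \<sigma> \<in> compact_strings T)"
      using T unfolding comp_locally_compact_def computable_tree_def compact_strings_def
      by (auto intro: computable_string_set_decidable simp del: mem_Collect_eq)
    show "decidable (\<lambda>\<sigma>. \<sigma> \<in> subtree_of T N)"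
      using assms(5) unfolding computable_tree_def by (auto intro: computable_string_set_decidable)
    show "computable (\<lambda>p. H (fst p) (snd p))" using H(1) by (rule computable_string_bound_computable)
  qed (fact carrier assms(4) H(2) E J)+
  show ?thesis by (rule computably_tdlc_quotient)
qed

end
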